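(* Let $Z$ be a complete discrete valuation ring with fraction field $Q$, let $E$ be a commutative (finite-dimensional) semisimple $Q$-algebra, and let $R$ be a local Bass $Z$-order in $E$. Let $\sigma$ be a (possibly trivial) involution of $E/Q$ leaving $R$ stable, and let $V$ be a free $E$-module of finite rank with a non-degenerate sesquilinear pairing $\langle\ ,\ \rangle:V\times V\to E$. Let $M$ be a self-dual $R$-lattice in $(V,\langle\ ,\ \rangle)$ with structural invariants $R_1\subsetneq R_2\subsetneq\cdots\subsetneq R_m$ and $(r_1,\dots,r_m)$. For each $i$, let $\alpha_i$ be a fixed generator of the principal $R_i$-ideal $(R:R_i)=\{x\in E\mid xR_i\subseteq R\}$. Then there exists an orthogonal decomposition of $M$ into $R$-sublattices $$M=M_1\oplus\cdots\oplus M_m,\qquad \langle M_i,M_j\rangle=0\quad\text{for all }1\le i<j\le m,$$ where each $M_i$ is a free $R_i$-lattice of rank $r_i$, and the restriction $\langle\ ,\ \rangle_{M_i}:M_i\times M_i\to R$ of $\langle\ ,\ \rangle$ to $M_i$ is of the form $\alpha_i\langle\ ,\ \rangle_i$ for a perfect sesquilinear pairing $\langle\ ,\ \rangle_i:M_i\times M_i\to R_i$.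
   Context: A $Z$-order $R$ in $E$ (of full rank) is Gorenstein if $\mathrm{Hom}_Z(R,Z)$ is a projective $R$-module, and Bass if every order of $E$ containing $R$ is Gorenstein. An $R$-lattice in $V$ is a finitely generated $R$-submodule $M\subseteq V$ with $M\otimes_Z Q=V$. A sesquilinear pairing is a bi-additive pairing linear in the first variable and $\sigma$-linear in the second: $\langle ax,by\rangle=a\langle x,y\rangle b^\sigma$. A sesquilinear pairing $N\times N\to S$ on a lattice $N$ over a $\sigma$-stable order $S$ is perfect if $x\mapsto\langle\cdot,x\rangle$ is a bijection $N\to\mathrm{Hom}_S(N,S)$. $M$ is self-dual if $\langle M,M\rangle\subseteq R$ and the restricted pairing $M\times M\to R$ is perfect. Structural invariants: for every $R$-lattice $M$ in a free $E$-module there are a chain of $Z$-orders $R\subseteq R_1\subsetneq R_2\subsetneq\cdots\subsetneq R_m$ of $E$ and positive integers $(r_1,\dots,r_m)$, uniquely determined by $M$, with $M\simeq R_1^{r_1}\oplus\cdots\oplus R_m^{r_m}$ as $R$-lattices (Borevich–Faddeev). It is a fact that, for such $R$, each overorder of $R$ in $E$ is $\sigma$-stable and each $(R:R_i)$ is a principal $R_i$-ideal. *)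

theory Defs
  imports Complex_Main "HOL-Library.FuncSet" "HOL-Library.Function_Algebras"
begin

text \<open>
  The field Q, the algebra E and the E-module V are types; Z, the orders of E and the lattices
  in V are subsets of them.  Scalar actions are explicit functions in the style of
  \<^locale>\<open>module\<close> and \<^locale>\<open>vector_space\<close>.  Function spaces carry the pointwise
  group structure of \<^theory>\<open>HOL-Library.Function_Algebras\<close>.
\<close>

section \<open>Complete discrete valuation rings\<close>

text \<open>The value of \<open>v\<close> at 0 is irrelevant (it stands for infinity).\<close>

definition discrete_valuation :: "('q::field \<Rightarrow> int) \<Rightarrow> bool" where
  "discrete_valuation v \<longleftrightarrow>
     (\<forall>x y. x \<noteq> 0 \<longrightarrow> y \<noteq> 0 \<longrightarrow> v (x * y) = v x + v y) \<and>
     (\<forall>x y. x \<noteq> 0 \<longrightarrow> y \<noteq> 0 \<longrightarrow> x + y \<noteq> 0 \<longrightarrow> min (v x) (v y) \<le> v (x + y)) \<and>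
     v ` {x. x \<noteq> 0} = UNIV"

text \<open>
  \<open>Z\<close> is the valuation ring of a complete discrete valuation on the ambient field; in particular
  the ambient field is its fraction field.
\<close>

definition complete_dvr :: "'q::field set \<Rightarrow> bool" where
  "complete_dvr Z \<longleftrightarrow>
     (\<exists>v. discrete_valuation v \<and> Z = {x. x = 0 \<or> 0 \<le> v x} \<and>
       (\<forall>X :: nat \<Rightarrow> 'q.
          (\<forall>n. X n \<in> Z) \<longrightarrow>
          (\<forall>k. \<exists>N. \<forall>m\<ge>N. \<forall>n\<ge>N. X m = X n \<or> k \<le> v (X m - X n)) \<longrightarrow>
          (\<exists>l\<in>Z. \<forall>k. \<exists>N. \<forall>n\<ge>N. X n = l \<or> k \<le> v (X n - l))))"

section \<open>Modules over a subring\<close>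

definition is_subring :: "'a::comm_ring_1 set \<Rightarrow> bool" where
  "is_subring S \<longleftrightarrow> 1 \<in> S \<and> (\<forall>x\<in>S. \<forall>y\<in>S. x - y \<in> S \<and> x * y \<in> S)"

definition submodule_over ::
    "'a set \<Rightarrow> ('a \<Rightarrow> 'b::ab_group_add \<Rightarrow> 'b) \<Rightarrow> 'b set \<Rightarrow> bool" where
  "submodule_over S scale N \<longleftrightarrow>
     0 \<in> N \<and> (\<forall>x\<in>N. \<forall>y\<in>N. x + y \<in> N) \<and> (\<forall>a\<in>S. \<forall>x\<in>N. scale a x \<in> N)"

definition fg_over :: "'a set \<Rightarrow> ('a \<Rightarrow> 'b::ab_group_add \<Rightarrow> 'b) \<Rightarrow> 'b set \<Rightarrow> bool" where
  "fg_over S scale N \<longleftrightarrow>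
     (\<exists>B. finite B \<and> B \<subseteq> N \<and>
       (\<forall>x\<in>N. \<exists>c. (\<forall>b\<in>B. c b \<in> S) \<and> x = (\<Sum>b\<in>B. scale (c b) b)))"

definition free_over_of_rank ::
    "'a set \<Rightarrow> ('a \<Rightarrow> 'b::ab_group_add \<Rightarrow> 'b) \<Rightarrow> 'b set \<Rightarrow> nat \<Rightarrow> bool" where
  "free_over_of_rank S scale N n \<longleftrightarrow>
     submodule_over S scale N \<and>
     (\<exists>b :: nat \<Rightarrow> 'b. (\<forall>k<n. b k \<in> N) \<and>
       bij_betw (\<lambda>c. \<Sum>k<n. scale (c k) (b k)) ({..<n} \<rightarrow>\<^sub>E S) N)"

text \<open>
  \<open>Hom\<^sub>S(N, P)\<close>.  A map defined on \<open>N\<close> is represented by its extension by zero, so that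
  these maps form a subgroup of the full function space.
\<close>

definition hom_over ::
    "'a set \<Rightarrow> ('a \<Rightarrow> 'b::ab_group_add \<Rightarrow> 'b) \<Rightarrow> 'b set \<Rightarrow>
     ('a \<Rightarrow> 'c::ab_group_add \<Rightarrow> 'c) \<Rightarrow> 'c set \<Rightarrow> ('b \<Rightarrow> 'c) set" where
  "hom_over S scaleN N scaleP P =
     {f. (\<forall>x\<in>N. f x \<in> P) \<and> (\<forall>x. x \<notin> N \<longrightarrow> f x = 0) \<and>
         (\<forall>x\<in>N. \<forall>y\<in>N. f (x + y) = f x + f y) \<and>
         (\<forall>a\<in>S. \<forall>x\<in>N. f (scaleN a x) = scaleP a (f x))}"

text \<open>The free module on the set \<open>I\<close>: finitely supported families.\<close>

definition free_module_on :: "'a::comm_ring_1 set \<Rightarrow> 'i set \<Rightarrow> ('i \<Rightarrow> 'a) set" where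
  "free_module_on S I =
     {f. finite {i. f i \<noteq> 0} \<and> (\<forall>i\<in>I. f i \<in> S) \<and> (\<forall>i. i \<notin> I \<longrightarrow> f i = 0)}"

text \<open>
  A module is projective if it is a direct summand of a free module, i.e. if some free module
  retracts onto it.  Since \<open>P\<close> is a quotient of the free module on the set \<open>P\<close>, index sets in the
  type of \<open>P\<close> are no restriction.
\<close>

definition projective_over ::
    "'a::comm_ring_1 set \<Rightarrow> ('a \<Rightarrow> 'p::ab_group_add \<Rightarrow> 'p) \<Rightarrow> 'p set \<Rightarrow> bool" where
  "projective_over S scale P \<longleftrightarrow>
     (\<exists>I :: 'p set.
        \<exists>s \<in> hom_over S scale P (\<lambda>a f i. a * f i) (free_module_on S I).
        \<exists>p \<in> hom_over S (\<lambda>a f i. a * f i) (free_module_on S I) scale P.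
          \<forall>x\<in>P. p (s x) = x)"

section \<open>Algebras, orders\<close>

definition fd_algebra :: "('q::field \<Rightarrow> 'e::comm_ring_1 \<Rightarrow> 'e) \<Rightarrow> bool" where
  "fd_algebra scaleQ \<longleftrightarrow>
     vector_space scaleQ \<and> (\<forall>q x y. scaleQ q (x * y) = scaleQ q x * y) \<and>
     (\<exists>B. finite B \<and> module.span scaleQ B = UNIV)"

text \<open>
  A commutative ring is semisimple if every ideal has a complement; \<^term>\<open>module.subspace (*)\<close>
  are the ideals of the whole ring.
\<close>

definition semisimple_ring :: "'e::comm_ring_1 itself \<Rightarrow> bool" where
  "semisimple_ring _ \<longleftrightarrow>
     (\<forall>I :: 'e set. module.subspace (*) I \<longrightarrow>
       (\<exists>J. module.subspace (*) J \<and> I \<inter> J = {0} \<and> (\<forall>x. \<exists>a\<in>I. \<exists>b\<in>J. x = a + b)))"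

definition involution_over ::
    "('q::field \<Rightarrow> 'e::comm_ring_1 \<Rightarrow> 'e) \<Rightarrow> ('e \<Rightarrow> 'e) \<Rightarrow> bool" where
  "involution_over scaleQ \<sigma> \<longleftrightarrow>
     (\<forall>x y. \<sigma> (x + y) = \<sigma> x + \<sigma> y) \<and> (\<forall>x y. \<sigma> (x * y) = \<sigma> x * \<sigma> y) \<and> \<sigma> 1 = 1 \<and>
     (\<forall>q x. \<sigma> (scaleQ q x) = scaleQ q (\<sigma> x)) \<and> (\<forall>x. \<sigma> (\<sigma> x) = x)"

definition is_order ::
    "'q::field set \<Rightarrow> ('q \<Rightarrow> 'e::comm_ring_1 \<Rightarrow> 'e) \<Rightarrow> 'e set \<Rightarrow> bool" where
  "is_order Z scaleQ R \<longleftrightarrow>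
     is_subring R \<and> submodule_over Z scaleQ R \<and> fg_over Z scaleQ R \<and>
     module.span scaleQ R = UNIV"

definition local_subring :: "'e::comm_ring_1 set \<Rightarrow> bool" where
  "local_subring R \<longleftrightarrow>
     (\<exists>!I. I \<subset> R \<and> submodule_over R (*) I \<and>
        (\<forall>J. submodule_over R (*) J \<and> I \<subseteq> J \<and> J \<subset> R \<longrightarrow> J = I))"

text \<open>\<open>Hom\<^sub>Z(R, Z)\<close> is an \<open>R\<close>-module via \<open>(a f)(x) = f(a x)\<close>.\<close>

definition gorenstein ::
    "'q::field set \<Rightarrow> ('q \<Rightarrow> 'e::comm_ring_1 \<Rightarrow> 'e) \<Rightarrow> 'e set \<Rightarrow> bool" where
  "gorenstein Z scaleQ R \<longleftrightarrow>
     projective_over R (\<lambda>a f x. if x \<in> R then f (a * x) else 0) (hom_over Z scaleQ R (*) Z)"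

definition bass_order ::
    "'q::field set \<Rightarrow> ('q \<Rightarrow> 'e::comm_ring_1 \<Rightarrow> 'e) \<Rightarrow> 'e set \<Rightarrow> bool" where
  "bass_order Z scaleQ R \<longleftrightarrow>
     is_order Z scaleQ R \<and>
     (\<forall>S. is_order Z scaleQ S \<and> R \<subseteq> S \<longrightarrow> gorenstein Z scaleQ S)"

text \<open>The colon ideal \<open>(R : S)\<close>.\<close>

definition colon :: "'e::comm_ring_1 set \<Rightarrow> 'e set \<Rightarrow> 'e set" where
  "colon R S = {x. \<forall>y\<in>S. x * y \<in> R}"

section \<open>Lattices\<close>

definition free_finite_rank ::
    "('e::comm_ring_1 \<Rightarrow> 'v::ab_group_add \<Rightarrow> 'v) \<Rightarrow> bool" where
  "free_finite_rank scaleE \<longleftrightarrow>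
     module scaleE \<and>
     (\<exists>B. finite B \<and> \<not> module.dependent scaleE B \<and> module.span scaleE B = UNIV)"

text \<open>
  Since V is a Q-vector space, the canonical map from \<open>M \<otimes>\<^sub>Z Q\<close> to \<open>V\<close> is injective and
  its image is the Q-span of \<open>M\<close>, where \<open>q\<close> acts on \<open>V\<close> as \<open>q \<cdot> 1 \<in> E\<close>.
\<close>

definition lattice_in ::
    "('q::field \<Rightarrow> 'e::comm_ring_1 \<Rightarrow> 'e) \<Rightarrow> ('e \<Rightarrow> 'v::ab_group_add \<Rightarrow> 'v) \<Rightarrow>
     'e set \<Rightarrow> 'v set \<Rightarrow> bool" where
  "lattice_in scaleQ scaleE R M \<longleftrightarrow>
     submodule_over R scaleE M \<and> fg_over R scaleE M \<and>
     module.span (\<lambda>q. scaleE (scaleQ q 1)) M = UNIV"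

text \<open>
  The module \<open>R\<^sub>1\<^bsup>r\<^sub>1\<^esup> \<oplus> \<cdots> \<oplus> R\<^sub>m\<^bsup>r\<^sub>m\<^esup>\<close>, the coordinate \<open>(i, k)\<close> being the
  \<open>k\<close>-th coordinate in the \<open>i\<close>-th block.
\<close>

definition block_sum ::
    "nat \<Rightarrow> (nat \<Rightarrow> 'e::comm_ring_1 set) \<Rightarrow> (nat \<Rightarrow> nat) \<Rightarrow> (nat \<times> nat \<Rightarrow> 'e) set" where
  "block_sum m Rs r =
     {f. \<forall>i k. (i \<in> {1..m} \<and> k < r i \<longrightarrow> f (i, k) \<in> Rs i) \<and>
               (\<not> (i \<in> {1..m} \<and> k < r i) \<longrightarrow> f (i, k) = 0)}"

definition structural_invariants ::
    "'q::field set \<Rightarrow> ('q \<Rightarrow> 'e::comm_ring_1 \<Rightarrow> 'e) \<Rightarrow> ('e \<Rightarrow> 'v::ab_group_add \<Rightarrow> 'v) \<Rightarrow>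
     'e set \<Rightarrow> 'v set \<Rightarrow> nat \<Rightarrow> (nat \<Rightarrow> 'e set) \<Rightarrow> (nat \<Rightarrow> nat) \<Rightarrow> bool" where
  "structural_invariants Z scaleQ scaleE R M m Rs r \<longleftrightarrow>
     (\<forall>i\<in>{1..m}. is_order Z scaleQ (Rs i) \<and> R \<subseteq> Rs i \<and> 0 < r i) \<and>
     (\<forall>i\<in>{1..<m}. Rs i \<subset> Rs (Suc i)) \<and>
     (\<exists>\<phi> \<in> hom_over R scaleE M (\<lambda>a f j. a * f j) (block_sum m Rs r).
        bij_betw \<phi> M (block_sum m Rs r))"

definition internal_direct_sum ::
    "nat \<Rightarrow> (nat \<Rightarrow> 'v::ab_group_add set) \<Rightarrow> 'v set \<Rightarrow> bool" where
  "internal_direct_sum m Ms M \<longleftrightarrow>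
     bij_betw (\<lambda>x. \<Sum>i\<in>{1..m}. x i) (\<Pi>\<^sub>E i\<in>{1..m}. Ms i) M"

section \<open>Sesquilinear pairings\<close>

text \<open>\<open>sesquilinear_over S \<sigma> scale N p\<close>: \<open>p\<close> restricts to a sesquilinear pairing \<open>N \<times> N \<rightarrow> S\<close>.\<close>

definition sesquilinear_over ::
    "'e::comm_ring_1 set \<Rightarrow> ('e \<Rightarrow> 'e) \<Rightarrow> ('e \<Rightarrow> 'v::ab_group_add \<Rightarrow> 'v) \<Rightarrow>
     'v set \<Rightarrow> ('v \<Rightarrow> 'v \<Rightarrow> 'e) \<Rightarrow> bool" where
  "sesquilinear_over S \<sigma> scale N p \<longleftrightarrow>
     (\<forall>x\<in>N. \<forall>y\<in>N. p x y \<in> S) \<and>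
     (\<forall>x\<in>N. \<forall>y\<in>N. \<forall>z\<in>N. p (x + y) z = p x z + p y z) \<and>
     (\<forall>x\<in>N. \<forall>y\<in>N. \<forall>z\<in>N. p x (y + z) = p x y + p x z) \<and>
     (\<forall>a\<in>S. \<forall>b\<in>S. \<forall>x\<in>N. \<forall>y\<in>N. p (scale a x) (scale b y) = a * p x y * \<sigma> b)"

definition nondegenerate :: "('v::ab_group_add \<Rightarrow> 'v \<Rightarrow> 'e::comm_ring_1) \<Rightarrow> bool" where
  "nondegenerate p \<longleftrightarrow>
     (\<forall>x. (\<forall>y. p x y = 0) \<longrightarrow> x = 0) \<and> (\<forall>y. (\<forall>x. p x y = 0) \<longrightarrow> y = 0)"

definition perfect_over ::
    "'e::comm_ring_1 set \<Rightarrow> ('e \<Rightarrow> 'v::ab_group_add \<Rightarrow> 'v) \<Rightarrow> 'v set \<Rightarrow>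
     ('v \<Rightarrow> 'v \<Rightarrow> 'e) \<Rightarrow> bool" where
  "perfect_over S scale N p \<longleftrightarrow>
     bij_betw (\<lambda>x y. if y \<in> N then p y x else 0) N (hom_over S scale N (*) S)"

definition self_dual ::
    "'e::comm_ring_1 set \<Rightarrow> ('e \<Rightarrow> 'v::ab_group_add \<Rightarrow> 'v) \<Rightarrow> ('v \<Rightarrow> 'v \<Rightarrow> 'e) \<Rightarrow>
     'v set \<Rightarrow> bool" where
  "self_dual R scale p M \<longleftrightarrow>
     (\<forall>x\<in>M. \<forall>y\<in>M. p x y \<in> R) \<and> perfect_over R scale M p"

end

theory Submission
  imports Defs
begin

text \<open>
  Let \<open>S\<close> be a local Gorenstein order with maximal ideal \<open>\<mm>\<close> and \<open>T\<close> a strictly larger order.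
  By duality \<open>(S : \<mm>) / S\<close> is simple, so \<open>T\<close> contains the multiplier ring
  \<open>S' = (\<mm> : \<mm>)\<close>, which is strictly larger than \<open>S\<close>. If \<open>\<mm>\<close> is a radical ideal of \<open>S'\<close>, then \<open>S'\<close>
  is a maximal order; otherwise some \<open>y \<in> S' - \<mm>\<close> has \<open>y\<^sup>2 \<in> \<mm>\<close>, and \<open>S' = S + S y\<close> is again local.
  Iterating from a local Bass order \<open>R\<close>, every overorder of \<open>R\<close> is \<open>\<sigma>\<close>-stable and is local or
  maximal; in particular \<open>R\<^sub>1, \<dots>, R\<^sub>m\<^sub>-\<^sub>1\<close> are local.

  Since \<open>(R : R\<^sub>j)\<close> lies in \<open>\<alpha>\<^sub>i\<close> times the maximal ideal of \<open>R\<^sub>i\<close> for \<open>i < j\<close>, Nakayama's lemma shows that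
  \<open>\<alpha>\<^sub>1\<^sup>-\<^sup>1\<langle> , \<rangle>\<close> is perfect on any block of \<open>M\<close> isomorphic to \<open>R\<^sub>1\<^bsup>r\<^sub>1\<^esup>\<close>; this block splits off
  orthogonally, and the remaining blocks are treated in the same way.
\<close>

section \<open>Finitely generated modules over discrete valuation rings\<close>

text \<open>The cost of splitting off a block is compatibility with the larger orders. The
  projection of a generator with order R_j to the block of R_i lies in that block, which is only an
  R_i-module, while the complement is an R_j-lattice only if all R_j-multiples of the projection
  stay in the block. Nondegeneracy on the E-span of the block settles this: a multiple of the
  projection must be the projection of the multiple. Nondegeneracy comes from perfectness, which is
  carried along only as surjectivity onto the dual: a surjective endomorphism of a Noetherian module
  is injective. The blocks are taken by increasing order, since only then do the pairings linking a
  block to the remaining ones become non-units after division by \<alpha>_i. The last order may be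
  maximal without being local, but at that stage no other block is left. Scalars leave the second
  argument through \<sigma>, so \<sigma>-stability of the overorders is what puts pairings against a
  generator of order R_j into (R : R_j). The pairing need not be hermitian; the corrected generators
  become orthogonal to the block standing in the left argument.\<close>

definition span_over :: "'a set \<Rightarrow> ('a \<Rightarrow> 'b::ab_group_add \<Rightarrow> 'b) \<Rightarrow> 'b set \<Rightarrow> 'b set" where
  "span_over S scale B = {\<Sum>b\<in>B. scale (c b) b | c. \<forall>b\<in>B. c b \<in> S}"

lemma fg_over_iff:
  "fg_over S scale N \<longleftrightarrow> (\<exists>B. finite B \<and> B \<subseteq> N \<and> N \<subseteq> span_over S scale B)"
  by (simp add: fg_over_def span_over_def subset_iff Ball_def conj_commute)

lemma span_overI: "\<forall>b\<in>B. c b \<in> S \<Longrightarrow> (\<Sum>b\<in>B. scale (c b) b) \<in> span_over S scale B"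
  unfolding span_over_def mem_Collect_eq by (rule exI[of _ c]) simp

lemma span_overE:
  assumes "x \<in> span_over S scale B"
  obtains c where "\<forall>b\<in>B. c b \<in> S" "x = (\<Sum>b\<in>B. scale (c b) b)"
  using assms unfolding span_over_def mem_Collect_eq by (elim exE conjE) (rule that)

lemma submodule_over_sum:
  assumes "submodule_over S scale N" "\<And>i. i \<in> I \<Longrightarrow> f i \<in> N"
  shows "sum f I \<in> N"
  using assms(2)
proof (induction I rule: infinite_finite_induct)
  case (insert x F)
  then show ?case using assms(1) by (auto simp: submodule_over_def)
qed (use assms(1) in \<open>auto simp: submodule_over_def\<close>)

lemma submodule_overD:
  assumes "submodule_over S scale N"
  shows "0 \<in> N" "\<And>x y. x \<in> N \<Longrightarrow> y \<in> N \<Longrightarrow> x + y \<in> N"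
    "\<And>a x. a \<in> S \<Longrightarrow> x \<in> N \<Longrightarrow> scale a x \<in> N"
  using assms by (simp_all add: submodule_over_def)

lemma submodule_over_chain_Union:
  assumes C: "\<C> \<noteq> {}" "\<And>N. N \<in> \<C> \<Longrightarrow> submodule_over S scale N"
    and chain: "subset.chain \<A> \<C>"
  shows "submodule_over S scale (\<Union>\<C>)"
  unfolding submodule_over_def
proof (intro conjI ballI)
  have cmp: "X \<subseteq> Y \<or> Y \<subseteq> X" if "X \<in> \<C>" "Y \<in> \<C>" for X Y
    using chain that unfolding subset.chain_def by blast
  from C(1) obtain N where "N \<in> \<C>" by blast
  then show "0 \<in> \<Union>\<C>" using submodule_overD(1)[OF C(2)] by blast
  fix x assume x: "x \<in> \<Union>\<C>"
  show "scale a x \<in> \<Union>\<C>" if "a \<in> S" for a 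
    using x submodule_overD(3)[OF C(2) that] by blast
  fix y assume "y \<in> \<Union>\<C>"
  with x obtain X Y where XY: "X \<in> \<C>" "Y \<in> \<C>" "x \<in> X" "y \<in> Y" by blast
  with cmp have "(x \<in> Y \<and> y \<in> Y) \<or> (x \<in> X \<and> y \<in> X)" by blast
  with XY show "x + y \<in> \<Union>\<C>" using submodule_overD(2)[OF C(2)] by blast
qed

lemma span_over_least:
  assumes "submodule_over S scale N" "B \<subseteq> N"
  shows "span_over S scale B \<subseteq> N"
proof
  fix x assume "x \<in> span_over S scale B"
  then obtain c where c: "\<forall>b\<in>B. c b \<in> S" "x = (\<Sum>b\<in>B. scale (c b) b)" by (rule span_overE)
  show "x \<in> N" unfolding c(2)
    by (rule submodule_over_sum[OF assms(1)]) (use assms c(1) in \<open>auto simp: submodule_over_def\<close>)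
qed

lemma is_subringD:
  assumes "is_subring S"
  shows "0 \<in> S" "1 \<in> S" "\<And>x y. x \<in> S \<Longrightarrow> y \<in> S \<Longrightarrow> x - y \<in> S"
    "\<And>x y. x \<in> S \<Longrightarrow> y \<in> S \<Longrightarrow> x * y \<in> S" "\<And>x y. x \<in> S \<Longrightarrow> y \<in> S \<Longrightarrow> x + y \<in> S"
    "\<And>x. x \<in> S \<Longrightarrow> - x \<in> S"
proof -
  show 1: "1 \<in> S" and 2: "\<And>x y. x \<in> S \<Longrightarrow> y \<in> S \<Longrightarrow> x - y \<in> S"
    and "\<And>x y. x \<in> S \<Longrightarrow> y \<in> S \<Longrightarrow> x * y \<in> S"
    using assms by (auto simp: is_subring_def)
  show 0: "0 \<in> S" using 2[OF 1 1] by simp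
  show 3: "\<And>x. x \<in> S \<Longrightarrow> - x \<in> S" using 2[OF 0] by simp
  show "\<And>x y. x \<in> S \<Longrightarrow> y \<in> S \<Longrightarrow> x + y \<in> S" using 2 3 by (metis diff_minus_eq_add)
qed

lemma subring_power: "is_subring S \<Longrightarrow> x \<in> S \<Longrightarrow> x ^ n \<in> S"
  by (induction n) (auto simp: is_subringD)

lemma submodule_over_span_over:
  assumes S: "is_subring S" and "module scale"
  shows "submodule_over S scale (span_over S scale B)"
proof -
  interpret module scale by fact
  have "0 = (\<Sum>b\<in>B. scale ((\<lambda>_. 0) b) b)" by simp
  also have "\<dots> \<in> span_over S scale B" by (rule span_overI) (simp add: is_subringD[OF S])
  finally have 0: "0 \<in> span_over S scale B" .
  moreover have "x + y \<in> span_over S scale B" 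
    if "x \<in> span_over S scale B" "y \<in> span_over S scale B" for x y
  proof -
    from that obtain c where "\<forall>b\<in>B. c b \<in> S" "x = (\<Sum>b\<in>B. scale (c b) b)" by (auto elim: span_overE)
    moreover from that obtain d where
      "\<forall>b\<in>B. d b \<in> S" "y = (\<Sum>b\<in>B. scale (d b) b)" by (auto elim: span_overE)
    ultimately show ?thesis using span_overI[of B "\<lambda>b. c b + d b" S scale]
      by (simp add: is_subringD[OF S] scale_left_distrib sum.distrib)
  qed
  moreover have "scale a x \<in> span_over S scale B" 
    if "x \<in> span_over S scale B" "a \<in> S" for x a
  proof -
    from that obtain c where "\<forall>b\<in>B. c b \<in> S" "x = (\<Sum>b\<in>B. scale (c b) b)" by (auto elim: span_overE)
    then show ?thesis using span_overI[of B "\<lambda>b. a * c b" S scale] that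
      by (simp add: is_subringD[OF S] scale_sum_right)
  qed
  ultimately show ?thesis by (simp add: submodule_over_def)
qed

lemma span_over_superset:
  assumes S: "is_subring S" and "module scale" "finite B"
  shows "B \<subseteq> span_over S scale B"
proof
  fix b assume b: "b \<in> B"
  interpret module scale by fact
  have "b = (\<Sum>a\<in>B. if a = b then a else 0)" using b assms by simp
  also have "\<dots> = (\<Sum>a\<in>B. scale (if a = b then 1 else 0) a)" by (rule sum.cong) auto
  also have "\<dots> \<in> span_over S scale B" by (rule span_overI) (simp add: is_subringD[OF S])
  finally show "b \<in> span_over S scale B" .
qed

section \<open>Noetherian arguments over a discrete valuation ring\<close>

locale dvr =
  fixes v :: "'q::field \<Rightarrow> int" and Z :: "'q set"
  assumes val: "discrete_valuation v" and Z_eq: "Z = {x. x = 0 \<or> 0 \<le> v x}"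
begin

lemma v_mult: "x \<noteq> 0 \<Longrightarrow> y \<noteq> 0 \<Longrightarrow> v (x * y) = v x + v y"
  using val by (simp add: discrete_valuation_def)

lemma v_add: "x \<noteq> 0 \<Longrightarrow> y \<noteq> 0 \<Longrightarrow> x + y \<noteq> 0 \<Longrightarrow> min (v x) (v y) \<le> v (x + y)"
  using val by (simp add: discrete_valuation_def)

lemma v_one: "v 1 = 0"
  using v_mult[of 1 1] by simp

lemma v_uminus: "v (- x) = v x"
proof (cases "x = 0")
  case False
  have "v (-1) = 0" using v_mult[of "-1" "-1"] by (simp add: v_one)
  then show ?thesis using v_mult[of "-1" x] False by simp
qed simp

lemma v_divide: "x \<noteq> 0 \<Longrightarrow> y \<noteq> 0 \<Longrightarrow> v (x / y) = v x - v y"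
  using v_mult[of "x / y" y] by simp

lemma divide_in_Z: "y \<noteq> 0 \<Longrightarrow> x = 0 \<or> v y \<le> v x \<Longrightarrow> x / y \<in> Z"
  by (cases "x = 0") (auto simp: Z_eq v_divide)

lemma subring_Z: "is_subring Z"
  unfolding is_subring_def
proof (intro conjI ballI)
  show "1 \<in> Z" by (simp add: Z_eq v_one)
  fix x y assume xy: "x \<in> Z" "y \<in> Z"
  show "x * y \<in> Z" using xy by (cases "x = 0 \<or> y = 0") (auto simp: Z_eq v_mult)
  show "x - y \<in> Z" using xy v_add[of x "- y"] v_uminus[of y]
    by (cases "x = 0 \<or> y = 0 \<or> x = y") (auto simp: Z_eq)
qed

lemmas Z_closed = is_subringD[OF subring_Z]

definition unif :: 'q where "unif = (SOME x. x \<noteq> 0 \<and> v x = 1)"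

lemma unif: "unif \<noteq> 0" "v unif = 1"
proof -
  have "1 \<in> v ` {x. x \<noteq> 0}" using val by (simp add: discrete_valuation_def)
  then have "\<exists>x. x \<noteq> 0 \<and> v x = 1" by force
  from someI_ex[OF this] show "unif \<noteq> 0" "v unif = 1" by (auto simp: unif_def)
qed

lemma unif_in_Z: "unif \<in> Z" using unif by (simp add: Z_eq)

lemma v_unif_power: "v (unif ^ n) = int n"
  by (induction n) (use unif in \<open>auto simp: v_one v_mult\<close>)

lemma finite_common_denom:
  assumes "finite A"
  shows "\<exists>n. \<forall>a\<in>A. unif ^ n * a \<in> Z"
  using assms
proof induction
  case (insert a A)
  then obtain n where n: "\<forall>a\<in>A. unif ^ n * a \<in> Z" by blast
  define k where "k = nat (- v a)"
  have "unif ^ k * a \<in> Z" using unif by (cases "a = 0") (auto simp: Z_eq v_mult v_unif_power k_def)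
  then have "unif ^ n * (unif ^ k * a) \<in> Z" using Z_closed(4)[OF subring_power[OF subring_Z unif_in_Z]] by simp
  moreover have "unif ^ k * (unif ^ n * b) \<in> Z" if "b \<in> A" for b
    using Z_closed(4)[OF subring_power[OF subring_Z unif_in_Z]] n that by simp
  ultimately have "\<forall>b\<in>insert a A. unif ^ (n + k) * b \<in> Z"
    by (auto simp: power_add mult_ac)
  then show ?case by blast
qed simp

text \<open>Scaling by an entry of least valuation makes a family of coefficients integral with one
  entry equal to 1. Bases of lattices and algebraic relations of elements both rest on this
  normalisation.\<close>

lemma finite_min_valuation:
  assumes "finite A" "\<exists>a\<in>A. c a \<noteq> 0"
  obtains a where "a \<in> A" "c a \<noteq> 0" "\<forall>b\<in>A. c b / c a \<in> Z"
proof -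
  let ?A = "{a\<in>A. c a \<noteq> 0}"
  have "finite ?A" "?A \<noteq> {}" using assms by auto
  then obtain a where "a \<in> ?A" "\<forall>b\<in>?A. v (c a) \<le> v (c b)"
    using arg_min_if_finite(1)[of ?A "v \<circ> c"] arg_min_least[of ?A _ "v \<circ> c"] by fastforce
  then show ?thesis by (intro that[of a]) (auto intro!: divide_in_Z)
qed

text \<open>Noetherianity by induction on the generators: \<open>N\<close> is generated by its part
  inside the span of \<open>B\<close> and one further element whose coefficient at \<open>b\<close>
  has least valuation. The generators need not be independent, so a coefficient belongs to a chosen
  representation rather than to the element.\<close>

lemma fg_submodule_aux:
  assumes vs: "vector_space scale" and "finite B"
  shows "submodule_over Z scale N \<Longrightarrow> N \<subseteq> span_over Z scale B \<Longrightarrow> fg_over Z scale N"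
  using assms(2)
proof (induction B arbitrary: N)
  case empty
  interpret vector_space scale by fact
  from empty have "N = {0}" by (auto simp: span_over_def submodule_over_def)
  then show ?case unfolding fg_over_def by (intro exI[of _ "{0}"]) (simp add: exI[of _ "\<lambda>_. 0"] Z_closed(1))
next
  case (insert b B)
  interpret vector_space scale by fact
  have md: "module scale" by unfold_locales
  note sub = insert.prems(1)
  let ?L = "span_over Z scale B"
  note subL = submodule_over_span_over[OF subring_Z md, of B]
  have cb: "\<exists>c\<in>Z. \<exists>y\<in>?L. x = scale c b + y" if x: "x \<in> N" for x
  proof -
    from x insert.prems(2) have "x \<in> span_over Z scale (insert b B)" by blast
    then obtain c where "\<forall>a\<in>insert b B. c a \<in> Z" "x = (\<Sum>a\<in>insert b B. scale (c a) a)"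
      by (rule span_overE)
    then show ?thesis using insert.hyps span_overI[of B c Z scale] by force
  qed
  have sub': "submodule_over Z scale (N \<inter> ?L)" using sub subL by (auto simp: submodule_over_def)
  obtain B' where B': "finite B'" "B' \<subseteq> N \<inter> ?L" "N \<inter> ?L \<subseteq> span_over Z scale B'"
    using insert.IH[OF sub'] by (auto simp: fg_over_iff)
  show ?case
  proof (cases "\<exists>c\<in>Z. c \<noteq> 0 \<and> (\<exists>y\<in>?L. scale c b + y \<in> N)")
    case False
    have L: "N \<subseteq> ?L"
    proof
      fix x assume x: "x \<in> N"
      with cb[OF x] False show "x \<in> ?L" by (metis scale_zero_left add.left_neutral)
    qed
    then show ?thesis using insert.IH[OF sub] by simp
  next
    case True
    let ?P = "\<lambda>c. c \<in> Z \<and> c \<noteq> 0 \<and> (\<exists>y\<in>?L. scale c b + y \<in> N)"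
    \<comment> \<open>Nonzero elements of \<open>Z\<close> have nonnegative valuation, so
      \<open>nat\<close> loses nothing and a least valuation exists.\<close>
    from True obtain c0 where "?P c0" and min: "\<And>c. ?P c \<Longrightarrow> nat (v c0) \<le> nat (v c)"
      using ex_has_least_nat[of ?P _ "\<lambda>c. nat (v c)"] by metis
    then have c0: "?P c0" by blast
    have c0_min: "v c0 \<le> v c" if "?P c" for c
    proof -
      have "nat (v c0) \<le> nat (v c)" by (rule min) (rule that)
      moreover have "0 \<le> v c" using that by (auto simp: Z_eq)
      ultimately show ?thesis by linarith
    qed
    from c0 obtain y0 where y0: "y0 \<in> ?L" "scale c0 b + y0 \<in> N" by blast
    let ?n = "scale c0 b + y0"
    let ?B = "insert ?n B'"
    note spB = submodule_over_span_over[OF subring_Z md, of ?B]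
    have BB: "?B \<subseteq> span_over Z scale ?B" by (rule span_over_superset[OF subring_Z md]) (use B' in auto)
    have "N \<subseteq> span_over Z scale ?B"
    proof
      fix x assume x: "x \<in> N"
      with cb obtain c y where cy: "c \<in> Z" "y \<in> ?L" "x = scale c b + y" by blast
      have d: "c / c0 \<in> Z" by (rule divide_in_Z) (use c0 c0_min[of c] cy x in auto)
      let ?y = "y + scale (- (c / c0)) y0"
      have e: "x = scale (c / c0) ?n + ?y" using c0(1) by (simp add: cy scale_right_distrib)
      have "?y = x + scale (- (c / c0)) ?n" using c0(1) by (simp add: cy scale_right_distrib)
      moreover have "x + scale (- (c / c0)) ?n \<in> N" 
        by (intro submodule_overD(2,3)[OF sub] Z_closed(6) x y0 d)
      moreover have "?y \<in> ?L"
        by (intro submodule_overD(2,3)[OF subL] Z_closed(6) cy y0 d)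
      ultimately have "?y \<in> N \<inter> ?L" by simp
      then have "?y \<in> span_over Z scale ?B" 
        using B' span_over_least[OF spB, of B'] BB by blast
      then show "x \<in> span_over Z scale ?B" unfolding e
        using spB BB d by (auto simp: submodule_over_def)
    qed
    then show ?thesis using B' y0 by (auto simp: fg_over_iff intro!: exI[of _ ?B])
  qed
qed

lemma fg_submodule:
  assumes "vector_space scale" "fg_over Z scale L" "submodule_over Z scale N" "N \<subseteq> L"
  shows "fg_over Z scale N"
proof -
  obtain B where "finite B" "L \<subseteq> span_over Z scale B" using assms(2) by (auto simp: fg_over_iff)
  then show ?thesis by (intro fg_submodule_aux[OF assms(1) _ assms(3)]) (use assms(4) in auto)
qed

text \<open>The union is finitely generated, and its finitely many generators already lie in one
  member of the chain. This is the ascending chain condition in a form that fits both Zorn's lemma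
  and increasing kernels.\<close>

lemma chain_Union_mem:
  assumes vs: "vector_space scale" and fg: "fg_over Z scale L" 
    and C: "\<C> \<noteq> {}" "\<And>N. N \<in> \<C> \<Longrightarrow> submodule_over Z scale N \<and> N \<subseteq> L" 
    and chain: "subset.chain UNIV \<C>"
  shows "\<Union>\<C> \<in> \<C>"
proof -
  have "submodule_over Z scale (\<Union>\<C>)"
    by (rule submodule_over_chain_Union[OF C(1) _ chain]) (use C(2) in blast)
  then have "fg_over Z scale (\<Union>\<C>)" by (rule fg_submodule[OF vs fg]) (use C in blast)
  then obtain B where B: "finite B" "B \<subseteq> \<Union>\<C>" "\<Union>\<C> \<subseteq> span_over Z scale B" by (auto simp: fg_over_iff)
  obtain N where N: "N \<in> \<C>" "B \<subseteq> N"
    using finite_subset_Union_chain[OF B(1,2) C(1) chain] by blast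
  have "span_over Z scale B \<subseteq> N" by (rule span_over_least) (use N C in auto)
  then have "\<Union>\<C> = N" using N B by blast
  then show ?thesis using N by simp
qed

text \<open>The kernels of the iterates of \<open>f\<close> become stationary at some
  \<open>n\<close>. If \<open>x\<close> is written as the \<open>n\<close>-th iterate at
  \<open>y\<close>, then \<open>f x = 0\<close> puts \<open>y\<close> into the next kernel, hence
  into the \<open>n\<close>-th one, so \<open>x = 0\<close>.\<close>

lemma surj_imp_inj_on_fg:
  assumes vs: "vector_space scale" and fg: "fg_over Z scale N" and sub: "submodule_over Z scale N"
    and f: "\<And>x y. x \<in> N \<Longrightarrow> y \<in> N \<Longrightarrow> f (x + y) = f x + f y"
      "\<And>a x. a \<in> Z \<Longrightarrow> x \<in> N \<Longrightarrow> f (scale a x) = scale a (f x)"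
    and surj: "f ` N = N" and x: "x \<in> N" "f x = 0"
  shows "x = 0"
proof -
  interpret vector_space scale by fact
  have fN: "(f ^^ n) y \<in> N" if "y \<in> N" for n y
    using that surj by (induction n) auto
  have lin: "(f ^^ n) (y + z) = (f ^^ n) y + (f ^^ n) z" "a \<in> Z \<Longrightarrow> (f ^^ n) (scale a y) = scale a ((f ^^ n) y)"
    if "y \<in> N" "z \<in> N" for n y z a
    using that by (induction n) (auto simp: f fN)
  define K where "K n = {y\<in>N. (f ^^ n) y = 0}" for n
  have 00: "0 \<in> N" using sub by (simp add: submodule_over_def)
  have f0: "f 0 = 0" using f(1)[of 0 0] 00 by simp
  have fn0: "(f ^^ n) 0 = 0" for n by (induction n) (auto simp: f0)
  have Ksub: "submodule_over Z scale (K n)" for n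
    using sub 00 by (auto simp: submodule_over_def K_def lin fn0)
  have mono: "K n \<subseteq> K (Suc n)" for n by (auto simp: K_def f0)
  have mono': "K n \<subseteq> K k" if "n \<le> k" for n k using lift_Suc_mono_le[of K n k] mono that by blast
  have "\<Union>(range K) \<in> range K"
  proof (rule chain_Union_mem[OF vs fg])
    show "subset.chain UNIV (range K)" 
    proof -
      have "K i \<subseteq> K j \<or> K j \<subseteq> K i" for i j using mono'[of i j] mono'[of j i] by linarith
      then show ?thesis by (auto simp: subset_chain_def)
    qed
    show "submodule_over Z scale X \<and> X \<subseteq> N" if "X \<in> range K" for X
      using that Ksub by (auto simp: K_def)
  qed simp
  then obtain n where n: "\<Union>(range K) = K n" by blast
  have "\<exists>y\<in>N. (f ^^ k) y = x" for k
  proof (induction k)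
    case (Suc k)
    then obtain y where "y \<in> N" "(f ^^ k) y = x" by blast
    moreover obtain y' where "y' \<in> N" "f y' = y" using surj \<open>y \<in> N\<close> by (metis imageE)
    moreover have "(f ^^ Suc k) y' = (f ^^ k) (f y')" by (simp only: funpow_Suc_right comp_apply)
    ultimately show ?case by auto
  qed (use x in auto)
  then obtain y where y: "y \<in> N" "(f ^^ n) y = x" by blast
  then have "y \<in> K (Suc n)" using x by (simp add: K_def)
  then have "y \<in> K n" using n by blast
  then show ?thesis using y by (simp add: K_def)
qed

text \<open>A generating set of least cardinality is independent even over the field: a relation
  divided by its coefficient of least valuation would express one generator through the others over
  \<open>Z\<close>.\<close>

lemma fg_basis:
  assumes vs: "vector_space scale" and fg: "fg_over Z scale N"
  obtains B where "finite B" "B \<subseteq> N" "N \<subseteq> span_over Z scale B" "\<not> module.dependent scale B"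
proof -
  interpret vector_space scale by fact
  have md: "module scale" by unfold_locales
  let ?P = "\<lambda>B. finite B \<and> B \<subseteq> N \<and> N \<subseteq> span_over Z scale B"
  from fg have "\<exists>B. ?P B" by (simp add: fg_over_iff)
  then obtain B0 where B0: "?P B0" by blast
  obtain B where B: "?P B" and min: "\<forall>B'. ?P B' \<longrightarrow> card B \<le> card B'"
    using ex_has_least_nat[of ?P B0 card, OF B0] by (elim exE conjE) (rule that; blast)
  have "independent B"
  proof
    assume "dependent B"
    then obtain c where c: "\<exists>b\<in>B. c b \<noteq> 0" "(\<Sum>b\<in>B. scale (c b) b) = 0"
      using dependent_finite[of B] B by auto
    obtain a where a: "a \<in> B" "c a \<noteq> 0" "\<forall>b\<in>B. c b / c a \<in> Z"
      using finite_min_valuation[of B c] B c(1) by auto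
    let ?B = "B - {a}"
    note spB = submodule_over_span_over[OF subring_Z md, of ?B]
    have BB: "?B \<subseteq> span_over Z scale ?B" by (rule span_over_superset[OF subring_Z md]) (use B in auto)
    have "scale (c a) a + (\<Sum>b\<in>?B. scale (c b) b) = 0" 
      using c(2) sum.remove[of B a "\<lambda>b. scale (c b) b"] a(1) B by simp
    then have "scale (1 / c a) (scale (c a) a + (\<Sum>b\<in>?B. scale (c b) b)) = 0" by simp
    then have "a + (\<Sum>b\<in>?B. scale (c b / c a) b) = 0" 
      using a(2) by (simp add: scale_right_distrib scale_sum_right)
    then have "a = - (\<Sum>b\<in>?B. scale (c b / c a) b)" by (simp add: eq_neg_iff_add_eq_0)
    also have "\<dots> = (\<Sum>b\<in>?B. scale (- (c b / c a)) b)" by (simp add: sum_negf)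
    also have "\<dots> \<in> span_over Z scale ?B" by (rule span_overI) (use a(3) Z_closed in auto)
    finally have "B \<subseteq> span_over Z scale ?B" using BB by blast
    have "N \<subseteq> span_over Z scale ?B" 
      by (rule order_trans[OF _ span_over_least[OF spB \<open>B \<subseteq> span_over Z scale ?B\<close>]]) (use B in simp)
    with B have "?P ?B" by auto
    with min have "card B \<le> card ?B" by blast
    then show False using card_Diff1_less[of B a] B a(1) by simp
  qed
  with B show ?thesis by (intro that) auto
qed

end

section \<open>Orders and local rings\<close>

definition maximal_ideal :: "'e::comm_ring_1 set \<Rightarrow> 'e set" where
  "maximal_ideal S = (THE I. I \<subset> S \<and> submodule_over S (*) I \<and>
        (\<forall>J. submodule_over S (*) J \<and> I \<subseteq> J \<and> J \<subset> S \<longrightarrow> J = I))"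

lemma submodule_over_self: "is_subring S \<Longrightarrow> submodule_over S (*) S"
  by (simp add: submodule_over_def is_subringD)

lemma ideal_eq_if_one_mem:
  fixes S :: "'e::comm_ring_1 set"
  assumes "submodule_over S (*) I" "1 \<in> I" "I \<subseteq> S"
  shows "I = S"
proof -
  have "x \<in> I" if "x \<in> S" for x using submodule_overD(3)[OF assms(1) that assms(2)] by simp
  then show ?thesis using assms(3) by blast
qed

section \<open>Units and the maximal ideal of a local subring\<close>

context
  fixes S :: "'e::comm_ring_1 set"
  assumes S: "is_subring S" and loc: "local_subring S"
begin

lemma maximal_ideal:
  shows maximal_ideal_proper: "maximal_ideal S \<subset> S" 
    and maximal_ideal_ideal: "submodule_over S (*) (maximal_ideal S)"
  using theI'[OF loc[unfolded local_subring_def]] unfolding maximal_ideal_def by blast+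

lemma maximal_ideal_eqI:
  assumes "I \<subset> S" "submodule_over S (*) I" 
    "\<And>J. submodule_over S (*) J \<Longrightarrow> I \<subseteq> J \<Longrightarrow> J \<subset> S \<Longrightarrow> J = I"
  shows "maximal_ideal S = I"
  unfolding maximal_ideal_def
  by (rule the1_equality[OF loc[unfolded local_subring_def]]) (use assms in blast)

lemma one_notin_maximal_ideal: "1 \<notin> maximal_ideal S"
  using ideal_eq_if_one_mem[OF maximal_ideal_ideal] maximal_ideal_proper by blast

text \<open>Locality is defined through maximal ideals only. A non-unit generates an ideal that
  misses 1; Zorn's lemma enlarges it to a maximal ideal, and uniqueness identifies that ideal with
  the given one.\<close>

lemma local_unit:
  assumes x: "x \<in> S" "x \<notin> maximal_ideal S"
  obtains y where "y \<in> S" "x * y = 1"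
proof -
  have "\<exists>y\<in>S. x * y = 1"
  proof (rule ccontr)
    assume nu: "\<not> (\<exists>y\<in>S. x * y = 1)"
    let ?A = "{J. submodule_over S (*) J \<and> J \<subseteq> S \<and> x \<in> J \<and> 1 \<notin> J}"
    let ?X = "(\<lambda>y. x * y) ` S"
    have "submodule_over S (*) ?X"
      unfolding submodule_over_def
    proof (intro conjI ballI)
      show "0 \<in> ?X" using is_subringD(1)[OF S] by (force intro: image_eqI[of _ _ 0])
      fix a assume "a \<in> ?X"
      then obtain y where y: "y \<in> S" "a = x * y" by blast
      show "c * a \<in> ?X" if "c \<in> S" for c
        by (rule image_eqI[of _ _ "c * y"]) (use y that is_subringD(4)[OF S] in \<open>auto simp: mult_ac\<close>)
      fix b assume "b \<in> ?X"
      then obtain z where z: "z \<in> S" "b = x * z" by blast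
      show "a + b \<in> ?X"
        by (rule image_eqI[of _ _ "y + z"]) (use y z is_subringD(5)[OF S] in \<open>auto simp: distrib_left\<close>)
    qed
    moreover have "?X \<subseteq> S" using x is_subringD(4)[OF S] by blast
    moreover have "x \<in> ?X" using is_subringD(2)[OF S] by (force intro: image_eqI[of _ _ 1])
    moreover have "1 \<notin> ?X" using nu by force
    ultimately have "?X \<in> ?A" by simp
    then have ne: "?A \<noteq> {}" by blast
    have "\<exists>M\<in>?A. \<forall>X\<in>?A. M \<subseteq> X \<longrightarrow> X = M"
    proof (rule subset_Zorn_nonempty[OF ne])
      fix C assume C: "C \<noteq> {}" "subset.chain ?A C"
      then have CA: "C \<subseteq> ?A" by (simp add: subset_chain_def)
      have "submodule_over S (*) (\<Union>C)"
        by (rule submodule_over_chain_Union[OF C(1) _ C(2)]) (use CA in blast)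
      then show "\<Union>C \<in> ?A" using C(1) CA by blast
    qed
    then obtain M where M: "M \<in> ?A" "\<forall>X\<in>?A. M \<subseteq> X \<longrightarrow> X = M" by blast
    have "maximal_ideal S = M"
    proof (rule maximal_ideal_eqI)
      show "M \<subset> S" using M(1) is_subringD(2)[OF S] by auto
      show "submodule_over S (*) M" using M(1) by simp
      fix J assume J: "submodule_over S (*) J" "M \<subseteq> J" "J \<subset> S"
      then have "1 \<notin> J" using ideal_eq_if_one_mem[of S J] by blast
      with J M(1) have "J \<in> ?A" by auto
      with M(2) J(2) show "J = M" by blast
    qed
    with M(1) x(2) show False by simp
  qed
  with that show ?thesis by blast
qed

lemma notin_maximal_ideal_if_unit:
  assumes "y \<in> S" "x * y = 1"
  shows "x \<notin> maximal_ideal S"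
proof
  assume "x \<in> maximal_ideal S"
  from submodule_overD(3)[OF maximal_ideal_ideal assms(1) this]
  show False using assms(2) one_notin_maximal_ideal by (simp add: mult.commute)
qed

lemma maximal_ideal_prime:
  assumes "x \<in> S" "y \<in> S" "x * y \<in> maximal_ideal S"
  shows "x \<in> maximal_ideal S \<or> y \<in> maximal_ideal S"
proof (rule ccontr)
  assume "\<not> ?thesis"
  with assms(1,2) local_unit obtain a b where ab: "a \<in> S" "x * a = 1" "b \<in> S" "y * b = 1" by metis
  then have "(x * y) * (a * b) = 1" by (metis mult.assoc mult.left_commute mult_1_right)
  with notin_maximal_ideal_if_unit[of "a * b" "x * y"] ab is_subringD(4)[OF S] assms(3) show False by blast
qed

lemma maximal_ideal_power:
  assumes "x \<in> S" "x ^ n \<in> maximal_ideal S"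
  shows "x \<in> maximal_ideal S"
  using assms(2)
proof (induction n)
  case 0
  then show ?case using one_notin_maximal_ideal by simp
next
  case (Suc n)
  then show ?case using maximal_ideal_prime[OF assms(1) subring_power[OF S assms(1)], of n] by auto
qed

end

text \<open>If everything outside the ideal \<open>N\<close> is invertible, every proper ideal lies
  in \<open>N\<close>, so no other ideal can be maximal.\<close>

lemma local_subringI:
  fixes S :: "'e::comm_ring_1 set"
  assumes "submodule_over S (*) N" "N \<subseteq> S" "1 \<in> S" "1 \<notin> N" 
    and unit: "\<And>x. x \<in> S \<Longrightarrow> x \<notin> N \<Longrightarrow> \<exists>y\<in>S. x * y = 1"
  shows "local_subring S"
  unfolding local_subring_def
proof (rule ex1I[of _ N])
  have sub: "J \<subseteq> N" if J: "submodule_over S (*) J" "J \<subset> S" for J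
  proof
    fix x assume x: "x \<in> J"
    show "x \<in> N"
    proof (rule ccontr)
      assume "x \<notin> N"
      then obtain y where "y \<in> S" "x * y = 1" using unit[of x] x J by blast
      then have "1 \<in> J" using submodule_overD(3)[OF J(1) _ x, of y] by (simp add: mult.commute)
      then show False using ideal_eq_if_one_mem[OF J(1)] J(2) by blast
    qed
  qed
  then show "N \<subset> S \<and> submodule_over S (*) N \<and> 
    (\<forall>J. submodule_over S (*) J \<and> N \<subseteq> J \<and> J \<subset> S \<longrightarrow> J = N)" using assms by blast
  fix I assume I: "I \<subset> S \<and> submodule_over S (*) I \<and> 
    (\<forall>J. submodule_over S (*) J \<and> I \<subseteq> J \<and> J \<subset> S \<longrightarrow> J = I)"
  then have "I \<subseteq> N" using sub by blast
  then have "N = I" using I assms by blast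
  then show "I = N" by simp
qed

section \<open>Full lattices and orders in a finite-dimensional algebra\<close>

locale dvr_algebra = dvr v Z + vector_space scaleQ
  for v :: "'q::field \<Rightarrow> int" and Z and scaleQ :: "'q \<Rightarrow> 'e::comm_ring_1 \<Rightarrow> 'e" +
  assumes scaleQ_mult: "scaleQ q (x * y) = scaleQ q x * y"
    and fin_dim: "\<exists>B. finite B \<and> span B = UNIV"
begin

lemma vs: "vector_space scaleQ" by unfold_locales
lemma md: "module scaleQ" by unfold_locales

lemma mult_scaleQ: "x * scaleQ q y = scaleQ q (x * y)"
  by (metis mult.commute scaleQ_mult)

lemma scaleQ_eq: "scaleQ q x = scaleQ q 1 * x"
  by (simp add: scaleQ_mult[symmetric])

abbreviation order :: "'e set \<Rightarrow> bool" where "order \<equiv> is_order Z scaleQ"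

lemma orderD:
  assumes "order S"
  shows "is_subring S" "submodule_over Z scaleQ S" "fg_over Z scaleQ S" "span S = UNIV"
  using assms by (simp_all add: is_order_def)

lemma orderI:
  assumes "order S" "order T" "S \<subseteq> S'" "S' \<subseteq> T" "is_subring S'" "submodule_over Z scaleQ S'"
  shows "order S'"
  unfolding is_order_def
proof (intro conjI)
  show "fg_over Z scaleQ S'" by (rule fg_submodule[OF vs orderD(3)[OF assms(2)]]) (use assms in auto)
  show "span S' = UNIV" using span_mono[OF assms(3)] orderD(4)[OF assms(1)] by auto
qed (use assms in auto)

text \<open>Linear forms on all of \<open>E\<close> stand in for maps on an order, so that they can
  also be evaluated outside the order.\<close>

definition functional :: "('e \<Rightarrow> 'q) \<Rightarrow> bool" where
  "functional f \<longleftrightarrow> (\<forall>x y. f (x + y) = f x + f y) \<and> (\<forall>q x. f (scaleQ q x) = q * f x)"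

lemma functionalD:
  assumes "functional f"
  shows "f (x + y) = f x + f y" "f (scaleQ q x) = q * f x" "f 0 = 0" "f (sum g A) = (\<Sum>a\<in>A. f (g a))"
proof -
  show 1: "f (x + y) = f x + f y" for x y using assms by (simp add: functional_def)
  show "f (scaleQ q x) = q * f x" using assms by (simp add: functional_def)
  have "f 0 + 0 = f 0 + f 0" using 1[of 0 0] by (simp only: add_0_right)
  then show 0: "f 0 = 0" by (simp only: add_left_cancel)
  show "f (sum g A) = (\<Sum>a\<in>A. f (g a))" by (induction A rule: infinite_finite_induct) (auto simp: 0 1)
qed

lemma functional_mult:
  assumes "functional f"
  shows "functional (\<lambda>x. f (a * x))"
  unfolding functional_def by (simp add: distrib_left mult_scaleQ functionalD[OF assms])

lemma functional_sum:
  assumes "\<And>a. a \<in> A \<Longrightarrow> functional (f a)"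
  shows "functional (\<lambda>x. \<Sum>a\<in>A. f a x * c a)"
proof -
  have 1: "f a (x + y) = f a x + f a y" "f a (scaleQ q x) = q * f a x" if "a \<in> A" for a x y q 
    using functionalD[OF assms[OF that]] by auto
  show ?thesis unfolding functional_def
    by (simp add: 1 distrib_right sum.distrib sum_distrib_left mult.assoc cong: sum.cong)
qed

text \<open>A \<open>Z\<close>-basis of a full lattice with its dual basis of forms; membership in
  the lattice becomes integrality of the coordinates.\<close>

definition coordinates :: "'e set \<Rightarrow> 'e set \<Rightarrow> ('e \<Rightarrow> 'e \<Rightarrow> 'q) \<Rightarrow> bool" where
  "coordinates L B \<rho> \<longleftrightarrow> finite B \<and> B \<subseteq> L \<and> (\<forall>b\<in>B. functional (\<rho> b)) \<and>
     (\<forall>x. x \<in> L \<longleftrightarrow> (\<forall>b\<in>B. \<rho> b x \<in> Z)) \<and> (\<forall>x. (\<Sum>b\<in>B. scaleQ (\<rho> b x) b) = x) \<and>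
     (\<forall>a\<in>B. \<forall>b\<in>B. \<rho> b a = (if a = b then 1 else 0))"

lemma coordinatesD:
  assumes "coordinates L B \<rho>"
  shows "finite B" "B \<subseteq> L" "\<And>b. b \<in> B \<Longrightarrow> functional (\<rho> b)" 
    "\<And>x. x \<in> L \<longleftrightarrow> (\<forall>b\<in>B. \<rho> b x \<in> Z)" "\<And>x. (\<Sum>b\<in>B. scaleQ (\<rho> b x) b) = x"
    "\<And>a b. a \<in> B \<Longrightarrow> b \<in> B \<Longrightarrow> \<rho> b a = (if a = b then 1 else 0)"
  using assms by (simp_all add: coordinates_def)

lemma ex_coordinates:
  assumes fg: "fg_over Z scaleQ L" and sub: "submodule_over Z scaleQ L" and sp: "span L = UNIV"
  shows "\<exists>B \<rho>. coordinates L B \<rho>"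
proof -
  obtain B where B: "finite B" "B \<subseteq> L" "L \<subseteq> span_over Z scaleQ B" "independent B"
    by (rule fg_basis[OF vs fg])
  have "L \<subseteq> span B"
    using B(3) span_over_least[of Z scaleQ "span B" B] span_base span_add span_scale span_zero
    by (auto simp: submodule_over_def)
  then have "span L \<subseteq> span B" using span_mono[of L "span B"] span_span[of B] by simp
  then have spB: "span B = UNIV" using sp by blast
  then have in_sp: "x \<in> span B" for x by simp
  let ?\<rho> = "\<lambda>b x. representation B x b"
  have fnl: "functional (?\<rho> b)" for b
    unfolding functional_def using representation_add[OF B(4) in_sp in_sp] representation_scale[OF B(4) in_sp]
    by simp
  have eq: "x = (\<Sum>b\<in>B. scaleQ (?\<rho> b x) b)" for x
    using sum_representation_eq[OF B(4) in_sp B(1)] by simp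
  have delta: "?\<rho> b a = (if a = b then 1 else 0)" if "a \<in> B" "b \<in> B" for a b
    using representation_basis[OF B(4) that(1)] by auto
  have L: "x \<in> L \<longleftrightarrow> (\<forall>b\<in>B. ?\<rho> b x \<in> Z)" for x
  proof
    assume "x \<in> L"
    with B(3) have "x \<in> span_over Z scaleQ B" by blast
    then obtain c where c: "\<forall>b\<in>B. c b \<in> Z" "x = (\<Sum>b\<in>B. scaleQ (c b) b)" by (rule span_overE)
    have "?\<rho> b x = c b" if "b \<in> B" for b
    proof -
      have "?\<rho> b x = (\<Sum>a\<in>B. c a * ?\<rho> b a)" unfolding c(2) by (simp add: functionalD[OF fnl])
      also have "\<dots> = (\<Sum>a\<in>B. if a = b then c a else 0)" by (rule sum.cong) (use delta that in auto)
      finally show ?thesis using that B(1) by simp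
    qed
    with c(1) show "\<forall>b\<in>B. ?\<rho> b x \<in> Z" by simp
  next
    assume c: "\<forall>b\<in>B. ?\<rho> b x \<in> Z"
    have "(\<Sum>b\<in>B. scaleQ (?\<rho> b x) b) \<in> span_over Z scaleQ B" by (rule span_overI) (rule c)
    then show "x \<in> L" using eq[of x] span_over_least[OF sub B(2)] by auto
  qed
  show ?thesis unfolding coordinates_def
    by (intro exI[of _ B] exI[of _ ?\<rho>] conjI allI ballI B(1,2) fnl L eq[symmetric] delta)
qed

text \<open>Some coordinate of a point outside the lattice is not integral. This is how a lattice is
  recovered from its dual.\<close>

lemma functional_separates:
  assumes "fg_over Z scaleQ L" "submodule_over Z scaleQ L" "span L = UNIV" "e \<notin> L"
  obtains \<psi> where "functional \<psi>" "\<forall>x\<in>L. \<psi> x \<in> Z" "\<psi> e \<notin> Z"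
proof -
  obtain B \<rho> where "coordinates L B \<rho>" using ex_coordinates[OF assms(1-3)] by blast
  note B = coordinatesD(1,2)[OF this] and \<rho> = coordinatesD(3-6)[OF this]
  with assms(4) obtain b where "b \<in> B" "\<rho> b e \<notin> Z" by blast
  with \<rho> show ?thesis by (intro that[of "\<rho> b"]) auto
qed

lemma unif_power_in_Z: "unif ^ n \<in> Z" by (rule subring_power[OF subring_Z unif_in_Z])

lemma finite_scale_into:
  assumes fg: "fg_over Z scaleQ L" and sub: "submodule_over Z scaleQ L" and sp: "span L = UNIV"
    and "finite A"
  obtains n where "\<And>a. a \<in> A \<Longrightarrow> scaleQ (unif ^ n) a \<in> L"
proof -
  obtain B \<rho> where "coordinates L B \<rho>" using ex_coordinates[OF assms(1-3)] by blast
  note B = coordinatesD(1,2)[OF this] and \<rho> = coordinatesD(3-6)[OF this]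
  obtain n where n: "\<forall>c\<in>(\<lambda>(b,a). \<rho> b a) ` (B \<times> A). unif ^ n * c \<in> Z"
    using finite_common_denom[of "(\<lambda>(b,a). \<rho> b a) ` (B \<times> A)"] B(1) assms(4) by auto
  show ?thesis
    by (rule that[of n]) (use n \<rho> functionalD(2)[OF \<rho>(1)] in auto)
qed

lemma fg_scale_into:
  assumes "fg_over Z scaleQ L" and sub: "submodule_over Z scaleQ L" and "span L = UNIV"
    and "fg_over Z scaleQ N"
  obtains n where "\<And>x. x \<in> N \<Longrightarrow> scaleQ (unif ^ n) x \<in> L"
proof -
  obtain A where A: "finite A" "N \<subseteq> span_over Z scaleQ A" using assms(4) by (auto simp: fg_over_iff)
  obtain n where n: "\<And>a. a \<in> A \<Longrightarrow> scaleQ (unif ^ n) a \<in> L"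
    using finite_scale_into[OF assms(1-3) A(1)] by blast
  have "scaleQ (unif ^ n) x \<in> L" if x: "x \<in> N" for x
  proof -
    from x A have "x \<in> span_over Z scaleQ A" by blast
    then obtain c where c: "\<forall>b\<in>A. c b \<in> Z" "x = (\<Sum>b\<in>A. scaleQ (c b) b)" by (rule span_overE)
    have "scaleQ (unif ^ n) x = (\<Sum>b\<in>A. scaleQ (c b) (scaleQ (unif ^ n) b))"
      unfolding c(2) by (simp add: scale_sum_right mult.commute)
    also have "\<dots> \<in> L" by (intro submodule_over_sum[OF sub] submodule_overD(3)[OF sub] n) (use c(1) in auto)
    finally show ?thesis .
  qed
  with that show ?thesis by blast
qed

lemma scale_one_in_order: "order S \<Longrightarrow> z \<in> Z \<Longrightarrow> scaleQ z 1 \<in> S"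
  using submodule_overD(3)[OF orderD(2)] is_subringD(2)[OF orderD(1)] by blast

lemma order_submodule:
  assumes S: "order S" and L: "submodule_over S (*) L"
  shows "submodule_over Z scaleQ L"
proof -
  have "scaleQ z x \<in> L" if "z \<in> Z" "x \<in> L" for z x
    using submodule_overD(3)[OF L scale_one_in_order[OF S that(1)] that(2)] scaleQ_eq[of z x] by simp
  then show ?thesis using submodule_overD(1,2)[OF L] by (auto simp: submodule_over_def)
qed

text \<open>If the uniformizer had an inverse \<open>y\<close> in the order, then 1 would be
  \<open>unif ^ n\<close> times \<open>y ^ n\<close> for every \<open>n\<close>, and a nonzero
  coordinate of 1 would have valuation at least \<open>n\<close>.\<close>

lemma unif_not_unit:
  assumes S: "order S" and y: "y \<in> S" "scaleQ unif 1 * y = 1"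
  shows False
proof -
  obtain B \<rho> where "coordinates S B \<rho>" using ex_coordinates[OF orderD(3,2,4)[OF S]] by blast
  note B = coordinatesD(1,2)[OF this] and \<rho> = coordinatesD(3-6)[OF this]
  have "\<exists>b\<in>B. \<rho> b 1 \<noteq> 0"
  proof (rule ccontr)
    assume "\<not> ?thesis"
    then have "1 = (0::'e)" using \<rho>(3)[of 1] by simp
    then show False by simp
  qed
  then obtain b where b: "b \<in> B" "\<rho> b 1 \<noteq> 0" by blast
  define n where "n = Suc (nat (v (\<rho> b 1)))"
  have "scaleQ unif y = 1" using y(2) scaleQ_eq[of unif y] by simp
  have "scaleQ (unif ^ k) (y ^ k) = 1" for k
  proof (induction k)
    case (Suc k)
    have "scaleQ (unif ^ Suc k) (y ^ Suc k) = scaleQ (unif ^ k) (y ^ k * scaleQ unif y)"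
      by (simp add: mult_scaleQ mult_ac)
    also have "\<dots> = 1" using Suc \<open>scaleQ unif y = 1\<close> by simp
    finally show ?case .
  qed simp
  then have e: "\<rho> b 1 = unif ^ n * \<rho> b (y ^ n)" using functionalD(2)[OF \<rho>(1)[OF b(1)]] by metis
  have "\<rho> b (y ^ n) \<in> Z" using \<rho>(2) b(1) subring_power[OF orderD(1)[OF S] y(1)] by blast
  moreover have "\<rho> b (y ^ n) \<noteq> 0" using e b(2) by auto
  ultimately have "v (\<rho> b 1) \<ge> int n" unfolding e using unif by (simp add: v_mult v_unif_power Z_eq)
  then show False unfolding n_def by linarith
qed

lemma unif_in_maximal_ideal:
  assumes S: "order S" "local_subring S"
  shows "scaleQ unif 1 \<in> maximal_ideal S"
  using local_unit[OF orderD(1)[OF S(1)] S(2) scale_one_in_order[OF S(1) unif_in_Z]] unif_not_unit[OF S(1)]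
  by blast

lemma algebraic_relation:
  fixes x :: 'e
  obtains c N where "\<exists>i\<le>N. c i \<noteq> 0" "(\<Sum>i\<le>N. scaleQ (c i) (x ^ i)) = 0"
proof -
  obtain B where B: "finite B" "span B = UNIV" using fin_dim by blast
  define N where "N = card B"
  let ?p = "\<lambda>i::nat. x ^ i"
  show ?thesis
  proof (cases "inj_on ?p {..N}")
    case True
    let ?P = "?p ` {..N}"
    have "card ?P = Suc N" using card_image[OF True] by simp
    then have "dependent ?P" using independent_span_bound[OF B(1), of ?P] B(2) N_def by auto
    then obtain u where u: "\<exists>y\<in>?P. u y \<noteq> 0" "(\<Sum>y\<in>?P. scaleQ (u y) y) = 0"
      using dependent_finite[of ?P] by auto
    show ?thesis by (rule that[of N "\<lambda>i. u (x ^ i)"]) (use u sum.reindex[OF True, of "\<lambda>y. scaleQ (u y) y"] in auto)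
  next
    case False
    then obtain i j where ij: "i \<le> N" "j \<le> N" "i \<noteq> j" "x ^ i = x ^ j" by (auto simp: inj_on_def)
    \<comment> \<open>Two equal powers of \<open>x\<close> with different exponents already give a
      relation; the dimension count covers only pairwise distinct powers.\<close>
    let ?c = "\<lambda>k. (if k = i then 1 else 0) - (if k = j then 1 else (0::'q))"
    have "(\<Sum>k\<le>N. scaleQ (?c k) (x ^ k)) = 
      (\<Sum>k\<le>N. if k = i then x ^ k else 0) - (\<Sum>k\<le>N. if k = j then x ^ k else 0)"
      unfolding sum_subtractf[symmetric] by (rule sum.cong) (auto simp: scale_left_diff_distrib)
    also have "\<dots> = 0" using ij by simp
    finally show ?thesis by (intro that[of N ?c]) (use ij in auto)
  qed
qed

text \<open>
  In a nontrivial relation between the powers of \<open>x\<close> with coefficients in \<open>Z\<close>, not all in the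
  maximal ideal, the lowest unit coefficient exhibits a power of \<open>x\<close> times a unit as a multiple of
  the uniformizer.
\<close>

lemma maximal_ideal_topologically_nilpotent:
  assumes S: "order S" "local_subring S" and x: "x \<in> maximal_ideal S"
  obtains n y where "y \<in> S" "x ^ n = scaleQ unif y"
proof -
  note Sr = orderD(1)[OF S(1)]
  note mi = maximal_ideal_ideal[OF Sr S(2)]
  have xS: "x \<in> S" using x maximal_ideal_proper[OF Sr S(2)] by blast
  note sub = orderD(2)[OF S(1)]
  obtain c N where c: "\<exists>i\<le>N. c i \<noteq> 0" "(\<Sum>i\<le>N. scaleQ (c i) (x ^ i)) = 0" by (rule algebraic_relation)
  obtain a where a: "a \<le> N" "c a \<noteq> 0" "\<forall>b\<in>{..N}. c b / c a \<in> Z"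
    using finite_min_valuation[of "{..N}" c] c(1) by auto
  define d where "d i = c i / c a" for i
  have dZ: "d i \<in> Z" if "i \<le> N" for i using a(3) that by (simp add: d_def)
  have "(\<Sum>i\<le>N. scaleQ (d i) (x ^ i)) = scaleQ (1 / c a) (\<Sum>i\<le>N. scaleQ (c i) (x ^ i))"
    by (simp add: scale_sum_right d_def)
  then have d0: "(\<Sum>i\<le>N. scaleQ (d i) (x ^ i)) = 0" using c(2) by simp
  define j where "j = (LEAST i. d i \<noteq> 0 \<and> v (d i) = 0)"
  have da: "d a \<noteq> 0 \<and> v (d a) = 0" using a(2) by (simp add: d_def v_one)
  have j: "d j \<noteq> 0" "v (d j) = 0" "j \<le> N" 
    using LeastI[of "\<lambda>i. d i \<noteq> 0 \<and> v (d i) = 0", OF da] Least_le[of "\<lambda>i. d i \<noteq> 0 \<and> v (d i) = 0", OF da] a(1)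
    by (auto simp: j_def)
  have low: "d i / unif \<in> Z" if "i < j" for i
  proof -
    have "\<not> (d i \<noteq> 0 \<and> v (d i) = 0)" using that not_less_Least unfolding j_def by blast
    moreover have "d i \<in> Z" using dZ that j(3) by simp
    ultimately show ?thesis by (intro divide_in_Z) (use unif in \<open>auto simp: Z_eq\<close>)
  qed
  \<comment> \<open>The relation splits at \<open>j\<close> into \<open>unif\<close> times
    \<open>y0\<close> plus \<open>x ^ j\<close> times \<open>u\<close>. Here \<open>u\<close> is a
    unit, because \<open>d j\<close> is a unit of \<open>Z\<close> and \<open>x\<close> lies in the
    maximal ideal.\<close>
  define y0 where "y0 = (\<Sum>i<j. scaleQ (d i / unif) (x ^ i))"
  define w where "w = (\<Sum>i\<in>{j<..N}. scaleQ (d i) (x ^ (i - Suc j)))"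
  define u where "u = scaleQ (d j) 1 + x * w"
  have pow: "x ^ i \<in> S" for i by (rule subring_power[OF Sr xS])
  have y0: "y0 \<in> S" unfolding y0_def 
    by (rule submodule_over_sum[OF sub]) (use low pow submodule_overD(3)[OF sub] in auto)
  have w: "w \<in> S" unfolding w_def 
    by (rule submodule_over_sum[OF sub]) (use dZ pow submodule_overD(3)[OF sub] in auto)
  have split: "{..N} = {..<j} \<union> (insert j {j<..N})" using j(3) by auto
  have "(\<Sum>i\<le>N. scaleQ (d i) (x ^ i)) = 
    (\<Sum>i<j. scaleQ (d i) (x ^ i)) + (scaleQ (d j) (x ^ j) + (\<Sum>i\<in>{j<..N}. scaleQ (d i) (x ^ i)))"
    unfolding split by (subst sum.union_disjoint) auto
  moreover have "(\<Sum>i<j. scaleQ (d i) (x ^ i)) = scaleQ unif y0"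
    using unif(1) by (simp add: y0_def scale_sum_right)
  moreover have "(\<Sum>i\<in>{j<..N}. scaleQ (d i) (x ^ i)) = x ^ j * (x * w)"
    unfolding w_def sum_distrib_left
  proof (rule sum.cong)
    fix i assume "i \<in> {j<..N}"
    then have "i = j + Suc (i - Suc j)" by auto
    then have "x ^ i = x ^ j * (x * x ^ (i - Suc j))" by (metis power_add power_Suc)
    then show "scaleQ (d i) (x ^ i) = x ^ j * (x * scaleQ (d i) (x ^ (i - Suc j)))" 
      by (simp add: mult_scaleQ)
  qed simp
  moreover have "scaleQ (d j) (x ^ j) = x ^ j * scaleQ (d j) 1" by (simp add: mult_scaleQ)
  ultimately have eq: "x ^ j * u = - scaleQ unif y0" 
    using d0 by (simp add: u_def distrib_left eq_neg_iff_add_eq_0 add_ac)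
  have "u \<notin> maximal_ideal S"
  proof
    assume "u \<in> maximal_ideal S"
    then have "u + (- w) * x \<in> maximal_ideal S" 
      using submodule_overD(2,3)[OF mi] x w is_subringD(6)[OF Sr] by blast
    then have m: "scaleQ (d j) 1 \<in> maximal_ideal S" by (simp add: u_def mult_ac)
    have "1 / d j \<in> Z" using j by (intro divide_in_Z) (auto simp: v_one)
    then have "scaleQ (1 / d j) 1 \<in> S" by (rule scale_one_in_order[OF S(1)])
    moreover have "scaleQ (d j) 1 * scaleQ (1 / d j) 1 = 1" using j(1) by (simp add: mult_scaleQ)
    ultimately show False using notin_maximal_ideal_if_unit[OF Sr S(2)] m by blast
  qed
  moreover have "u \<in> S"
    unfolding u_def using scale_one_in_order[OF S(1) dZ[OF j(3)]] xS w is_subringD(4,5)[OF Sr] by blast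
  ultimately obtain u' where u': "u' \<in> S" "u * u' = 1" using local_unit[OF Sr S(2)] by blast
  have "x ^ j = (x ^ j * u) * u'" using u' by (simp add: mult.assoc)
  also have "\<dots> = scaleQ unif (- y0 * u')" unfolding eq by (simp add: scaleQ_mult)
  finally show ?thesis by (intro that[of "- y0 * u'"]) (use y0 u' is_subringD(4,6)[OF Sr] in auto)
qed

text \<open>Some power of \<open>x\<close> lies in \<open>unif\<close> times the order, so high
  powers of \<open>x\<close> absorb any fixed denominator, in particular one that carries
  \<open>T\<close> into \<open>L\<close>.\<close>

lemma maximal_ideal_power_mult:
  assumes S: "order S" "local_subring S" and x: "x \<in> maximal_ideal S"
    and T: "order T" "S \<subseteq> T" and L: "submodule_over S (*) L" "fg_over Z scaleQ L" "span L = UNIV"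
  obtains k where "\<And>t. t \<in> T \<Longrightarrow> x ^ k * t \<in> L"
proof -
  obtain n y where y: "y \<in> S" "x ^ n = scaleQ unif y" 
    by (rule maximal_ideal_topologically_nilpotent[OF S x])
  obtain k where k: "\<And>x. x \<in> T \<Longrightarrow> scaleQ (unif ^ k) x \<in> L"
    using fg_scale_into[OF L(2) order_submodule[OF S(1) L(1)] L(3) orderD(3)[OF T(1)]] by blast
  have "x ^ (n * k) = scaleQ (unif ^ k) (y ^ k)"
  proof (induction k)
    case (Suc k)
    have "x ^ (n * Suc k) = scaleQ (unif ^ k) (y ^ k) * scaleQ unif y"
      using Suc y(2) by (simp add: power_add mult.commute)
    then show ?case by (simp add: mult_scaleQ scaleQ_mult[symmetric] mult_ac)
  qed simp
  then have "x ^ (n * k) * t \<in> L" if "t \<in> T" for t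
    using k[of "y ^ k * t"] y(1) that T(2) subring_power[OF orderD(1)[OF T(1)], of y k] 
      is_subringD(4)[OF orderD(1)[OF T(1)], of "y ^ k" t] by (auto simp: scaleQ_mult)
  with that show ?thesis by blast
qed

text \<open>The quotient of \<open>T\<close> by \<open>A\<close> has a nonzero element killed by
  \<open>J\<close>. The generators of \<open>J\<close> are treated one at a time: \<open>t\<close>
  is replaced by the last \<open>a ^ l * t\<close> still outside \<open>A\<close>, and commutativity
  preserves what was achieved for the earlier generators.\<close>

lemma ex_annihilated:
  assumes A: "is_subring A" "submodule_over Z scaleQ A" and T: "is_subring T" "A \<subset> T" 
    and J: "J \<subseteq> A" "fg_over Z scaleQ J" and nil: "\<And>a. a \<in> J \<Longrightarrow> \<exists>k. \<forall>t\<in>T. a ^ k * t \<in> A"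
  obtains t where "t \<in> T" "t \<notin> A" "\<And>a. a \<in> J \<Longrightarrow> a * t \<in> A"
proof -
  obtain F where F: "finite F" "F \<subseteq> J" "J \<subseteq> span_over Z scaleQ F" using J(2) by (auto simp: fg_over_iff)
  have "\<exists>t\<in>T. t \<notin> A \<and> (\<forall>a\<in>F. a * t \<in> A)"
    using F(1,2)
  proof induction
    case empty
    then show ?case using T(2) by auto
  next
    case (insert a F)
    then obtain t where t: "t \<in> T" "t \<notin> A" "\<forall>b\<in>F. b * t \<in> A" by auto
    have aJ: "a \<in> J" using insert.prems by simp
    then have aA: "a \<in> A" "a \<in> T" using J(1) T(2) by auto
    from nil[OF aJ] t(1) have ex: "\<exists>k. a ^ k * t \<in> A" by blast
    define k where "k = (LEAST k. a ^ k * t \<in> A)"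
    have k: "a ^ k * t \<in> A" unfolding k_def using LeastI_ex[OF ex] .
    have "k \<noteq> 0" using k t(2) by (cases k) auto
    then obtain l where l: "k = Suc l" using not0_implies_Suc by blast
    have lk: "a ^ l * t \<notin> A" using not_less_Least[of l "\<lambda>k. a ^ k * t \<in> A"] l k_def by simp
    show ?case
    proof (intro bexI conjI ballI)
      show "a ^ l * t \<in> T" using is_subringD(4)[OF T(1) subring_power[OF T(1) aA(2)] t(1)] .
      show "a ^ l * t \<notin> A" by (rule lk)
      fix b assume "b \<in> insert a F"
      then show "b * (a ^ l * t) \<in> A"
      proof
        assume "b = a"
        then show ?thesis using k l by (simp add: mult.assoc)
      next
        assume "b \<in> F"
        then have "a ^ l * (b * t) \<in> A" using t(3) is_subringD(4)[OF A(1) subring_power[OF A(1) aA(1)]] by blast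
        then show ?thesis by (simp add: mult.left_commute)
      qed
    qed
  qed
  then obtain t where t: "t \<in> T" "t \<notin> A" "\<forall>a\<in>F. a * t \<in> A" by blast
  have "a * t \<in> A" if a: "a \<in> J" for a
  proof -
    from a F have "a \<in> span_over Z scaleQ F" by blast
    then obtain c where c: "\<forall>b\<in>F. c b \<in> Z" "a = (\<Sum>b\<in>F. scaleQ (c b) b)" by (rule span_overE)
    have "a * t = (\<Sum>b\<in>F. scaleQ (c b) (b * t))" unfolding c(2) by (simp add: sum_distrib_right scaleQ_mult)
    also have "\<dots> \<in> A" by (rule submodule_over_sum[OF A(2)]) (use c(1) t(3) submodule_overD(3)[OF A(2)] in auto)
    finally show ?thesis .
  qed
  with t that show ?thesis by blast
qed

text \<open>Otherwise some \<open>t\<close> in \<open>T\<close> outside \<open>A\<close> has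
  \<open>J t\<close> inside \<open>A\<close>. All multipliers of \<open>J\<close> lie in
  \<open>A\<close>, so some product \<open>a * t\<close> is outside \<open>J\<close>; yet one of its
  powers lies in \<open>J\<close>, against radicality. The argument serves twice: for a local order
  itself and for its multiplier ring.\<close>

lemma order_maximal_if_radical_ideal:
  assumes A: "is_subring A" "submodule_over Z scaleQ A" and T: "is_subring T" "A \<subseteq> T" 
    and J: "submodule_over A (*) J" "J \<subseteq> A" "fg_over Z scaleQ J" 
    and nil: "\<And>a. a \<in> J \<Longrightarrow> \<exists>k. \<forall>t\<in>T. a ^ k * t \<in> J"
    and mult: "\<And>t. (\<And>a. a \<in> J \<Longrightarrow> a * t \<in> J) \<Longrightarrow> t \<in> A"
    and radical: "\<And>x n. x \<in> A \<Longrightarrow> x ^ n \<in> J \<Longrightarrow> x \<in> J"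
  shows "T = A"
proof (rule ccontr)
  assume "T \<noteq> A"
  with T(2) have "A \<subset> T" by blast
  have "\<exists>k. \<forall>t\<in>T. a ^ k * t \<in> A" if "a \<in> J" for a
    using nil[OF that] J(2) by (metis subsetD)
  then obtain t where t: "t \<in> T" "t \<notin> A" "\<And>a. a \<in> J \<Longrightarrow> a * t \<in> A"
    using ex_annihilated[OF A T(1) \<open>A \<subset> T\<close> J(2,3)] by auto
  with mult obtain a where a: "a \<in> J" "a * t \<notin> J" by blast
  obtain k where k: "\<forall>t\<in>T. a ^ k * t \<in> J" using nil[OF a(1)] by blast
  have "(a * t) ^ k \<in> J" using k subring_power[OF T(1) t(1)] by (simp add: power_mult_distrib)
  with radical t(3)[OF a(1)] a(2) show False by blast
qed

end

section \<open>Duality over Gorenstein local orders\<close>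

lemma hom_over_free_module_sum:
  fixes S :: "'a::comm_ring_1 set" and p :: "('i \<Rightarrow> 'a) \<Rightarrow> 'p::ab_group_add"
  assumes S: "is_subring S" and p: "p \<in> hom_over S (\<lambda>a f i. a * f i) (free_module_on S I) scale P"
    and F: "finite F" "F \<subseteq> I" and f: "f \<in> free_module_on S I" "{i. f i \<noteq> 0} \<subseteq> F"
  shows "p f = (\<Sum>i\<in>F. scale (f i) (p (\<lambda>j. if j = i then 1 else 0)))"
  using F f
proof (induction F arbitrary: f)
  case empty
  then have f0: "f = (\<lambda>_. 0)" by (simp add: fun_eq_iff)
  then have "p (f + f) = p f + p f" using p empty.prems(2) unfolding hom_over_def by blast
  moreover have "f + f = f" using f0 by (simp add: fun_eq_iff)
  ultimately have "p f + 0 = p f + p f" by simp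
  then show ?case by (simp only: add_left_cancel sum.empty)
next
  case (insert i F)
  let ?d = "\<lambda>j. if j = i then 1 else (0::'a)"
  let ?g = "f(i := 0)"
  have iI: "i \<in> I" using insert.prems by simp
  have fi: "f i \<in> S" using insert.prems(2) iI by (simp add: free_module_on_def)
  have d: "?d \<in> free_module_on S I" 
    using iI is_subringD(1,2)[OF S] by (simp add: free_module_on_def)
  have g: "?g \<in> free_module_on S I"
    unfolding free_module_on_def mem_Collect_eq
  proof (intro conjI)
    have "{j. ?g j \<noteq> 0} \<subseteq> {j. f j \<noteq> 0}" by auto
    moreover have "finite {j. f j \<noteq> 0}" using insert.prems(2) by (simp add: free_module_on_def)
    ultimately show "finite {j. ?g j \<noteq> 0}" by (rule finite_subset)
  qed (use insert.prems(2) is_subringD(1)[OF S] in \<open>auto simp: free_module_on_def\<close>)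
  let ?e = "\<lambda>j. f i * ?d j"
  have e: "?e \<in> free_module_on S I"
    using iI fi is_subringD(1,2)[OF S] by (simp add: free_module_on_def)
  have "f = ?g + ?e" by (auto simp: fun_eq_iff)
  moreover have "p (a + b) = p a + p b" if "a \<in> free_module_on S I" "b \<in> free_module_on S I" for a b
    using p that by (simp add: hom_over_def)
  note this[OF g e]
  ultimately have "p f = p ?g + p ?e" by simp
  also have "p ?e = scale (f i) (p ?d)" using p d fi by (simp add: hom_over_def)
  also have "p ?g = (\<Sum>k\<in>F. scale (?g k) (p (\<lambda>j. if j = k then 1 else 0)))"
    by (rule insert.IH[OF _ g]) (use insert.prems in auto)
  also have "\<dots> = (\<Sum>k\<in>F. scale (f k) (p (\<lambda>j. if j = k then 1 else 0)))"
    by (rule sum.cong) (use insert.hyps in auto)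
  finally show ?case using insert.hyps by (simp add: add.commute)
qed

lemma sum_fun_app: "sum f A x = (\<Sum>a\<in>A. f a x)"
  by (induction A rule: infinite_finite_induct) auto

context dvr_algebra
begin

definition ext_by_zero :: "'e set \<Rightarrow> ('e \<Rightarrow> 'q) \<Rightarrow> 'e \<Rightarrow> 'q" where
  "ext_by_zero S f x = (if x \<in> S then f x else 0)"

lemma ext_by_zero_in_hom:
  assumes "functional f" "\<forall>x\<in>S. f x \<in> Z" "submodule_over Z scaleQ S"
  shows "ext_by_zero S f \<in> hom_over Z scaleQ S (*) Z"
  using assms submodule_overD(2,3)[OF assms(3)] functionalD[OF assms(1)]
  by (simp add: hom_over_def ext_by_zero_def)

text \<open>Coordinates extend a \<open>Z\<close>-linear map on a full lattice to a linear form on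
  \<open>E\<close>. This makes the dual that occurs in the Gorenstein condition accessible through
  forms.\<close>

lemma hom_eq_ext_by_zero:
  assumes S: "fg_over Z scaleQ S" "submodule_over Z scaleQ S" "span S = UNIV" 
    and d: "d \<in> hom_over Z scaleQ S (*) Z"
  obtains f where "functional f" "\<forall>x\<in>S. f x \<in> Z" "d = ext_by_zero S f"
proof -
  obtain B \<rho> where "coordinates S B \<rho>" using ex_coordinates[OF S] by blast
  note B = coordinatesD(1,2)[OF this] and \<rho> = coordinatesD(3-6)[OF this]
  let ?f = "\<lambda>x. \<Sum>b\<in>B. \<rho> b x * d b"
  have d': "d x \<in> Z" "d (x + y) = d x + d y" "a \<in> Z \<Longrightarrow> d (scaleQ a x) = a * d x" 
    if "x \<in> S" "y \<in> S" for x y a using d that by (auto simp: hom_over_def)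
  have "0 \<in> S" using submodule_overD(1)[OF S(2)] .
  then have d0: "d 0 = 0" using d'(3)[of 0 0 0] Z_closed(1) by simp
  have dsum: "d (\<Sum>b\<in>A. scaleQ (c b) b) = (\<Sum>b\<in>A. c b * d b) \<and> (\<Sum>b\<in>A. scaleQ (c b) b) \<in> S" 
    if "finite A" "A \<subseteq> B" "\<forall>b\<in>A. c b \<in> Z" for A c
    using that
  proof (induction A)
    case empty
    then show ?case using d0 \<open>0 \<in> S\<close> by simp
  next
    case (insert b A)
    then have "b \<in> S" "c b \<in> Z" using B by auto
    moreover have "scaleQ (c b) b \<in> S" by (rule submodule_overD(3)[OF S(2)]) fact+
    ultimately show ?case using insert d' submodule_overD(2)[OF S(2)] by simp
  qed
  have eq: "d x = ?f x" if "x \<in> S" for x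
  proof -
    have "\<forall>b\<in>B. \<rho> b x \<in> Z" using \<rho>(2)[of x] that by simp
    from dsum[OF B(1) subset_refl this] show ?thesis unfolding \<rho>(3) by simp
  qed
  show ?thesis
  proof (rule that[of ?f])
    show "functional ?f" by (rule functional_sum) (rule \<rho>(1))
    show "\<forall>x\<in>S. ?f x \<in> Z" using eq d' by metis
    have "d x = 0" if "x \<notin> S" for x using that d by (simp add: hom_over_def)
    then show "d = ext_by_zero S ?f" using eq by (auto simp: ext_by_zero_def fun_eq_iff)
  qed
qed

text \<open>
  An element \<open>t\<close> outside \<open>S\<close> that is multiplied into \<open>S\<close> by the maximal ideal \<open>\<mm>\<close>
  shows that \<open>Hom(S, Z)\<close> differs from \<open>\<mm> Hom(S, Z)\<close>; so some coordinate map of the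
  projective module \<open>Hom(S, Z)\<close> takes a unit as a value.
\<close>

lemma gorenstein_coordinate:
  assumes S: "order S" "local_subring S" and gor: "gorenstein Z scaleQ S"
    and t: "t \<notin> S" "\<And>a. a \<in> maximal_ideal S \<Longrightarrow> a * t \<in> S"
  obtains h :: "('e \<Rightarrow> 'q) \<Rightarrow> 'e" and \<phi> where
    "functional \<phi>" "\<forall>x\<in>S. \<phi> x \<in> Z" "h (ext_by_zero S \<phi>) = 1"
    "\<forall>d\<in>hom_over Z scaleQ S (*) Z. h d \<in> S"
    "\<forall>f. \<forall>a\<in>S. functional f \<longrightarrow> (\<forall>x\<in>S. f x \<in> Z) \<longrightarrow>
      h (ext_by_zero S (\<lambda>x. f (a * x))) = a * h (ext_by_zero S f)"
proof -
  note Sr = orderD(1)[OF S(1)] and Ss = orderD(2)[OF S(1)]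
  let ?D = "hom_over Z scaleQ S (*) Z"
  let ?act = "\<lambda>a (f :: 'e \<Rightarrow> 'q) x. if x \<in> S then f (a * x) else 0"
  obtain I :: "('e \<Rightarrow> 'q) set" and s p where s: "s \<in> hom_over S ?act ?D (\<lambda>a f i. a * f i) (free_module_on S I)"
    and p: "p \<in> hom_over S (\<lambda>a f i. a * f i) (free_module_on S I) ?act ?D"
    and ps: "\<forall>d\<in>?D. p (s d) = d"
    using gor unfolding gorenstein_def projective_over_def by (elim exE bexE) (rule that)
  have act: "?act a (ext_by_zero S f) = ext_by_zero S (\<lambda>x. f (a * x))" if "a \<in> S" for a f
    using that is_subringD(4)[OF Sr] by (auto simp: ext_by_zero_def fun_eq_iff)
  have sfree: "s d \<in> free_module_on S I" if "d \<in> ?D" for d using s that by (simp add: hom_over_def)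
  have sS: "s d i \<in> S" if "d \<in> ?D" for d i
    using sfree[OF that] is_subringD(1)[OF Sr] by (cases "i \<in> I") (auto simp: free_module_on_def)
  have sact: "s (ext_by_zero S (\<lambda>x. f (a * x))) i = a * s (ext_by_zero S f) i" 
    if "functional f" "\<forall>x\<in>S. f x \<in> Z" "a \<in> S" for f a i
  proof -
    have "s (?act a (ext_by_zero S f)) = (\<lambda>i. a * s (ext_by_zero S f) i)"
      using s ext_by_zero_in_hom[OF that(1,2) Ss] that(3) by (simp add: hom_over_def)
    then show ?thesis unfolding act[OF that(3)] by (simp add: fun_eq_iff)
  qed
  have "\<exists>d\<in>?D. \<exists>i. s d i \<notin> maximal_ideal S"
  proof (rule ccontr)
    assume "\<not> ?thesis"
    then have sm: "s d i \<in> maximal_ideal S" if "d \<in> ?D" for d i using that by blast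
    \<comment> \<open>If all coordinates lay in the maximal ideal, the expansion of
      \<open>\<psi>\<close> along them would present its value at \<open>t\<close> as a sum of
      values of integral forms at the elements \<open>s ?d i * t\<close> of
      \<open>S\<close>.\<close>
    obtain \<psi> where \<psi>: "functional \<psi>" "\<forall>x\<in>S. \<psi> x \<in> Z" "\<psi> t \<notin> Z"
      using functional_separates[OF orderD(3,2,4)[OF S(1)] t(1)] by blast
    let ?d = "ext_by_zero S \<psi>"
    have dD: "?d \<in> ?D" by (rule ext_by_zero_in_hom[OF \<psi>(1,2) Ss])
    let ?F = "{i. s ?d i \<noteq> 0}"
    have F: "finite ?F" "?F \<subseteq> I" using sfree[OF dD] by (auto simp: free_module_on_def)
    let ?\<delta> = "\<lambda>i j. if j = i then 1 else (0::'e)"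
    have "\<exists>f. functional f \<and> (\<forall>x\<in>S. f x \<in> Z) \<and> p (?\<delta> i) = ext_by_zero S f" if "i \<in> I" for i
    proof -
      have "?\<delta> i \<in> free_module_on S I" using that is_subringD(1,2)[OF Sr] by (simp add: free_module_on_def)
      then have "p (?\<delta> i) \<in> ?D" using p by (simp add: hom_over_def)
      then show ?thesis using hom_eq_ext_by_zero[OF orderD(3,2,4)[OF S(1)]] by metis
    qed
    then obtain f where f: "\<And>i. i \<in> I \<Longrightarrow> functional (f i)" "\<And>i x. i \<in> I \<Longrightarrow> x \<in> S \<Longrightarrow> f i x \<in> Z"
      "\<And>i. i \<in> I \<Longrightarrow> p (?\<delta> i) = ext_by_zero S (f i)" by metis
    have "?d = p (s ?d)" using ps dD by simp
    also have "\<dots> = (\<Sum>i\<in>?F. ?act (s ?d i) (p (?\<delta> i)))"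
      by (rule hom_over_free_module_sum[OF Sr p F sfree[OF dD] subset_refl])
    also have "\<dots> = (\<Sum>i\<in>?F. ext_by_zero S (\<lambda>x. f i (s ?d i * x)))"
    proof (rule sum.cong[OF refl])
      fix i assume "i \<in> ?F"
      with F(2) have "p (?\<delta> i) = ext_by_zero S (f i)" using f(3) by blast
      then show "?act (s ?d i) (p (?\<delta> i)) = ext_by_zero S (\<lambda>x. f i (s ?d i * x))" 
        using act[OF sS[OF dD]] by (simp only:)
    qed
    finally have eq': "?d = (\<Sum>i\<in>?F. ext_by_zero S (\<lambda>x. f i (s ?d i * x)))" .
    have eq: "\<psi> x = (\<Sum>i\<in>?F. f i (s ?d i * x))" if "x \<in> S" for x
    proof -
      have "?d x = (\<Sum>i\<in>?F. ext_by_zero S (\<lambda>x. f i (s ?d i * x)) x)"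
        using fun_cong[OF eq', of x] by (simp only: sum_fun_app)
      moreover have "ext_by_zero S g x = g x" for g using that by (simp add: ext_by_zero_def)
      ultimately show ?thesis by (simp only:)
    qed
    \<comment> \<open>The expansion is known on \<open>S\<close> only; \<open>t\<close> is scaled
      into \<open>S\<close> and the factor is cancelled afterwards.\<close>
    obtain n where n: "scaleQ (unif ^ n) t \<in> S" 
      using finite_scale_into[OF orderD(3,2,4)[OF S(1)], of "{t}"] by auto
    have "unif ^ n * \<psi> t = \<psi> (scaleQ (unif ^ n) t)" using functionalD(2)[OF \<psi>(1)] by simp
    also have "\<dots> = (\<Sum>i\<in>?F. f i (s ?d i * scaleQ (unif ^ n) t))" by (rule eq[OF n])
    also have "\<dots> = (\<Sum>i\<in>?F. unif ^ n * f i (s ?d i * t))"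
      by (rule sum.cong[OF refl]) (use f(1) F(2) functionalD(2) in \<open>auto simp: mult_scaleQ\<close>)
    finally have "\<psi> t = (\<Sum>i\<in>?F. f i (s ?d i * t))" using unif(1) by (simp add: sum_distrib_left[symmetric])
    also have "\<dots> \<in> Z"
      by (rule submodule_over_sum[OF submodule_over_self[OF subring_Z]])
         (use f(2) F(2) t(2)[OF sm[OF dD]] in auto)
    finally show False using \<psi>(3) by simp
  qed
  then obtain d i where d: "d \<in> ?D" "s d i \<notin> maximal_ideal S" by blast
  obtain w where w: "w \<in> S" "s d i * w = 1" using local_unit[OF Sr S(2) sS[OF d(1)] d(2)] by blast
  obtain f where f: "functional f" "\<forall>x\<in>S. f x \<in> Z" "d = ext_by_zero S f"
    using hom_eq_ext_by_zero[OF orderD(3,2,4)[OF S(1)] d(1)] by blast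
  \<comment> \<open>Twisting \<open>f\<close> by the inverse \<open>w\<close> of the unit coordinate
    normalises the value to 1.\<close>
  show ?thesis
  proof (rule that[of "\<lambda>x. f (w * x)" "\<lambda>d. s d i"])
    show "functional (\<lambda>x. f (w * x))" by (rule functional_mult[OF f(1)])
    show "\<forall>x\<in>S. f (w * x) \<in> Z" using f(2) w(1) is_subringD(4)[OF Sr] by simp
    show "s (ext_by_zero S (\<lambda>x. f (w * x))) i = 1" 
      unfolding sact[OF f(1,2) w(1)] using w(2) f(3) by (simp add: mult.commute)
    show "\<forall>d\<in>?D. s d i \<in> S" using sS by simp
    show "\<forall>f. \<forall>a\<in>S. functional f \<longrightarrow> (\<forall>x\<in>S. f x \<in> Z) \<longrightarrow>
      s (ext_by_zero S (\<lambda>x. f (a * x))) i = a * s (ext_by_zero S f) i" using sact by simp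
  qed
qed

text \<open>By nondegeneracy \<open>e\<close> is determined by the form sending \<open>x\<close> to
  \<open>\<phi> (e * x)\<close>, and \<open>E\<close> and its dual have the same finite dimension,
  so every form arises. The map into the dual is realised as an endomorphism of \<open>E\<close> by
  recording values on the basis \<open>B\<close>.\<close>

lemma functional_representable:
  assumes \<phi>: "functional \<phi>" and nondeg: "\<And>e. (\<And>x. \<phi> (e * x) = 0) \<Longrightarrow> e = 0" 
    and B: "finite B" "independent B" "span B = UNIV" and \<psi>: "functional \<psi>"
  obtains e where "\<And>x. \<psi> x = \<phi> (e * x)"
proof -
  interpret finite_dimensional_vector_space scaleQ B
    by unfold_locales (use B in auto)
  let ?F = "\<lambda>e. \<Sum>b\<in>B. scaleQ (\<phi> (e * b)) b"
  have in_sp: "x \<in> span B" for x using B(3) by simp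
  have rep: "representation B (\<Sum>b\<in>B. scaleQ (c b) b) b = c b" if "b \<in> B" for c b
  proof -
    have "representation B (\<Sum>b\<in>B. scaleQ (c b) b) b = (\<Sum>a\<in>B. c a * representation B a b)"
      using in_sp by (simp add: representation_sum[OF B(2)] representation_scale[OF B(2)])
    also have "\<dots> = (\<Sum>a\<in>B. if a = b then c a else 0)"
      by (rule sum.cong) (auto simp: representation_basis[OF B(2)])
    finally show ?thesis using that B(1) by simp
  qed
  have expand: "f x = (\<Sum>b\<in>B. representation B x b * f b)" if "functional f" for f x
  proof -
    have "f (\<Sum>b\<in>B. scaleQ (representation B x b) b) = (\<Sum>b\<in>B. representation B x b * f b)"
      by (simp add: functionalD[OF that])
    then show ?thesis using sum_representation_eq[OF B(2) in_sp B(1)] by simp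
  qed
  have eqI: "f x = g x" if "functional f" "functional g" "\<And>b. b \<in> B \<Longrightarrow> f b = g b" for f g x
    using that expand[OF that(1), of x] expand[OF that(2), of x] by simp
  have lin: "Vector_Spaces.linear scaleQ scaleQ ?F"
    by unfold_locales
      (simp_all add: distrib_right functionalD[OF \<phi>] scale_left_distrib sum.distrib scaleQ_mult[symmetric] 
        scale_sum_right)
  have "inj ?F"
  proof (rule injI)
    fix x y assume xy: "?F x = ?F y"
    have eB: "\<phi> (x * b) = \<phi> (y * b)" if "b \<in> B" for b
      using rep[OF that, of "\<lambda>b. \<phi> (x * b)"] rep[OF that, of "\<lambda>b. \<phi> (y * b)"] xy by simp
    have e: "\<phi> (x * z) = \<phi> (y * z)" for z
      by (rule eqI[OF functional_mult[OF \<phi>] functional_mult[OF \<phi>] eB])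
    have "\<phi> ((x - y) * z) = 0" for z
    proof -
      have "\<phi> ((x - y) * z + y * z) = \<phi> ((x - y) * z) + \<phi> (y * z)" by (rule functionalD(1)[OF \<phi>])
      then show ?thesis using e[of z] by (simp add: algebra_simps)
    qed
    then have "x - y = 0" by (rule nondeg)
    then show "x = y" by simp
  qed
  then have "surj ?F" using linear_inj_imp_surj[OF lin] by blast
  then obtain e where e: "(\<Sum>b\<in>B. scaleQ (\<psi> b) b) = ?F e" unfolding surj_def by blast
  have eB: "\<psi> b = \<phi> (e * b)" if "b \<in> B" for b
    using rep[OF that, of \<psi>] rep[OF that, of "\<lambda>b. \<phi> (e * b)"] e by simp
  have "\<psi> x = \<phi> (e * x)" for x
    by (rule eqI[OF \<psi> functional_mult[OF \<phi>] eB])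
  with that show ?thesis by blast
qed

text \<open>The coordinate \<open>h\<close> recovers \<open>a\<close> from the form sending
  \<open>x\<close> to \<open>\<phi> (a * x)\<close>, so \<open>\<phi>\<close> generates the dual of
  \<open>S\<close> freely. Hence the bilinear form \<open>\<phi> (x * y)\<close> is nondegenerate on
  \<open>E\<close>, and \<open>S\<close> is its own dual lattice for it.\<close>

lemma gorenstein_functional:
  assumes S: "order S" "local_subring S" and gor: "gorenstein Z scaleQ S"
    and t: "t \<notin> S" "\<And>a. a \<in> maximal_ideal S \<Longrightarrow> a * t \<in> S"
  obtains \<phi> where "functional \<phi>" "\<forall>x\<in>S. \<phi> x \<in> Z" "\<forall>\<psi>. functional \<psi> \<longrightarrow> (\<exists>e. \<forall>x. \<psi> x = \<phi> (e * x))"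
    "\<forall>e. (\<forall>x\<in>S. \<phi> (e * x) \<in> Z) \<longrightarrow> e \<in> S"
proof -
  note Sr = orderD(1)[OF S(1)] and Ss = orderD(2)[OF S(1)]
  obtain h :: "('e \<Rightarrow> 'q) \<Rightarrow> 'e" and \<phi> where
    \<phi>: "functional \<phi>" "\<forall>x\<in>S. \<phi> x \<in> Z" and h1: "h (ext_by_zero S \<phi>) = 1"
    and hS: "\<forall>d\<in>hom_over Z scaleQ S (*) Z. h d \<in> S"
    and h': "\<forall>f. \<forall>a\<in>S. functional f \<longrightarrow> (\<forall>x\<in>S. f x \<in> Z) \<longrightarrow>
      h (ext_by_zero S (\<lambda>x. f (a * x))) = a * h (ext_by_zero S f)"
    by (rule gorenstein_coordinate[OF S gor t])
  have h: "h (ext_by_zero S (\<lambda>x. f (a * x))) = a * h (ext_by_zero S f)"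
    if "functional f" "\<forall>x\<in>S. f x \<in> Z" "a \<in> S" for f a using h' that by blast
  have h\<phi>: "h (ext_by_zero S (\<lambda>x. \<phi> (a * x))) = a" if "a \<in> S" for a using h[OF \<phi> that] h1 by simp
  have scale: "\<exists>n. scaleQ (unif ^ n) e \<in> S" for e
    using finite_scale_into[OF orderD(3,2,4)[OF S(1)], of "{e}"] by auto
  have cancel: "x = y" if "scaleQ (unif ^ n) x = scaleQ (unif ^ n) y" for n x y
    using that unif(1) by (simp add: scale_cancel_left)
  have nondeg: "e = 0" if e: "\<And>x. \<phi> (e * x) = 0" for e
  proof -
    obtain n where n: "scaleQ (unif ^ n) e \<in> S" using scale by blast
    have "\<phi> (scaleQ (unif ^ n) e * x) = \<phi> (0 * x)" for x
      using e functionalD[OF \<phi>(1)] by (simp add: scaleQ_mult[symmetric])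
    then have "scaleQ (unif ^ n) e = 0" 
      using h\<phi>[OF n] h\<phi>[OF is_subringD(1)[OF Sr]] by simp
    then show ?thesis using cancel[of n e 0] by simp
  qed
  obtain B where B: "finite B" "independent B" "span B = UNIV"
  proof -
    obtain B0 where B0: "finite B0" "span B0 = UNIV" using fin_dim by blast
    then obtain B where "B \<subseteq> B0" "independent B" "B0 \<subseteq> span B"
      using maximal_independent_subset[of B0] by metis
    then show ?thesis using B0 span_mono[of B0 "span B"] span_span[of B] finite_subset by (intro that[of B]) auto
  qed
  have rep: "\<exists>e. \<forall>x. \<psi> x = \<phi> (e * x)" if "functional \<psi>" for \<psi>
    using functional_representable[OF \<phi>(1) nondeg B that] by blast
  have "e \<in> S" if e: "\<And>x. x \<in> S \<Longrightarrow> \<phi> (e * x) \<in> Z" for e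
  proof -
    obtain n where n: "scaleQ (unif ^ n) e \<in> S" using scale by blast
    let ?\<psi> = "\<lambda>x. \<phi> (e * x)"
    have \<psi>: "functional ?\<psi>" "\<forall>x\<in>S. ?\<psi> x \<in> Z" using functional_mult[OF \<phi>(1)] e by auto
    have "(\<lambda>x. ?\<psi> (scaleQ (unif ^ n) 1 * x)) = (\<lambda>x. \<phi> (scaleQ (unif ^ n) e * x))"
      by (simp add: scaleQ_mult[symmetric] mult_scaleQ)
    then have "scaleQ (unif ^ n) e = scaleQ (unif ^ n) 1 * h (ext_by_zero S ?\<psi>)"
      using h[OF \<psi> scale_one_in_order[OF S(1) unif_power_in_Z, of n]] h\<phi>[OF n] by simp
    then have "scaleQ (unif ^ n) e = scaleQ (unif ^ n) (h (ext_by_zero S ?\<psi>))"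
      using scaleQ_eq[of "unif ^ n" "h (ext_by_zero S ?\<psi>)"] by simp
    then have "e = h (ext_by_zero S ?\<psi>)" by (rule cancel)
    then show ?thesis using bspec[OF hS ext_by_zero_in_hom[OF \<psi> Ss]] by simp
  qed
  then show ?thesis by (intro that[of \<phi>] \<phi> allI impI rep) blast+
qed

text \<open>In terms of \<open>\<phi>\<close>, a form integral on \<open>S + S t\<close> is given by
  some \<open>f\<close> that multiplies \<open>S + S t\<close> into \<open>S\<close>. As
  \<open>t\<close> is outside \<open>S\<close>, such an \<open>f\<close> is not a unit of
  \<open>S\<close>, so it lies in the maximal ideal and takes \<open>u\<close> into
  \<open>S\<close>. Every such form is therefore integral at \<open>u\<close>, and a lattice
  contains all points at which its dual is integral.\<close>

lemma gorenstein_socle_simple: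
  assumes S: "order S" "local_subring S" and gor: "gorenstein Z scaleQ S"
    and t: "t \<notin> S" "\<And>a. a \<in> maximal_ideal S \<Longrightarrow> a * t \<in> S"
    and u: "\<And>a. a \<in> maximal_ideal S \<Longrightarrow> a * u \<in> S"
  shows "\<exists>a\<in>S. \<exists>b\<in>S. u = a + b * t"
proof -
  note Sr = orderD(1)[OF S(1)] and Ss = orderD(2)[OF S(1)]
  obtain \<phi> where \<phi>: "functional \<phi>" and \<phi>Z: "\<forall>x\<in>S. \<phi> x \<in> Z" 
    and rep: "\<forall>\<psi>. functional \<psi> \<longrightarrow> (\<exists>e. \<forall>x. \<psi> x = \<phi> (e * x))"
    and self: "\<forall>e. (\<forall>x\<in>S. \<phi> (e * x) \<in> Z) \<longrightarrow> e \<in> S"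
    by (rule gorenstein_functional[OF S gor t])
  let ?L = "{a + b * t | a b. a \<in> S \<and> b \<in> S}"
  have memI: "a + b * t \<in> ?L" if "a \<in> S" "b \<in> S" for a b using that by blast
  have Lmod: "submodule_over S (*) ?L"
    unfolding submodule_over_def
  proof (intro conjI ballI)
    show "0 \<in> ?L" using memI[of 0 0] is_subringD(1)[OF Sr] by simp
    fix x assume "x \<in> ?L"
    then obtain a b where x: "x = a + b * t" "a \<in> S" "b \<in> S" by blast
    show "c * x \<in> ?L" if "c \<in> S" for c
      using memI[of "c * a" "c * b"] x that is_subringD(4)[OF Sr] by (simp add: algebra_simps)
    fix y assume "y \<in> ?L"
    then obtain a' b' where y: "y = a' + b' * t" "a' \<in> S" "b' \<in> S" by blast
    show "x + y \<in> ?L"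
      using memI[of "a + a'" "b + b'"] x y is_subringD(5)[OF Sr] by (simp add: algebra_simps)
  qed
  have SL: "S \<subseteq> ?L" using memI[OF _ is_subringD(1)[OF Sr]] by auto
  have tL: "t \<in> ?L" using memI[OF is_subringD(1,2)[OF Sr]] by simp
  note Lsub = order_submodule[OF S(1) Lmod]
  have Lspan: "span ?L = UNIV" using span_mono[OF SL] orderD(4)[OF S(1)] by auto
  have Lfg: "fg_over Z scaleQ ?L"
  proof -
    obtain n where n: "scaleQ (unif ^ n) t \<in> S"
      using finite_scale_into[OF orderD(3,2,4)[OF S(1)], of "{t}"] by auto
    obtain G where G: "finite G" "G \<subseteq> S" "S \<subseteq> span_over Z scaleQ G"
      using orderD(3)[OF S(1)] by (auto simp: fg_over_iff)
    let ?G = "G \<union> (\<lambda>g. g * t) ` G"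
    note sp = submodule_over_span_over[OF subring_Z md, of ?G]
    have G': "?G \<subseteq> span_over Z scaleQ ?G"
      by (rule span_over_superset[OF subring_Z md]) (use G(1) in simp)
    have 1: "a \<in> span_over Z scaleQ ?G" if "a \<in> S" for a
      using that G(3) span_over_least[OF sp, of G] G' by blast
    have 2: "b * t \<in> span_over Z scaleQ ?G" if b: "b \<in> S" for b
    proof -
      from b G(3) have "b \<in> span_over Z scaleQ G" by blast
      then obtain c where c: "\<forall>g\<in>G. c g \<in> Z" "b = (\<Sum>g\<in>G. scaleQ (c g) g)" by (rule span_overE)
      have "b * t = (\<Sum>g\<in>G. scaleQ (c g) (g * t))" unfolding c(2) by (simp add: sum_distrib_right scaleQ_mult)
      also have "\<dots> \<in> span_over Z scaleQ ?G"
        by (intro submodule_over_sum[OF sp] submodule_overD(3)[OF sp]) (use c(1) G' in auto)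
      finally show ?thesis .
    qed
    have "?L \<subseteq> span_over Z scaleQ ?G"
      using 1 2 submodule_overD(2)[OF sp] by auto
    moreover have "?G \<subseteq> ?L"
      using G(2) SL memI[OF is_subringD(1)[OF Sr]] by auto
    ultimately show ?thesis unfolding fg_over_iff using G(1) by (intro exI[of _ ?G]) simp
  qed
  have "u \<in> ?L"
  proof (rule ccontr)
    assume "u \<notin> ?L"
    then obtain \<psi> where \<psi>: "functional \<psi>" "\<forall>x\<in>?L. \<psi> x \<in> Z" "\<psi> u \<notin> Z"
      using functional_separates[OF Lfg Lsub Lspan] by blast
    obtain f where f: "\<And>x. \<psi> x = \<phi> (f * x)" using rep \<psi>(1) by blast
    have fL: "f * x \<in> S" if "x \<in> ?L" for x
    proof (rule self[rule_format])
      fix y assume "y \<in> S"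
      then have "y * x \<in> ?L" using submodule_overD(3)[OF Lmod _ that] by blast
      then have "\<psi> (y * x) \<in> Z" using \<psi>(2) by blast
      then show "\<phi> (f * x * y) \<in> Z" unfolding f by (simp add: mult_ac)
    qed
    have fS: "f \<in> S" using fL[OF subsetD[OF SL is_subringD(2)[OF Sr]]] by simp
    show False
    proof (cases "f \<in> maximal_ideal S")
      case True
      then have "f * u \<in> ?L" using u SL by blast
      then have "f * u \<in> S" using u True by blast
      then show False using f \<psi>(3) \<phi>Z by simp
    next
      case False
      then obtain g where g: "g \<in> S" "f * g = 1" using local_unit[OF Sr S(2) fS] by blast
      have "t = (f * g) * t" using g(2) by simp
      then have "t = g * (f * t)" by (simp add: mult_ac)
      then show False using fL[OF tL] g(1) is_subringD(4)[OF Sr] t(1) by metis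
    qed
  qed
  then show ?thesis by blast
qed

end

section \<open>Overorders of a local Bass order\<close>

definition multiplier_ring :: "'e::comm_ring_1 set \<Rightarrow> 'e set" where
  "multiplier_ring S = {x. \<forall>a\<in>maximal_ideal S. a * x \<in> maximal_ideal S}"

context dvr_algebra
begin

definition maximal_order :: "'e set \<Rightarrow> bool" where
  "maximal_order S \<longleftrightarrow> (\<forall>T. order T \<longrightarrow> S \<subseteq> T \<longrightarrow> T = S)"

text \<open>The maximal ideal contains the uniformizer times the order and therefore has full
  rank.\<close>

lemma maximal_ideal_lattice:
  assumes S: "order S" "local_subring S"
  shows "fg_over Z scaleQ (maximal_ideal S)" "span (maximal_ideal S) = UNIV"
    "submodule_over Z scaleQ (maximal_ideal S)"
proof -
  note Sr = orderD(1)[OF S(1)]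
  note mi = maximal_ideal_ideal[OF Sr S(2)]
  show 1: "submodule_over Z scaleQ (maximal_ideal S)" by (rule order_submodule[OF S(1) mi])
  show "fg_over Z scaleQ (maximal_ideal S)"
    by (rule fg_submodule[OF vs orderD(3)[OF S(1)] 1]) (use maximal_ideal_proper[OF Sr S(2)] in blast)
  have "S \<subseteq> span (maximal_ideal S)"
  proof
    fix x assume "x \<in> S"
    then have "x * scaleQ unif 1 \<in> maximal_ideal S"
      using submodule_overD(3)[OF mi] unif_in_maximal_ideal[OF S] by blast
    then have "scaleQ (1 / unif) (x * scaleQ unif 1) \<in> span (maximal_ideal S)"
      by (intro span_scale span_base)
    then show "x \<in> span (maximal_ideal S)" using unif(1) by (simp add: mult_scaleQ)
  qed
  then have "span S \<subseteq> span (maximal_ideal S)" by (metis span_mono span_span)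
  then show "span (maximal_ideal S) = UNIV" using orderD(4)[OF S(1)] by auto
qed

context
  fixes S :: "'e set"
  assumes S: "order S" "local_subring S"
begin

lemma multiplier_ring:
  shows subring_multiplier_ring: "is_subring (multiplier_ring S)"
    and submodule_multiplier_ring: "submodule_over Z scaleQ (multiplier_ring S)"
    and subset_multiplier_ring: "S \<subseteq> multiplier_ring S"
    and maximal_ideal_ideal_multiplier: "submodule_over (multiplier_ring S) (*) (maximal_ideal S)"
proof -
  note Sr = orderD(1)[OF S(1)]
  note mi = maximal_ideal_ideal[OF Sr S(2)]
  let ?m = "maximal_ideal S" and ?O = "multiplier_ring S"
  have neg: "- x \<in> ?m" if "x \<in> ?m" for x
    using submodule_overD(3)[OF mi is_subringD(6)[OF Sr is_subringD(2)[OF Sr]] that] by simp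
  have I: "x \<in> ?O" if "\<And>a. a \<in> ?m \<Longrightarrow> a * x \<in> ?m" for x using that by (simp add: multiplier_ring_def)
  have D: "a * x \<in> ?m" if "x \<in> ?O" "a \<in> ?m" for x a using that by (simp add: multiplier_ring_def)
  show SO: "S \<subseteq> ?O"
  proof
    fix x assume x: "x \<in> S"
    show "x \<in> ?O" by (rule I) (use submodule_overD(3)[OF mi x] in \<open>simp add: mult.commute\<close>)
  qed
  have diff: "x - y \<in> ?O" if "x \<in> ?O" "y \<in> ?O" for x y
  proof (rule I)
    fix a assume a: "a \<in> ?m"
    have "a * x + - (a * y) \<in> ?m" by (intro submodule_overD(2)[OF mi] neg D that a)
    then show "a * (x - y) \<in> ?m" by (simp add: right_diff_distrib)
  qed
  have mult: "x * y \<in> ?O" if "x \<in> ?O" "y \<in> ?O" for x y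
  proof (rule I)
    fix a assume a: "a \<in> ?m"
    have "(a * x) * y \<in> ?m" by (intro D that a)
    then show "a * (x * y) \<in> ?m" by (simp add: mult.assoc)
  qed
  show ring: "is_subring ?O"
    unfolding is_subring_def using SO is_subringD(2)[OF Sr] diff mult by blast
  have "scaleQ z x \<in> ?O" if "z \<in> Z" "x \<in> ?O" for z x
    using is_subringD(4)[OF ring subsetD[OF SO scale_one_in_order[OF S(1) that(1)]] that(2)] scaleQ_eq[of z x] 
    by simp
  then show "submodule_over Z scaleQ ?O"
    using is_subringD(1,5)[OF ring] by (simp add: submodule_over_def)
  show "submodule_over ?O (*) ?m"
    using submodule_overD(1,2)[OF mi] D by (simp add: submodule_over_def mult.commute)
qed

context
  fixes T :: "'e set"
  assumes gor: "gorenstein Z scaleQ S" and T: "order T" "S \<subset> T"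
begin

text \<open>Powers of each element of the maximal ideal push \<open>T\<close> into \<open>S\<close>,
  so some \<open>t\<close> in \<open>T\<close> outside \<open>S\<close> is multiplied into
  \<open>S\<close> by the maximal ideal. Simplicity of the socle writes every multiplier as
  \<open>a + b * t\<close>, and with \<open>y\<close> for \<open>t\<close> it gives the last claim.
  Equality with \<open>S\<close> would make the maximal ideal a radical ideal whose multipliers all
  lie in \<open>S\<close>, forcing \<open>T = S\<close>.\<close>

lemma multiplier_ring_overorder:
  shows order_multiplier_ring: "order (multiplier_ring S)"
    and psubset_multiplier_ring: "S \<subset> multiplier_ring S"
    and multiplier_ring_subset: "multiplier_ring S \<subseteq> T"
    and multiplier_ring_generator: "\<And>y. y \<in> multiplier_ring S \<Longrightarrow> y \<notin> S \<Longrightarrow> 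
      multiplier_ring S \<subseteq> {a + b * y | a b. a \<in> S \<and> b \<in> S}"
proof -
  let ?m = "maximal_ideal S" and ?O = "multiplier_ring S"
  note Sr = orderD(1)[OF S(1)] and Tr = orderD(1)[OF T(1)]
  note mi = maximal_ideal_ideal[OF Sr S(2)]
  note ml = maximal_ideal_lattice[OF S]
  have mS: "?m \<subseteq> S" using maximal_ideal_proper[OF Sr S(2)] by blast
  have nil: "\<exists>k. \<forall>t\<in>T. a ^ k * t \<in> ?m" if "a \<in> ?m" for a
    using maximal_ideal_power_mult[OF S that T(1) psubset_imp_subset[OF T(2)] mi ml(1,2)] by metis
  then have nil': "\<exists>k. \<forall>t\<in>T. a ^ k * t \<in> S" if "a \<in> ?m" for a using that mS by (metis subsetD)
  obtain t where t: "t \<in> T" "t \<notin> S" "\<And>a. a \<in> ?m \<Longrightarrow> a * t \<in> S"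
    using ex_annihilated[OF Sr orderD(2)[OF S(1)] Tr T(2) mS ml(1) nil'] by auto
  have OS: "a * x \<in> S" if "x \<in> ?O" "a \<in> ?m" for x a
    using that mS by (auto simp: multiplier_ring_def)
  show OT: "?O \<subseteq> T"
  proof
    fix u assume u: "u \<in> ?O"
    obtain a b where ab: "a \<in> S" "b \<in> S" "u = a + b * t"
      using gorenstein_socle_simple[OF S gor t(2,3) OS[OF u]] by auto
    then have "a \<in> T" "b \<in> T" using T(2) by auto
    then show "u \<in> T" unfolding ab(3) by (intro is_subringD(4,5)[OF Tr] t(1))
  qed
  show ord: "order ?O"
    by (rule orderI[OF S(1) T(1) subset_multiplier_ring OT subring_multiplier_ring submodule_multiplier_ring])
  have "?O \<noteq> S"
  proof
    assume eq: "?O = S"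
    have "T = S"
    proof (rule order_maximal_if_radical_ideal[OF Sr orderD(2)[OF S(1)] Tr _ mi mS ml(1) nil])
      show "t \<in> S" if "\<And>a. a \<in> ?m \<Longrightarrow> a * t \<in> ?m" for t
        using that eq by (auto simp: multiplier_ring_def)
      show "x \<in> ?m" if "x \<in> S" "x ^ n \<in> ?m" for x n by (rule maximal_ideal_power[OF Sr S(2) that])
    qed (use T(2) in auto)
    then show False using T(2) by blast
  qed
  then show "S \<subset> ?O" using subset_multiplier_ring by blast
  fix y assume y: "y \<in> ?O" "y \<notin> S"
  show "?O \<subseteq> {a + b * y | a b. a \<in> S \<and> b \<in> S}"
  proof
    fix u assume u: "u \<in> ?O"
    obtain a b where "a \<in> S" "b \<in> S" "u = a + b * y"
      using gorenstein_socle_simple[OF S gor y(2) OS[OF y(1)] OS[OF u]] by auto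
    then show "u \<in> {a + b * y | a b. a \<in> S \<and> b \<in> S}" by blast
  qed
qed

text \<open>Modulo the maximal ideal of \<open>S\<close>, the multiplier ring is a two-dimensional
  algebra over the residue field. It is either reduced or an algebra of dual numbers, and the latter
  is local.\<close>

lemma multiplier_ring_local_or_maximal:
  "local_subring (multiplier_ring S) \<or> maximal_order (multiplier_ring S)"
proof -
  let ?m = "maximal_ideal S" and ?O = "multiplier_ring S"
  note Sr = orderD(1)[OF S(1)]
  note Or = subring_multiplier_ring
  note mi = maximal_ideal_ideal[OF Sr S(2)] and miO = maximal_ideal_ideal_multiplier
  note ml = maximal_ideal_lattice[OF S]
  have mS: "?m \<subseteq> S" using maximal_ideal_proper[OF Sr S(2)] by blast
  note SO = subset_multiplier_ring
  show ?thesis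
  proof (cases "\<forall>x\<in>?O. \<forall>n. x ^ n \<in> ?m \<longrightarrow> x \<in> ?m")
    case True
    have "maximal_order ?O"
      unfolding maximal_order_def
    proof (intro allI impI)
      fix T' assume T': "order T'" "?O \<subseteq> T'"
      have ST': "S \<subseteq> T'" using SO T' by blast
      show "T' = ?O"
      proof (rule order_maximal_if_radical_ideal[OF Or submodule_multiplier_ring orderD(1)[OF T'(1)] T'(2) miO _ ml(1)])
        show "?m \<subseteq> ?O" using mS SO by blast
        show "\<exists>k. \<forall>t\<in>T'. a ^ k * t \<in> ?m" if "a \<in> ?m" for a
          using maximal_ideal_power_mult[OF S that T'(1) ST' mi ml(1,2)] by metis
        show "t \<in> ?O" if "\<And>a. a \<in> ?m \<Longrightarrow> a * t \<in> ?m" for t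
          using that by (simp add: multiplier_ring_def)
        show "x \<in> ?m" if "x \<in> ?O" "x ^ n \<in> ?m" for x n using True that by blast
      qed
    qed
    then show ?thesis ..
  next
    case False
    then obtain x n where x: "x \<in> ?O" "x ^ n \<in> ?m" "x \<notin> ?m" by blast
    define k where "k = (LEAST k. x ^ k \<in> ?m)"
    have k: "x ^ k \<in> ?m" unfolding k_def using LeastI[of "\<lambda>k. x ^ k \<in> ?m", OF x(2)] .
    have "k \<noteq> 0" using k one_notin_maximal_ideal[OF Sr S(2)] by (cases k) auto
    moreover have "k \<noteq> 1" using k x(3) by auto
    ultimately obtain l where l: "k = Suc (Suc l)" by (metis One_nat_def not0_implies_Suc)
    \<comment> \<open>The last power of \<open>x\<close> outside the maximal ideal; its square is
      \<open>x ^ l * x ^ k\<close>.\<close>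
    define y where "y = x ^ Suc l"
    have y: "y \<in> ?O" unfolding y_def by (rule subring_power[OF Or x(1)])
    have ym: "y \<notin> ?m" using not_less_Least[of "Suc l" "\<lambda>k. x ^ k \<in> ?m"] l k_def y_def by simp
    have yy: "y * y \<in> ?m"
    proof -
      have "y * y = x ^ l * x ^ k" by (simp add: y_def l power_add[symmetric] del: power_Suc)
      then show ?thesis using submodule_overD(3)[OF miO subring_power[OF Or x(1)] k] by simp
    qed
    have yS: "y \<notin> S"
    proof
      assume "y \<in> S"
      then show False using maximal_ideal_power[OF Sr S(2), of y 2] yy ym by (simp add: power2_eq_square)
    qed
    have gen: "\<exists>a b. u = a + b * y \<and> a \<in> S \<and> b \<in> S" if "u \<in> ?O" for u
      using multiplier_ring_generator[OF y yS] that by blast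
    have yyb: "b * y * (b' * y) \<in> ?m" if "b \<in> S" "b' \<in> S" for b b'
    proof -
      have "(b * b') * (y * y) \<in> ?m" using submodule_overD(3)[OF mi _ yy] is_subringD(4)[OF Sr that] by blast
      then show ?thesis by (simp add: mult_ac)
    qed
    \<comment> \<open>The candidate for the maximal ideal: \<open>y\<close> is nilpotent modulo the
      maximal ideal of \<open>S\<close>, so invertibility is decided by the constant term.\<close>
    let ?N = "{a + b * y | a b. a \<in> ?m \<and> b \<in> S}"
    have NI: "a + b * y \<in> ?N" if "a \<in> ?m" "b \<in> S" for a b using that by blast
    have my: "a * y \<in> ?m" if "a \<in> ?m" for a using y that by (simp add: multiplier_ring_def)
    have "local_subring ?O"
    proof (rule local_subringI[of _ ?N])
      show "submodule_over ?O (*) ?N"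
        unfolding submodule_over_def
      proof (intro conjI ballI)
        show "0 \<in> ?N" using NI[OF submodule_overD(1)[OF mi] is_subringD(1)[OF Sr]] by simp
        fix u assume "u \<in> ?N"
        then obtain a b where u: "u = a + b * y" "a \<in> ?m" "b \<in> S" by blast
        {
          fix w assume "w \<in> ?N"
          then obtain a' b' where "w = a' + b' * y" "a' \<in> ?m" "b' \<in> S" by blast
          then show "u + w \<in> ?N"
            using NI[of "a + a'" "b + b'"] u submodule_overD(2)[OF mi] is_subringD(5)[OF Sr] 
            by (simp add: algebra_simps)
        }
        fix w assume "w \<in> ?O"
        then obtain c d where w: "w = c + d * y" "c \<in> S" "d \<in> S" using gen by blast
        have "w * u = (c * a + (d * (a * y) + d * y * (b * y))) + (c * b) * y"
          by (simp add: w u algebra_simps)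
        moreover have "c * a + (d * (a * y) + d * y * (b * y)) \<in> ?m"
          by (intro submodule_overD(2,3)[OF mi] my yyb w u)
        ultimately show "w * u \<in> ?N" using NI[OF _ is_subringD(4)[OF Sr w(2) u(3)]] by simp
      qed
      show "?N \<subseteq> ?O" using mS SO y is_subringD(4,5)[OF Or] by blast
      show "1 \<in> ?O" by (rule is_subringD(2)[OF Or])
      show "1 \<notin> ?N"
      proof
        assume "1 \<in> ?N"
        then obtain a b where ab: "1 = a + b * y" "a \<in> ?m" "b \<in> S" by blast
        \<comment> \<open>Squaring \<open>b * y = 1 - a\<close> removes \<open>y\<close> and leads
          back to a statement inside \<open>S\<close>.\<close>
        have "b * y * (b * y) = (1 - a) * (1 - a)" using ab(1) by (metis add_diff_cancel_left')
        then have "(1 - a) * (1 - a) \<in> ?m" using yyb[OF ab(3) ab(3)] by simp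
        then have "1 - a \<in> ?m" 
          using maximal_ideal_prime[OF Sr S(2), of "1 - a" "1 - a"] ab(2) mS is_subringD(2,3)[OF Sr] by blast
        then have "(1 - a) + a \<in> ?m" by (rule submodule_overD(2)[OF mi _ ab(2)])
        then show False using one_notin_maximal_ideal[OF Sr S(2)] by simp
      qed
      fix u assume u: "u \<in> ?O" "u \<notin> ?N"
      then obtain a b where ab: "u = a + b * y" "a \<in> S" "b \<in> S" using gen by blast
      have am: "a \<notin> ?m" using ab u(2) by blast
      \<comment> \<open>The conjugate \<open>a - b * y\<close> turns \<open>u\<close> into the norm
        \<open>?q\<close>, a unit of \<open>S\<close> because \<open>a * a\<close> is a unit and the
        other term lies in the maximal ideal.\<close>
      let ?q = "a * a + - (b * y * (b * y))"
      have neg: "- (b * y * (b * y)) \<in> ?m"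
        using submodule_overD(3)[OF mi is_subringD(6)[OF Sr is_subringD(2)[OF Sr]] yyb[OF ab(3) ab(3)]] by simp
      have "?q \<notin> ?m"
      proof
        assume "?q \<in> ?m"
        then have "?q + b * y * (b * y) \<in> ?m" by (rule submodule_overD(2)[OF mi _ yyb[OF ab(3) ab(3)]])
        then have "a * a \<in> ?m" by simp
        then show False using maximal_ideal_prime[OF Sr S(2) ab(2) ab(2)] am by blast
      qed
      moreover have "?q \<in> S" using neg mS ab is_subringD(4,5)[OF Sr] by blast
      ultimately obtain z where z: "z \<in> S" "?q * z = 1" using local_unit[OF Sr S(2)] by blast
      have "u * ((a - b * y) * z) = ?q * z" by (simp add: ab algebra_simps)
      moreover have "(a - b * y) * z \<in> ?O" 
        using ab z SO by (intro is_subringD(3,4)[OF Or] y) auto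
      ultimately show "\<exists>w\<in>?O. u * w = 1" using z(2) by auto
    qed
    then show ?thesis ..
  qed
qed

end

text \<open>The involution permutes the units of \<open>S\<close>, hence preserves the maximal
  ideal, and multipliers follow.\<close>

lemma multiplier_ring_stable:
  assumes \<sigma>: "involution_over scaleQ \<sigma>" and stable: "\<And>x. x \<in> S \<Longrightarrow> \<sigma> x \<in> S" 
    and x: "x \<in> multiplier_ring S"
  shows "\<sigma> x \<in> multiplier_ring S"
proof -
  note Sr = orderD(1)[OF S(1)]
  have \<sigma>': "\<sigma> (x * y) = \<sigma> x * \<sigma> y" "\<sigma> 1 = 1" "\<sigma> (\<sigma> x) = x" for x y 
    using \<sigma> by (simp_all add: involution_over_def)
  have m: "\<sigma> a \<in> maximal_ideal S" if a: "a \<in> maximal_ideal S" for a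
  proof (rule ccontr)
    assume "\<sigma> a \<notin> maximal_ideal S"
    moreover have "\<sigma> a \<in> S" using a maximal_ideal_proper[OF Sr S(2)] stable by blast
    ultimately obtain y where y: "y \<in> S" "\<sigma> a * y = 1" using local_unit[OF Sr S(2)] by blast
    have "\<sigma> (\<sigma> a * y) = a * \<sigma> y" by (simp add: \<sigma>')
    then have "a * \<sigma> y = 1" using y(2) \<sigma>'(2) by simp
    then show False using notin_maximal_ideal_if_unit[OF Sr S(2) stable[OF y(1)]] a by blast
  qed
  show ?thesis
    unfolding multiplier_ring_def mem_Collect_eq
  proof
    fix a assume "a \<in> maximal_ideal S"
    then have "\<sigma> a * x \<in> maximal_ideal S" using m x by (simp add: multiplier_ring_def)
    then have "\<sigma> (\<sigma> a * x) \<in> maximal_ideal S" by (rule m)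
    then show "a * \<sigma> x \<in> maximal_ideal S" by (simp add: \<sigma>')
  qed
qed

end

text \<open>
  Starting from \<open>R\<close>, iterated multiplier rings climb through \<open>\<sigma>\<close>-stable local orders
  inside \<open>T\<close> until they reach \<open>T\<close>; the last one may fail to be local, but is then maximal.
\<close>

theorem bass_overorder:
  assumes R: "bass_order Z scaleQ R" "local_subring R"
    and \<sigma>: "involution_over scaleQ \<sigma>" "\<sigma> ` R \<subseteq> R"
    and T: "order T" "R \<subseteq> T"
  shows "(\<forall>x\<in>T. \<sigma> x \<in> T) \<and> (local_subring T \<or> maximal_order T)"
proof -
  let ?P = "\<lambda>S. order S \<and> R \<subseteq> S \<and> S \<subseteq> T \<and> local_subring S \<and> (\<forall>x\<in>S. \<sigma> x \<in> S)"
  have "R \<in> Collect ?P" using R \<sigma> T by (auto simp: bass_order_def)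
  then have ne: "Collect ?P \<noteq> {}" by blast
  \<comment> \<open>Zorn's lemma replaces the iteration: a maximal \<sigma>-stable local order
    between \<open>R\<close> and \<open>T\<close> is \<open>T\<close> itself or has a multiplier
    ring that is not local.\<close>
  have "\<exists>M\<in>Collect ?P. \<forall>X\<in>Collect ?P. M \<subseteq> X \<longrightarrow> X = M"
  proof (rule subset_Zorn_nonempty[OF ne])
    fix \<C> assume C: "\<C> \<noteq> {}" "subset.chain (Collect ?P) \<C>"
    then have CP: "\<C> \<subseteq> Collect ?P" by (simp add: subset_chain_def)
    have "\<Union>\<C> \<in> \<C>"
    proof (rule chain_Union_mem[OF vs orderD(3)[OF T(1)] C(1)])
      show "subset.chain UNIV \<C>" using C(2) by (simp add: subset_chain_def)
      show "submodule_over Z scaleQ N \<and> N \<subseteq> T" if "N \<in> \<C>" for N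
        using subsetD[OF CP that] orderD(2) by simp
    qed
    then show "\<Union>\<C> \<in> Collect ?P" by (rule subsetD[OF CP])
  qed
  then obtain S where S': "S \<in> Collect ?P" "\<forall>X\<in>Collect ?P. S \<subseteq> X \<longrightarrow> X = S" by (rule bexE)
  then have S: "?P S" by simp
  have max: "X = S" if "?P X" "S \<subseteq> X" for X using S'(2) that by simp
  show ?thesis
  proof (cases "S = T")
    case True
    then show ?thesis using S by blast
  next
    case False
    then have ST: "S \<subset> T" using S by blast
    have S': "order S" "local_subring S" using S by auto
    have gor: "gorenstein Z scaleQ S" using R(1) S by (simp add: bass_order_def)
    let ?O = "multiplier_ring S"
    note O = multiplier_ring_overorder[OF S' gor T(1) ST]
    have st: "\<forall>x\<in>?O. \<sigma> x \<in> ?O" using multiplier_ring_stable[OF S' \<sigma>(1)] S by blast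
    have "\<not> local_subring ?O"
    proof
      assume "local_subring ?O"
      moreover have "R \<subseteq> ?O" using S O(2) by blast
      ultimately have "?P ?O" using O(1,3) st by blast
      from max[OF this] O(2) show False by blast
    qed
    then have "maximal_order ?O" using multiplier_ring_local_or_maximal[OF S' gor T(1) ST] by blast
    then have "T = ?O" using O(3) T(1) unfolding maximal_order_def by blast
    then show ?thesis using st \<open>maximal_order ?O\<close> by simp
  qed
qed

end

section \<open>Lattices with a sesquilinear pairing\<close>

text \<open>Gaussian elimination modulo \<open>N\<close>: \<open>1 - c l\<close> is a unit, so
  \<open>b l\<close> can be solved for and substituted into the other relations, whose coefficients
  stay in the maximal ideal.\<close>

lemma nakayama_local:
  fixes S :: "'e::comm_ring_1 set"
  assumes S: "is_subring S" "local_subring S" and "module scale" and N: "submodule_over S scale N"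
    and "finite L" and b: "\<And>l. l \<in> L \<Longrightarrow> 
      \<exists>c. (\<forall>k\<in>L. c k \<in> maximal_ideal S) \<and> b l - (\<Sum>k\<in>L. scale (c k) (b k)) \<in> N"
  shows "\<forall>l\<in>L. b l \<in> N"
  using assms(5,6)
proof (induction L)
  case empty
  then show ?case by simp
next
  case (insert l L)
  interpret module scale by fact
  note mi = maximal_ideal_ideal[OF S]
  have mS: "maximal_ideal S \<subseteq> S" using maximal_ideal_proper[OF S] by blast
  obtain c where c: "\<forall>k\<in>insert l L. c k \<in> maximal_ideal S" "b l - (\<Sum>k\<in>insert l L. scale (c k) (b k)) \<in> N"
    using insert.prems[of l] by auto
  define n where "n = b l - (\<Sum>k\<in>insert l L. scale (c k) (b k))"
  have nN: "n \<in> N" using c(2) by (simp add: n_def)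
  have cl: "c l \<in> maximal_ideal S" using c(1) by simp
  have "1 - c l \<notin> maximal_ideal S"
  proof
    assume "1 - c l \<in> maximal_ideal S"
    then have "(1 - c l) + c l \<in> maximal_ideal S" by (rule submodule_overD(2)[OF mi _ cl])
    then show False using one_notin_maximal_ideal[OF S] by simp
  qed
  moreover have "1 - c l \<in> S" using cl mS is_subringD(2,3)[OF S(1)] by blast
  ultimately obtain u where u: "u \<in> S" "(1 - c l) * u = 1" using local_unit[OF S] by blast
  have "n + (\<Sum>k\<in>L. scale (c k) (b k)) = scale (1 - c l) (b l)"
    using insert.hyps by (simp add: n_def scale_left_diff_distrib)
  then have "scale u (n + (\<Sum>k\<in>L. scale (c k) (b k))) = b l" 
    using u(2) by (simp add: mult.commute)
  then have bl: "b l = scale u n + (\<Sum>k\<in>L. scale (u * c k) (b k))"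
    by (simp add: scale_right_distrib scale_sum_right)
  have "\<exists>d. (\<forall>j\<in>L. d j \<in> maximal_ideal S) \<and> b k - (\<Sum>j\<in>L. scale (d j) (b j)) \<in> N" if k: "k \<in> L" for k
  proof -
    obtain d where d: "\<forall>j\<in>insert l L. d j \<in> maximal_ideal S" "b k - (\<Sum>j\<in>insert l L. scale (d j) (b j)) \<in> N"
      using insert.prems[of k] k by auto
    let ?d = "\<lambda>j. d j + d l * (u * c j)"
    have dl: "d l \<in> S" using d(1) mS by blast
    have dm: "?d j \<in> maximal_ideal S" if "j \<in> L" for j
      by (intro submodule_overD(2,3)[OF mi] dl u(1)) (use c(1) d(1) that in auto)
    have eq: "b k - (\<Sum>j\<in>L. scale (?d j) (b j)) = 
      (b k - (\<Sum>j\<in>insert l L. scale (d j) (b j))) + scale (d l) (scale u n)"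
    proof -
      have "(\<Sum>j\<in>insert l L. scale (d j) (b j)) = scale (d l) (b l) + (\<Sum>j\<in>L. scale (d j) (b j))"
        using insert.hyps by simp
      also have "scale (d l) (b l) = scale (d l) (scale u n) + (\<Sum>j\<in>L. scale (d l * (u * c j)) (b j))"
        by (subst bl) (simp only: scale_right_distrib scale_sum_right scale_scale)
      finally show ?thesis by (simp add: scale_left_distrib sum.distrib algebra_simps)
    qed
    show ?thesis
    proof (intro exI[of _ ?d] conjI ballI dm)
      show "b k - (\<Sum>j\<in>L. scale (?d j) (b j)) \<in> N"
        unfolding eq by (intro submodule_overD(2,3)[OF N] d(2) dl u(1) nN)
    qed
  qed
  then have L: "\<forall>k\<in>L. b k \<in> N" by (rule insert.IH)
  have "b l \<in> N"
    unfolding bl 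
  proof (intro submodule_overD(2,3)[OF N] u(1) nN submodule_over_sum[OF N])
    fix k assume k: "k \<in> L"
    then show "b k \<in> N" "u * c k \<in> S" using L c(1) mS u(1) is_subringD(4)[OF S(1)] by auto
  qed
  then show ?case using L by simp
qed

section \<open>Lattices spanned over coefficient orders that vary with the generator\<close>

definition lspan :: "('e \<Rightarrow> 'v::ab_group_add \<Rightarrow> 'v) \<Rightarrow> ('i \<Rightarrow> 'e set) \<Rightarrow> 'i set \<Rightarrow> ('i \<Rightarrow> 'v) \<Rightarrow> 'v set" where
  "lspan scale A J e = {\<Sum>p\<in>J. scale (c p) (e p) | c. \<forall>p\<in>J. c p \<in> A p}"

text \<open>Coefficients range over all of \<open>E\<close>, so independence is not tied to a
  coefficient order.\<close>

definition lindep :: "('e::zero \<Rightarrow> 'v::ab_group_add \<Rightarrow> 'v) \<Rightarrow> 'i set \<Rightarrow> ('i \<Rightarrow> 'v) \<Rightarrow> bool" where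
  "lindep scale J e \<longleftrightarrow> (\<forall>c. (\<Sum>p\<in>J. scale (c p) (e p)) = 0 \<longrightarrow> (\<forall>p\<in>J. c p = 0))"

lemma lspanI: "\<forall>p\<in>J. c p \<in> A p \<Longrightarrow> (\<Sum>p\<in>J. scale (c p) (e p)) \<in> lspan scale A J e"
  unfolding lspan_def mem_Collect_eq by (rule exI[of _ c]) simp

lemma lspanE:
  assumes "x \<in> lspan scale A J e"
  obtains c where "\<forall>p\<in>J. c p \<in> A p" "x = (\<Sum>p\<in>J. scale (c p) (e p))"
  using assms unfolding lspan_def mem_Collect_eq by (elim exE conjE) (rule that)

lemma lspan_cong:
  assumes "\<And>p. p \<in> J \<Longrightarrow> e p = e' p"
  shows "lspan scale A J e = lspan scale A J e'"
proof -
  have "(\<Sum>p\<in>J. scale (c p) (e p)) = (\<Sum>p\<in>J. scale (c p) (e' p))" for c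
    by (rule sum.cong) (use assms in auto)
  then show ?thesis by (simp add: lspan_def)
qed

lemma lspan_Un:
  assumes "finite J1" "finite J2" "J1 \<inter> J2 = {}"
  shows "lspan scale A (J1 \<union> J2) e = {x + y | x y. x \<in> lspan scale A J1 e \<and> y \<in> lspan scale A J2 e}"
    (is "?L = ?R")
proof (intro equalityI subsetI)
  fix x assume "x \<in> ?L"
  then obtain c where c: "\<forall>p\<in>J1 \<union> J2. c p \<in> A p" "x = (\<Sum>p\<in>J1 \<union> J2. scale (c p) (e p))" by (rule lspanE)
  then have x: "x = (\<Sum>p\<in>J1. scale (c p) (e p)) + (\<Sum>p\<in>J2. scale (c p) (e p))"
    by (simp only: sum.union_disjoint[OF assms])
  have "(\<Sum>p\<in>J1. scale (c p) (e p)) \<in> lspan scale A J1 e" "(\<Sum>p\<in>J2. scale (c p) (e p)) \<in> lspan scale A J2 e"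
    using c(1) by (auto intro!: lspanI)
  with x show "x \<in> ?R" by blast
next
  fix z assume "z \<in> ?R"
  then obtain x y where z: "z = x + y" and x: "x \<in> lspan scale A J1 e" and y: "y \<in> lspan scale A J2 e" by blast
  obtain c where c: "\<forall>p\<in>J1. c p \<in> A p" "x = (\<Sum>p\<in>J1. scale (c p) (e p))" using x by (rule lspanE)
  obtain d where d: "\<forall>p\<in>J2. d p \<in> A p" "y = (\<Sum>p\<in>J2. scale (d p) (e p))" using y by (rule lspanE)
  let ?c = "\<lambda>p. if p \<in> J1 then c p else d p"
  have "(\<Sum>p\<in>J1. scale (?c p) (e p)) = x" unfolding c(2) by (rule sum.cong) auto
  moreover have "(\<Sum>p\<in>J2. scale (?c p) (e p)) = y" unfolding d(2) by (rule sum.cong) (use assms(3) in auto)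
  ultimately have "z = (\<Sum>p\<in>J1 \<union> J2. scale (?c p) (e p))" 
    by (simp only: sum.union_disjoint[OF assms] z)
  also have "\<dots> \<in> ?L" by (rule lspanI) (use c(1) d(1) in auto)
  finally show "z \<in> ?L" .
qed

locale sesquilinear_lattice = dvr_algebra v Z scaleQ + V: module scaleE
  for v :: "'q::field \<Rightarrow> int" and Z and scaleQ :: "'q \<Rightarrow> 'e::comm_ring_1 \<Rightarrow> 'e"
    and scaleE :: "'e \<Rightarrow> 'v::ab_group_add \<Rightarrow> 'v" +
  fixes \<sigma> :: "'e \<Rightarrow> 'e" and pairing :: "'v \<Rightarrow> 'v \<Rightarrow> 'e"
  assumes involution: "involution_over scaleQ \<sigma>"
    and sesquilinear: "sesquilinear_over UNIV \<sigma> scaleE UNIV pairing"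
begin

lemma \<sigma>: "\<sigma> (x + y) = \<sigma> x + \<sigma> y" "\<sigma> (x * y) = \<sigma> x * \<sigma> y" "\<sigma> 1 = 1" 
  "\<sigma> (scaleQ q x) = scaleQ q (\<sigma> x)" "\<sigma> (\<sigma> x) = x"
  using involution by (auto simp: involution_over_def)

lemma pairing_add: "pairing (x + y) z = pairing x z + pairing y z" 
    "pairing x (y + z) = pairing x y + pairing x z"
  using sesquilinear by (auto simp: sesquilinear_over_def)

lemma pairing_scale2: "pairing (scaleE a x) (scaleE b y) = a * pairing x y * \<sigma> b"
  using sesquilinear by (simp add: sesquilinear_over_def)

lemma pairing_scale: "pairing (scaleE a x) y = a * pairing x y" "pairing x (scaleE b y) = pairing x y * \<sigma> b"
  using pairing_scale2[of a x 1 y] pairing_scale2[of 1 x b y] by (simp_all add: \<sigma>)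

lemma pairing_zero: "pairing 0 y = 0" "pairing x 0 = 0"
proof -
  have "pairing (scaleE 0 0) y = 0 * pairing 0 y" by (rule pairing_scale)
  then show "pairing 0 y = 0" by simp
  have "pairing x 0 + 0 = pairing x 0 + pairing x 0" using pairing_add(2)[of x 0 0] by simp
  then show "pairing x 0 = 0" by (simp only: add_left_cancel)
qed

lemma pairing_sum: "pairing (sum f I) y = (\<Sum>i\<in>I. pairing (f i) y)" 
    "pairing x (sum f I) = (\<Sum>i\<in>I. pairing x (f i))"
  by (induction I rule: infinite_finite_induct; simp add: pairing_add pairing_zero)+

lemma pairing_diff: "pairing x (y - z) = pairing x y - pairing x z"
  using pairing_add(2)[of x "y - z" z] by (simp add: algebra_simps)

abbreviation scaleV :: "'q \<Rightarrow> 'v \<Rightarrow> 'v" where "scaleV q \<equiv> scaleE (scaleQ q 1)"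

lemma vector_space_V: "vector_space scaleV"
proof (rule vector_space.intro)
  show "scaleV a (x + y) = scaleV a x + scaleV a y" for a x y by (rule V.scale_right_distrib)
  show "scaleV (a + b) x = scaleV a x + scaleV b x" for a b x
    by (simp add: scale_left_distrib V.scale_left_distrib)
  show "scaleV a (scaleV b x) = scaleV (a * b) x" for a b x
    by (simp add: scaleQ_mult[symmetric] mult_scaleQ mult.commute)
  show "scaleV 1 x = x" for x by simp
qed

lemma scaleV_cancel:
  assumes "q \<noteq> 0" "scaleE (scaleQ q 1) x = scaleE (scaleQ q 1) y"
  shows "x = y"
  using assms vector_space.scale_cancel_left[OF vector_space_V, of q x y] by simp

lemma submodule_lspan:
  assumes S: "is_subring S" and A: "\<And>p. p \<in> J \<Longrightarrow> submodule_over S (*) (A p)"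
  shows "submodule_over S scaleE (lspan scaleE A J e)"
  unfolding submodule_over_def
proof (intro conjI ballI)
  have "(\<Sum>p\<in>J. scaleE ((\<lambda>_. 0) p) (e p)) \<in> lspan scaleE A J e"
    by (rule lspanI) (use submodule_overD(1)[OF A] in simp)
  then show "0 \<in> lspan scaleE A J e" by simp
  fix x assume "x \<in> lspan scaleE A J e"
  then obtain c where c: "\<forall>p\<in>J. c p \<in> A p" "x = (\<Sum>p\<in>J. scaleE (c p) (e p))" by (rule lspanE)
  {
    fix y assume "y \<in> lspan scaleE A J e"
    then obtain d where d: "\<forall>p\<in>J. d p \<in> A p" "y = (\<Sum>p\<in>J. scaleE (d p) (e p))" by (rule lspanE)
    have "x + y = (\<Sum>p\<in>J. scaleE (c p + d p) (e p))"
      unfolding c(2) d(2) by (simp add: V.scale_left_distrib sum.distrib)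
    also have "\<dots> \<in> lspan scaleE A J e" by (rule lspanI) (use c(1) d(1) submodule_overD(2)[OF A] in simp)
    finally show "x + y \<in> lspan scaleE A J e" .
  }
  fix a assume a: "a \<in> S"
  have "scaleE a x = (\<Sum>p\<in>J. scaleE (a * c p) (e p))"
    unfolding c(2) by (simp add: V.scale_sum_right)
  also have "\<dots> \<in> lspan scaleE A J e" by (rule lspanI) (use c(1) a submodule_overD(3)[OF A] in simp)
  finally show "scaleE a x \<in> lspan scaleE A J e" .
qed

lemma lspan_scaled_generator:
  assumes "finite J" "p \<in> J" "a \<in> A p" "\<And>q. q \<in> J \<Longrightarrow> 0 \<in> A q"
  shows "scaleE a (e p) \<in> lspan scaleE A J e"
proof -
  have "scaleE a (e p) = (\<Sum>q\<in>J. if q = p then scaleE a (e q) else 0)" using assms by simp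
  also have "\<dots> = (\<Sum>q\<in>J. scaleE (if q = p then a else 0) (e q))" by (rule sum.cong) auto
  also have "\<dots> \<in> lspan scaleE A J e" by (rule lspanI) (use assms in auto)
  finally show ?thesis .
qed

lemma lindep_subset:
  assumes "finite J" "I \<subseteq> J" "lindep scaleE J e"
  shows "lindep scaleE I e"
  unfolding lindep_def
proof (intro allI impI)
  fix c assume c: "(\<Sum>p\<in>I. scaleE (c p) (e p)) = 0"
  let ?c = "\<lambda>p. if p \<in> I then c p else 0"
  have "(\<Sum>p\<in>J. scaleE (?c p) (e p)) = (\<Sum>p\<in>I. scaleE (?c p) (e p))"
    by (rule sum.mono_neutral_right) (use assms in auto)
  also have "\<dots> = (\<Sum>p\<in>I. scaleE (c p) (e p))" by (rule sum.cong) auto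
  finally have "(\<Sum>p\<in>J. scaleE (?c p) (e p)) = 0" using c by simp
  then have "\<forall>p\<in>J. ?c p = 0" by (rule assms(3)[unfolded lindep_def, THEN spec, THEN mp])
  then have "?c p = 0" if "p \<in> I" for p using assms(2) that by blast
  then show "\<forall>p\<in>I. c p = 0" by simp
qed

lemma lindep_eqD:
  assumes "lindep scaleE J e" "(\<Sum>p\<in>J. scaleE (c p) (e p)) = (\<Sum>p\<in>J. scaleE (d p) (e p))" "p \<in> J"
  shows "c p = d p"
proof -
  have "(\<Sum>p\<in>J. scaleE (c p - d p) (e p)) = 0"
    using assms(2) by (simp add: V.scale_left_diff_distrib sum_subtractf)
  then show ?thesis using assms(1,3) unfolding lindep_def by auto
qed

lemma fg_lspan:
  assumes J: "finite J" and A: "\<And>p. p \<in> J \<Longrightarrow> order (A p)"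
  shows "fg_over Z scaleV (lspan scaleE A J e)"
proof -
  have "\<exists>G. \<forall>p\<in>J. finite (G p) \<and> G p \<subseteq> A p \<and> A p \<subseteq> span_over Z scaleQ (G p)"
    using A orderD(3) unfolding fg_over_iff by (intro bchoice) blast
  then obtain G where G: "\<And>p. p \<in> J \<Longrightarrow> finite (G p)" "\<And>p. p \<in> J \<Longrightarrow> G p \<subseteq> A p"
    "\<And>p. p \<in> J \<Longrightarrow> A p \<subseteq> span_over Z scaleQ (G p)" by metis
  let ?G = "\<Union>p\<in>J. (\<lambda>g. scaleE g (e p)) ` G p"
  have fin: "finite ?G" using J G(1) by blast
  have mdV: "module scaleV" using vector_space_V by (simp add: module_iff_vector_space)
  note sp = submodule_over_span_over[OF subring_Z mdV, of ?G]
  note sup = span_over_superset[OF subring_Z mdV fin]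
  have "lspan scaleE A J e \<subseteq> span_over Z scaleV ?G"
  proof
    fix x assume "x \<in> lspan scaleE A J e"
    then obtain c where c: "\<forall>p\<in>J. c p \<in> A p" "x = (\<Sum>p\<in>J. scaleE (c p) (e p))" by (rule lspanE)
    have "scaleE (c p) (e p) \<in> span_over Z scaleV ?G" if p: "p \<in> J" for p
    proof -
      have "c p \<in> span_over Z scaleQ (G p)" using c(1) G(3) p by blast
      then obtain d where d: "\<forall>g\<in>G p. d g \<in> Z" "c p = (\<Sum>g\<in>G p. scaleQ (d g) g)" by (rule span_overE)
      have "scaleE (c p) (e p) = (\<Sum>g\<in>G p. scaleV (d g) (scaleE g (e p)))"
        unfolding d(2) by (simp add: V.scale_sum_left scaleQ_mult[symmetric])
      also have "\<dots> \<in> span_over Z scaleV ?G"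
      proof (intro submodule_over_sum[OF sp] submodule_overD(3)[OF sp])
        fix g assume g: "g \<in> G p"
        then show "d g \<in> Z" using d(1) by simp
        have "scaleE g (e p) \<in> ?G" using g p by blast
        then show "scaleE g (e p) \<in> span_over Z scaleV ?G" by (rule subsetD[OF sup])
      qed
      finally show ?thesis .
    qed
    then show "x \<in> span_over Z scaleV ?G" unfolding c(2) by (rule submodule_over_sum[OF sp])
  qed
  moreover have "?G \<subseteq> lspan scaleE A J e"
  proof
    fix x assume "x \<in> ?G"
    then obtain p g where pg: "p \<in> J" "g \<in> G p" "x = scaleE g (e p)" by blast
    show "x \<in> lspan scaleE A J e" unfolding pg(3)
      by (rule lspan_scaled_generator[OF J pg(1)]) (use pg G(2) A orderD(1) is_subringD(1) in blast)+
  qed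
  ultimately show ?thesis unfolding fg_over_iff using fin by blast
qed

end

lemma colonI: "(\<And>y. y \<in> S \<Longrightarrow> x * y \<in> R) \<Longrightarrow> x \<in> colon R S"
  by (simp add: colon_def)

lemma colonD: "x \<in> colon R S \<Longrightarrow> y \<in> S \<Longrightarrow> x * y \<in> R"
  by (simp add: colon_def)

section \<open>Perfect pairings on lattices assembled from blocks\<close>

locale overorder_family = sesquilinear_lattice v Z scaleQ scaleE \<sigma> pairing
  for v :: "'q::field \<Rightarrow> int" and Z and scaleQ :: "'q \<Rightarrow> 'e::comm_ring_1 \<Rightarrow> 'e"
    and scaleE :: "'e \<Rightarrow> 'v::ab_group_add \<Rightarrow> 'v" and \<sigma> pairing +
  fixes R :: "'e set" and A :: "'i \<Rightarrow> 'e set" and J0 :: "'i set"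
  assumes finite_index: "finite J0" and order_R: "order R"
    and order_A: "p \<in> J0 \<Longrightarrow> order (A p)" and R_subset: "p \<in> J0 \<Longrightarrow> R \<subseteq> A p"
    and stable_A: "p \<in> J0 \<Longrightarrow> x \<in> A p \<Longrightarrow> \<sigma> x \<in> A p"
begin

abbreviation "latt \<equiv> lspan scaleE A"

definition integral_on :: "'i set \<Rightarrow> ('i \<Rightarrow> 'v) \<Rightarrow> bool" where
  "integral_on J e \<longleftrightarrow> (\<forall>x\<in>latt J e. \<forall>y\<in>latt J e. pairing x y \<in> R)"

text \<open>
  The functional on the lattice spanned by the \<open>e p\<close> with prescribed values \<open>t p\<close> is
  \<open>R\<close>-valued exactly if \<open>t p\<close> lies in \<open>(R : A p)\<close>; so this is surjectivity onto the dual.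
\<close>

definition perfect_on :: "'i set \<Rightarrow> ('i \<Rightarrow> 'v) \<Rightarrow> bool" where
  "perfect_on J e \<longleftrightarrow> (\<forall>t. (\<forall>p\<in>J. t p \<in> colon R (A p)) \<longrightarrow> 
     (\<exists>y\<in>latt J e. \<forall>p\<in>J. pairing (e p) y = t p))"

lemma perfect_onD:
  assumes "perfect_on J e" "\<forall>p\<in>J. t p \<in> colon R (A p)"
  shows "\<exists>y\<in>latt J e. \<forall>p\<in>J. pairing (e p) y = t p"
  using assms(1)[unfolded perfect_on_def, THEN spec, THEN mp, OF assms(2)] .

lemma subring_A: "p \<in> J0 \<Longrightarrow> is_subring (A p)"
  using orderD(1)[OF order_A] .

lemmas subring_R = orderD(1)[OF order_R]

lemma finite_subset_index: "J \<subseteq> J0 \<Longrightarrow> finite J"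
  using finite_index finite_subset by blast

lemma submodule_latt_R:
  assumes "J \<subseteq> J0"
  shows "submodule_over R scaleE (latt J e)"
proof (rule submodule_lspan[OF subring_R])
  fix p assume "p \<in> J"
  with assms have "p \<in> J0" by blast
  then show "submodule_over R (*) (A p)"
    using subring_A[of p] R_subset[of p] by (auto simp: submodule_over_def is_subringD)
qed

lemma submodule_latt_Z:
  assumes "J \<subseteq> J0"
  shows "submodule_over Z scaleV (latt J e)"
  using submodule_latt_R[OF assms, of e] scale_one_in_order[OF order_R] by (simp add: submodule_over_def)

lemma submodule_latt_block:
  assumes "J \<subseteq> J0" "\<And>p. p \<in> J \<Longrightarrow> A p = S" "is_subring S"
  shows "submodule_over S scaleE (latt J e)"
  by (rule submodule_lspan[OF assms(3)]) (simp add: assms submodule_over_self)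

lemma generator_in_latt:
  assumes "J \<subseteq> J0" "p \<in> J" "a \<in> A p"
  shows "scaleE a (e p) \<in> latt J e"
proof (rule lspan_scaled_generator)
  show "0 \<in> A q" if "q \<in> J" for q
    using is_subringD(1)[OF subring_A[of q]] assms(1) that by blast
qed (use assms finite_subset_index in auto)

lemma basis_in_latt: "J \<subseteq> J0 \<Longrightarrow> p \<in> J \<Longrightarrow> e p \<in> latt J e"
  using generator_in_latt[of J p 1 e] is_subringD(2)[OF subring_A[of p]] by auto

lemma latt_mono:
  assumes "I \<subseteq> J" "J \<subseteq> J0"
  shows "latt I e \<subseteq> latt J e"
proof
  fix x assume "x \<in> latt I e"
  then obtain c where c: "\<forall>p\<in>I. c p \<in> A p" "x = (\<Sum>p\<in>I. scaleE (c p) (e p))" by (rule lspanE)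
  show "x \<in> latt J e" unfolding c(2)
    by (rule submodule_over_sum[OF submodule_latt_R[OF assms(2)]])
      (use c(1) assms in \<open>auto intro!: generator_in_latt\<close>)
qed

lemma integral_on_subset: "integral_on J e \<Longrightarrow> latt I e' \<subseteq> latt J e \<Longrightarrow> integral_on I e'"
  unfolding integral_on_def by blast

lemma pairing_in_colon_left:
  assumes J: "J \<subseteq> J0" "integral_on J e" and p: "p \<in> J" and y: "y \<in> latt J e"
  shows "pairing (e p) y \<in> colon R (A p)"
proof (rule colonI)
  fix b assume "b \<in> A p"
  then have "pairing (scaleE b (e p)) y \<in> R"
    using J(2) y generator_in_latt[OF J(1) p] unfolding integral_on_def by blast
  then show "pairing (e p) y * b \<in> R" by (simp add: pairing_scale mult.commute)
qed

text \<open>A factor \<open>b\<close> of the value comes from \<open>\<sigma> b\<close> acting in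
  the second argument, and \<sigma>-stability of \<open>A q\<close> keeps that multiple in the
  lattice.\<close>

lemma pairing_in_colon_right:
  assumes J: "J \<subseteq> J0" "integral_on J e" and q: "q \<in> J" and y: "y \<in> latt J e" and c: "c \<in> A q"
  shows "pairing y (scaleE c (e q)) \<in> colon R (A q)"
proof (rule colonI)
  fix b assume b: "b \<in> A q"
  have q0: "q \<in> J0" using J(1) q by blast
  have "scaleE (\<sigma> b * c) (e q) \<in> latt J e"
    by (rule generator_in_latt[OF J(1) q]) (rule is_subringD(4)[OF subring_A[OF q0] stable_A[OF q0 b] c])
  then have "pairing y (scaleE (\<sigma> b * c) (e q)) \<in> R" using J(2) y unfolding integral_on_def by blast
  then show "pairing y (scaleE c (e q)) * b \<in> R" by (simp add: pairing_scale \<sigma> mult_ac)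
qed

context
  fixes J1 :: "'i set" and S :: "'e set" and \<alpha> \<beta> :: 'e
  assumes J1: "J1 \<subseteq> J0" and S: "order S" "\<And>x. x \<in> S \<Longrightarrow> \<sigma> x \<in> S" and AS: "\<And>p. p \<in> J1 \<Longrightarrow> A p = S"
    and \<alpha>: "colon R S = (\<lambda>x. \<alpha> * x) ` S" "\<alpha> * \<beta> = 1"
begin

lemma block_divide:
  assumes "x \<in> colon R S"
  shows "\<beta> * x \<in> S" "\<alpha> * (\<beta> * x) = x"
proof -
  from assms \<alpha>(1) obtain s where s: "s \<in> S" "x = \<alpha> * s" by blast
  have "\<beta> * x = (\<alpha> * \<beta>) * s" by (simp add: s(2) mult_ac)
  then show "\<beta> * x \<in> S" using \<alpha>(2) s(1) by simp
  have "\<alpha> * (\<beta> * x) = (\<alpha> * \<beta>) * x" by (simp add: mult_ac)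
  then show "\<alpha> * (\<beta> * x) = x" using \<alpha>(2) by simp
qed

text \<open>
  Perfectness makes \<open>y \<mapsto> (\<Sum>p\<in>J1. \<sigma> (\<beta> \<langle>e p, y\<rangle>) e p)\<close> a surjective endomorphism of a Noetherian
  module, hence injective.
\<close>

lemma block_nondegenerate:
  assumes int: "integral_on J1 e" and perf: "perfect_on J1 e"
    and y: "y = (\<Sum>p\<in>J1. scaleE (c p) (e p))" "\<And>p. p \<in> J1 \<Longrightarrow> pairing (e p) y = 0"
  shows "y = 0"
proof -
  let ?f = "\<lambda>y. \<Sum>p\<in>J1. scaleE (\<sigma> (\<beta> * pairing (e p) y)) (e p)"
  have surj: "?f ` latt J1 e = latt J1 e"
  proof (intro equalityI subsetI)
    fix x assume "x \<in> ?f ` latt J1 e"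
    then obtain y where y: "y \<in> latt J1 e" "x = ?f y" by blast
    show "x \<in> latt J1 e" unfolding y(2)
    proof (rule lspanI, rule ballI)
      fix p assume p: "p \<in> J1"
      have "pairing (e p) y \<in> colon R S" using pairing_in_colon_left[OF J1 int p y(1)] AS[OF p] by simp
      then show "\<sigma> (\<beta> * pairing (e p) y) \<in> A p" using S(2) block_divide(1) AS[OF p] by simp
    qed
  next
    fix x assume "x \<in> latt J1 e"
    then obtain d where d: "\<forall>p\<in>J1. d p \<in> A p" "x = (\<Sum>p\<in>J1. scaleE (d p) (e p))" by (rule lspanE)
    \<comment> \<open>A preimage of \<open>x\<close> must have the values
      \<open>\<alpha> * \<sigma> (d p)\<close>: dividing by \<alpha> and applying \<sigma> returns
      \<open>d p\<close>.\<close>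
    have "\<forall>p\<in>J1. \<alpha> * \<sigma> (d p) \<in> colon R (A p)"
      using d(1) AS S(2) \<alpha>(1) by auto
    from perfect_onD[OF perf this]
    obtain y where y: "y \<in> latt J1 e" "\<forall>p\<in>J1. pairing (e p) y = \<alpha> * \<sigma> (d p)" by blast
    have "?f y = x" unfolding d(2)
    proof (rule sum.cong[OF refl])
      fix p assume "p \<in> J1"
      then have "\<beta> * pairing (e p) y = (\<alpha> * \<beta>) * \<sigma> (d p)" using y(2) by (simp add: mult_ac)
      then show "scaleE (\<sigma> (\<beta> * pairing (e p) y)) (e p) = scaleE (d p) (e p)" using \<alpha>(2) by (simp add: \<sigma>)
    qed
    then show "x \<in> ?f ` latt J1 e" using y(1) by blast
  qed
  have finJ: "finite J1" by (rule finite_subset_index[OF J1])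
  have f_scale: "?f (scaleV q x) = scaleV q (?f x)" for q x
    by (simp add: pairing_scale \<sigma> V.scale_sum_right mult_ac)
  \<comment> \<open>The coefficients \<open>c\<close> are arbitrary elements of \<open>E\<close>;
    scaling brings \<open>y\<close> into the lattice on which the endomorphism acts.\<close>
  obtain n where n: "\<And>a. a \<in> c ` J1 \<Longrightarrow> scaleQ (unif ^ n) a \<in> S"
    using finite_scale_into[OF orderD(3,2,4)[OF S(1)], of "c ` J1"] finJ by blast
  let ?z = "scaleV (unif ^ n) y"
  have "?z = (\<Sum>p\<in>J1. scaleE (scaleQ (unif ^ n) (c p)) (e p))"
    unfolding y(1) by (simp add: V.scale_sum_right scaleQ_mult[symmetric])
  also have "\<dots> \<in> latt J1 e" by (rule lspanI) (use n AS in auto)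
  finally have zL: "?z \<in> latt J1 e" .
  have "?f y = (\<Sum>p\<in>J1. 0)" 
  proof (rule sum.cong[OF refl])
    fix p assume "p \<in> J1"
    moreover have "\<sigma> 0 = 0" using \<sigma>(4)[of 0 0] by simp
    ultimately show "scaleE (\<sigma> (\<beta> * pairing (e p) y)) (e p) = 0" using y(2) by simp
  qed
  then have "?f y = 0" by simp
  then have fz: "?f ?z = 0" unfolding f_scale by simp
  have "?z = 0"
  proof (rule surj_imp_inj_on_fg[OF vector_space_V _ submodule_latt_Z[OF J1, of e] _ _ surj zL fz])
    show "fg_over Z scaleV (latt J1 e)" by (rule fg_lspan[OF finJ]) (use order_A J1 in blast)
    show "?f (x + y) = ?f x + ?f y" for x y
      by (simp add: pairing_add distrib_left \<sigma> V.scale_left_distrib sum.distrib)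
    show "?f (scaleV a x) = scaleV a (?f x)" for a x by (rule f_scale)
  qed
  then show "y = 0" using scaleV_cancel[of "unif ^ n" y 0] unif(1) by simp
qed

context
  fixes J2 :: "'i set" and e :: "'i \<Rightarrow> 'v"
  assumes J2: "J2 \<subseteq> J0" and disj: "J1 \<inter> J2 = {}"
    and int: "integral_on (J1 \<union> J2) e" and perf: "perfect_on (J1 \<union> J2) e"
begin

lemma union_index: "J1 \<union> J2 \<subseteq> J0"
  using J1 J2 by blast

lemma latt_union: "latt (J1 \<union> J2) e' = {x + y | x y. x \<in> latt J1 e' \<and> y \<in> latt J2 e'}"
  by (rule lspan_Un[OF finite_subset_index[OF J1] finite_subset_index[OF J2] disj])

text \<open>
  Modulo the maximal ideal \<open>\<mm>\<close> of \<open>S\<close>, the blocks with larger orders contribute nothing to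
  the values on the block of \<open>S\<close>, because \<open>(R : A q)\<close> is contained in \<open>\<alpha> \<mm>\<close>.
\<close>

lemma block_perfect:
  assumes loc: "local_subring S" and small: "\<And>q. q \<in> J2 \<Longrightarrow> colon R (A q) \<subseteq> (\<lambda>x. \<alpha> * x) ` maximal_ideal S"
  shows "perfect_on J1 e"
  unfolding perfect_on_def
proof (intro allI impI)
  fix t assume t: "\<forall>p\<in>J1. t p \<in> colon R (A p)"
  note Sr = orderD(1)[OF S(1)]
  note mi = maximal_ideal_ideal[OF Sr loc]
  note U = union_index
  have finJ: "finite J1" "finite J2" using finite_subset_index J1 J2 by auto
  let ?scale = "\<lambda>a (f :: 'i \<Rightarrow> 'e) p. a * f p"
  let ?b = "\<lambda>l p. if p = l then 1 else (0::'e)"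
  \<comment> \<open>The value vectors, divided by \<alpha>, that the first block attains. A scalar
    \<open>a\<close> on value vectors is realised by \<open>\<sigma> a\<close> on the block.\<close>
  let ?N = "{f. \<exists>y\<in>latt J1 e. \<forall>p\<in>J1. pairing (e p) y = \<alpha> * f p}"
  have LS: "submodule_over S scaleE (latt J1 e)" by (rule submodule_latt_block[OF J1 _ Sr]) (rule AS)
  have mdf: "module ?scale" by unfold_locales (auto simp: fun_eq_iff algebra_simps)
  have N: "submodule_over S ?scale ?N"
    unfolding submodule_over_def
  proof (intro conjI ballI)
    show "0 \<in> ?N" using submodule_overD(1)[OF LS] by (auto simp: pairing_zero intro!: bexI[of _ 0])
    fix f assume "f \<in> ?N"
    then obtain y where y: "y \<in> latt J1 e" "\<forall>p\<in>J1. pairing (e p) y = \<alpha> * f p" by blast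
    {
      fix g assume "g \<in> ?N"
      then obtain z where z: "z \<in> latt J1 e" "\<forall>p\<in>J1. pairing (e p) z = \<alpha> * g p" by blast
      then show "f + g \<in> ?N" using y submodule_overD(2)[OF LS y(1) z(1)]
        by (auto simp: pairing_add distrib_left intro!: bexI[of _ "y + z"])
    }
    fix a assume a: "a \<in> S"
    then show "?scale a f \<in> ?N" using y submodule_overD(3)[OF LS S(2)[OF a] y(1)]
      by (auto simp: pairing_scale \<sigma> mult_ac intro!: bexI[of _ "scaleE (\<sigma> a) y"])
  qed
  have "\<forall>l\<in>J1. ?b l \<in> ?N"
  proof (rule nakayama_local[OF Sr loc mdf N finJ(1)])
    fix l assume l: "l \<in> J1"
    \<comment> \<open>Perfectness on the union gives \<open>y\<close> with value \<alpha> at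
      \<open>e l\<close> and 0 at the other generators. Dropping its component \<open>y2\<close> in
      the other blocks changes the values by \<alpha> times elements of the maximal ideal, which is
      the congruence that Nakayama's lemma asks for.\<close>
    let ?t = "\<lambda>p. if p = l then \<alpha> else 0"
    have "\<alpha> \<in> colon R S" unfolding \<alpha>(1) using is_subringD(2)[OF Sr] by (intro image_eqI[of _ _ 1]) auto
    moreover have "0 \<in> colon R X" for X using is_subringD(1)[OF subring_R] by (simp add: colon_def)
    ultimately have "\<forall>p\<in>J1 \<union> J2. ?t p \<in> colon R (A p)" using AS l by simp
    from perfect_onD[OF perf this]
    obtain y where y: "y \<in> latt (J1 \<union> J2) e" "\<forall>p\<in>J1 \<union> J2. pairing (e p) y = ?t p" by (rule bexE)
    then obtain y1 y2 where y12: "y = y1 + y2" "y1 \<in> latt J1 e" "y2 \<in> latt J2 e" 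
      unfolding latt_union by blast
    obtain c where c: "\<forall>q\<in>J2. c q \<in> A q" "y2 = (\<Sum>q\<in>J2. scaleE (c q) (e q))" using y12(3) by (rule lspanE)
    have "\<exists>d. d \<in> maximal_ideal S \<and> pairing (e p) y2 = \<alpha> * d" if p: "p \<in> J1" for p
    proof -
      have "\<exists>d. \<forall>q\<in>J2. d q \<in> maximal_ideal S \<and> pairing (e p) (scaleE (c q) (e q)) = \<alpha> * d q"
      proof (rule bchoice, rule ballI)
        fix q assume q: "q \<in> J2"
        have "pairing (e p) (scaleE (c q) (e q)) \<in> colon R (A q)"
          by (rule pairing_in_colon_right[OF U int]) (use q c(1) p basis_in_latt[OF U] in auto)
        then show "\<exists>d. d \<in> maximal_ideal S \<and> pairing (e p) (scaleE (c q) (e q)) = \<alpha> * d"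
          using small[OF q] by blast
      qed
      then obtain d where d: "\<forall>q\<in>J2. d q \<in> maximal_ideal S \<and> pairing (e p) (scaleE (c q) (e q)) = \<alpha> * d q"
        by blast
      have "pairing (e p) y2 = \<alpha> * (\<Sum>q\<in>J2. d q)"
        unfolding c(2) pairing_sum sum_distrib_left by (rule sum.cong) (use d in auto)
      moreover have "(\<Sum>q\<in>J2. d q) \<in> maximal_ideal S"
        by (rule submodule_over_sum[OF mi]) (use d in auto)
      ultimately show ?thesis by blast
    qed
    then obtain d where d: "\<And>p. p \<in> J1 \<Longrightarrow> d p \<in> maximal_ideal S" 
      "\<And>p. p \<in> J1 \<Longrightarrow> pairing (e p) y2 = \<alpha> * d p" by metis
    have "?b l - (\<Sum>k\<in>J1. ?scale (d k) (?b k)) \<in> ?N"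
    proof (rule CollectI, rule bexI[OF _ y12(2)], rule ballI)
      fix p assume p: "p \<in> J1"
      have "(\<Sum>k\<in>J1. ?scale (d k) (?b k)) p = (\<Sum>k\<in>J1. if p = k then d k else 0)"
        unfolding sum_fun_app by (rule sum.cong) auto
      then have 1: "(\<Sum>k\<in>J1. ?scale (d k) (?b k)) p = d p" using p finJ(1) by simp
      have "pairing (e p) y1 = pairing (e p) y - pairing (e p) y2"
        unfolding y12(1) by (simp add: pairing_add)
      also have "\<dots> = \<alpha> * (?b l p - d p)" using y(2) d(2) p by (simp add: right_diff_distrib)
      finally show "pairing (e p) y1 = \<alpha> * (?b l - (\<Sum>k\<in>J1. ?scale (d k) (?b k))) p" 
        unfolding minus_apply 1 .
    qed
    then show "\<exists>c. (\<forall>k\<in>J1. c k \<in> maximal_ideal S) \<and> ?b l - (\<Sum>k\<in>J1. ?scale (c k) (?b k)) \<in> ?N"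
      using d(1) by blast
  qed
  then have "(\<Sum>l\<in>J1. ?scale (\<beta> * t l) (?b l)) \<in> ?N"
    using t AS block_divide(1) by (intro submodule_over_sum[OF N] submodule_overD(3)[OF N]) auto
  then obtain y where y: "y \<in> latt J1 e" 
    "\<forall>p\<in>J1. pairing (e p) y = \<alpha> * (\<Sum>l\<in>J1. ?scale (\<beta> * t l) (?b l)) p" by blast
  have "pairing (e p) y = t p" if p: "p \<in> J1" for p
  proof -
    have "(\<Sum>l\<in>J1. ?scale (\<beta> * t l) (?b l)) p = (\<Sum>l\<in>J1. if p = l then \<beta> * t l else 0)"
      unfolding sum_fun_app by (rule sum.cong) auto
    also have "\<dots> = \<beta> * t p" using p finJ(1) by simp
    finally show ?thesis using y(2) p block_divide(2)[of "t p"] t AS by simp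
  qed
  then show "\<exists>y\<in>latt J1 e. \<forall>p\<in>J1. pairing (e p) y = t p" using y(1) by blast
qed

text \<open>Each \<open>e q\<close> is corrected by the element \<open>x q\<close> of the first
  block that has the same pairings with that block. Perfectness supplies \<open>x q\<close>;
  nondegeneracy makes the correction compatible with the coefficient order
  \<open>A q\<close>.\<close>

lemma block_split:
  assumes ind: "lindep scaleE (J1 \<union> J2) e" and perf1: "perfect_on J1 e"
  obtains e' where "lindep scaleE J2 e'" "\<And>p q. p \<in> J1 \<Longrightarrow> q \<in> J2 \<Longrightarrow> pairing (e p) (e' q) = 0"
    "latt (J1 \<union> J2) e = {x + y | x y. x \<in> latt J1 e \<and> y \<in> latt J2 e'}" "perfect_on J2 e'"
proof -
  note Sr = orderD(1)[OF S(1)]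
  note U = union_index
  have finJ: "finite J1" "finite J2" using finite_subset_index J1 J2 by auto
  have LS: "submodule_over S scaleE (latt J1 e)" by (rule submodule_latt_block[OF J1 _ Sr]) (rule AS)
  note LU = submodule_latt_R[OF U, of e]
  have L1U: "latt J1 e \<subseteq> latt (J1 \<union> J2) e" by (rule latt_mono[OF _ U]) blast
  have int1: "integral_on J1 e" by (rule integral_on_subset[OF int L1U])
  note nondeg = block_nondegenerate[OF int1 perf1]
  have proj: "\<exists>x\<in>latt J1 e. \<forall>p\<in>J1. pairing (e p) x = pairing (e p) y" if "y \<in> latt (J1 \<union> J2) e" for y
    by (rule perfect_onD[OF perf1]) (use pairing_in_colon_left[OF U int _ that] in auto)
  have "\<forall>q\<in>J2. \<exists>x\<in>latt J1 e. \<forall>p\<in>J1. pairing (e p) x = pairing (e p) (e q)"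
    using proj basis_in_latt[OF U] by blast
  then obtain x where x: "\<And>q. q \<in> J2 \<Longrightarrow> x q \<in> latt J1 e" 
    "\<And>p q. q \<in> J2 \<Longrightarrow> p \<in> J1 \<Longrightarrow> pairing (e p) (x q) = pairing (e p) (e q)" by metis
  have "\<forall>q\<in>J2. \<exists>d. x q = (\<Sum>p\<in>J1. scaleE (d p) (e p))" using x(1) by (blast elim: lspanE)
  then obtain d where d: "\<And>q. q \<in> J2 \<Longrightarrow> x q = (\<Sum>p\<in>J1. scaleE (d q p) (e p))" by metis
  \<comment> \<open>As \<open>c\<close> need not lie in \<open>S\<close>, it is not evident that
    \<open>scaleE c (x q)\<close> stays in the block. Its pairings with the block agree with those
    of the projection \<open>x'\<close> of \<open>scaleE c (e q)\<close>, which does lie there, and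
    nondegeneracy over \<open>E\<close> forces equality.\<close>
  have cx: "scaleE c (x q) \<in> latt J1 e" if q: "q \<in> J2" and c: "c \<in> A q" for q c
  proof -
    obtain x' where x': "x' \<in> latt J1 e" "\<forall>p\<in>J1. pairing (e p) x' = pairing (e p) (scaleE c (e q))"
      using proj[OF generator_in_latt[OF U _ c]] q by blast
    obtain d' where d': "x' = (\<Sum>p\<in>J1. scaleE (d' p) (e p))" using x'(1) by (rule lspanE)
    have "scaleE c (x q) - x' = 0"
    proof (rule nondeg)
      show "scaleE c (x q) - x' = (\<Sum>p\<in>J1. scaleE (c * d q p - d' p) (e p))"
        unfolding d[OF q] d' by (simp add: V.scale_sum_right V.scale_left_diff_distrib sum_subtractf)
      show "pairing (e p) (scaleE c (x q) - x') = 0" if "p \<in> J1" for p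
        using that x'(2) x(2)[OF q that] by (simp add: pairing_diff pairing_scale)
    qed
    then show ?thesis using x'(1) by simp
  qed
  define e' where "e' q = e q - x q" for q
  have expand: "(\<Sum>q\<in>J2. scaleE (c q) (e' q)) = 
      (\<Sum>q\<in>J2. scaleE (c q) (e q)) - (\<Sum>q\<in>J2. scaleE (c q) (x q))" for c
    by (simp add: e'_def V.scale_right_diff_distrib sum_subtractf)
  have orth: "pairing (e p) (e' q) = 0" if "p \<in> J1" "q \<in> J2" for p q
    using x(2)[OF that(2,1)] by (simp add: e'_def pairing_diff)
  have orth': "pairing (e p) y = 0" if p: "p \<in> J1" and "y \<in> latt J2 e'" for p y
  proof -
    from that(2) obtain c where c: "y = (\<Sum>q\<in>J2. scaleE (c q) (e' q))" by (rule lspanE)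
    show ?thesis unfolding c pairing_sum by (rule sum.neutral) (simp add: pairing_scale orth[OF p])
  qed
  have orth'': "pairing z y = 0" if z: "z \<in> latt J1 e" and y: "y \<in> latt J2 e'" for z y
  proof -
    from z obtain c where c: "z = (\<Sum>q\<in>J1. scaleE (c q) (e q))" by (rule lspanE)
    show ?thesis unfolding c pairing_sum by (rule sum.neutral) (simp add: pairing_scale orth'[OF _ y])
  qed
  have split: "latt (J1 \<union> J2) e = {x + y | x y. x \<in> latt J1 e \<and> y \<in> latt J2 e'}"
    unfolding latt_union
  proof (intro equalityI subsetI)
    fix z assume "z \<in> {x + y | x y. x \<in> latt J1 e \<and> y \<in> latt J2 e}"
    then obtain u y where z: "z = u + y" "u \<in> latt J1 e" "y \<in> latt J2 e" by blast
    obtain c where c: "\<forall>q\<in>J2. c q \<in> A q" "y = (\<Sum>q\<in>J2. scaleE (c q) (e q))" using z(3) by (rule lspanE)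
    let ?w = "\<Sum>q\<in>J2. scaleE (c q) (x q)" and ?y = "\<Sum>q\<in>J2. scaleE (c q) (e' q)"
    have "?w \<in> latt J1 e" 
    proof (rule submodule_over_sum[OF LS])
      fix q assume q: "q \<in> J2"
      then have "c q \<in> A q" using c(1) by simp
      then show "scaleE (c q) (x q) \<in> latt J1 e" by (rule cx[OF q])
    qed
    then have "u + ?w \<in> latt J1 e" by (rule submodule_overD(2)[OF LS z(2)])
    moreover have "?y \<in> latt J2 e'" by (rule lspanI[OF c(1)])
    moreover have "z = (u + ?w) + ?y" unfolding z(1) c(2) expand by simp
    ultimately show "z \<in> {x + y | x y. x \<in> latt J1 e \<and> y \<in> latt J2 e'}" by blast
  next
    fix z assume "z \<in> {x + y | x y. x \<in> latt J1 e \<and> y \<in> latt J2 e'}"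
    then obtain u y where z: "z = u + y" "u \<in> latt J1 e" "y \<in> latt J2 e'" by blast
    obtain c where c: "\<forall>q\<in>J2. c q \<in> A q" "y = (\<Sum>q\<in>J2. scaleE (c q) (e' q))" using z(3) by (rule lspanE)
    let ?w = "\<Sum>q\<in>J2. scaleE (- c q) (x q)" and ?y = "\<Sum>q\<in>J2. scaleE (c q) (e q)"
    have "?w \<in> latt J1 e"
    proof (rule submodule_over_sum[OF LS])
      fix q assume q: "q \<in> J2"
      then have "q \<in> J0" "c q \<in> A q" using J2 c(1) by auto
      then show "scaleE (- c q) (x q) \<in> latt J1 e" by (intro cx[OF q] is_subringD(6)[OF subring_A])
    qed
    then have "u + ?w \<in> latt J1 e" by (rule submodule_overD(2)[OF LS z(2)])
    moreover have "?y \<in> latt J2 e" by (rule lspanI[OF c(1)])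
    moreover have "z = (u + ?w) + ?y" unfolding z(1) c(2) expand by (simp add: sum_negf)
    ultimately show "z \<in> {x + y | x y. x \<in> latt J1 e \<and> y \<in> latt J2 e}" by blast
  qed
  have "lindep scaleE J2 e'"
    unfolding lindep_def
  proof (intro allI impI)
    fix c assume c: "(\<Sum>q\<in>J2. scaleE (c q) (e' q)) = 0"
    let ?d = "\<lambda>p. \<Sum>q\<in>J2. c q * d q p"
    have "(\<Sum>q\<in>J2. scaleE (c q) (x q)) = (\<Sum>q\<in>J2. \<Sum>p\<in>J1. scaleE (c q * d q p) (e p))"
      by (rule sum.cong[OF refl]) (simp add: d V.scale_sum_right)
    also have "\<dots> = (\<Sum>p\<in>J1. \<Sum>q\<in>J2. scaleE (c q * d q p) (e p))" by (rule sum.swap)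
    also have "\<dots> = (\<Sum>p\<in>J1. scaleE (?d p) (e p))" by (simp add: V.scale_sum_left)
    finally have eq: "(\<Sum>q\<in>J2. scaleE (c q) (e q)) - (\<Sum>p\<in>J1. scaleE (?d p) (e p)) = 0" using c expand by simp
    \<comment> \<open>The relation rewritten in the original basis: the corrections contribute
      \<open>- ?d p\<close> on the first block, and the coefficients on \<open>J2\<close> are
      unchanged.\<close>
    let ?c = "\<lambda>p. if p \<in> J1 then - ?d p else c p"
    have "(\<Sum>p\<in>J1. scaleE (?c p) (e p)) = - (\<Sum>p\<in>J1. scaleE (?d p) (e p))"
      by (simp add: sum_negf)
    moreover have "(\<Sum>p\<in>J2. scaleE (?c p) (e p)) = (\<Sum>p\<in>J2. scaleE (c p) (e p))"
      by (rule sum.cong) (use disj in auto)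
    moreover have "(\<Sum>p\<in>J1 \<union> J2. scaleE (?c p) (e p)) = 
        (\<Sum>p\<in>J1. scaleE (?c p) (e p)) + (\<Sum>p\<in>J2. scaleE (?c p) (e p))"
      by (rule sum.union_disjoint[OF finJ disj])
    ultimately have "(\<Sum>p\<in>J1 \<union> J2. scaleE (?c p) (e p)) = 0" using eq by simp
    then have "\<forall>p\<in>J1 \<union> J2. ?c p = 0" by (rule ind[unfolded lindep_def, THEN spec, THEN mp])
    then have "?c q = 0" if "q \<in> J2" for q using that by blast
    then show "\<forall>q\<in>J2. c q = 0" using disj by (metis disjoint_iff)
  qed
  moreover have "perfect_on J2 e'"
    unfolding perfect_on_def
  proof (intro allI impI)
    fix t assume t: "\<forall>q\<in>J2. t q \<in> colon R (A q)"
    \<comment> \<open>Prescribing 0 on the first block forces the component there to vanish, so the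
      solution lies in \<open>latt J2 e'\<close>. The element \<open>x q\<close> pairs to 0 with it,
      so \<open>e q\<close> and \<open>e' q\<close> have the same value.\<close>
    let ?t = "\<lambda>p. if p \<in> J1 then 0 else t p"
    have "0 \<in> colon R X" for X using is_subringD(1)[OF subring_R] by (simp add: colon_def)
    then have "\<forall>p\<in>J1 \<union> J2. ?t p \<in> colon R (A p)" using t by auto
    from perfect_onD[OF perf this]
    obtain y where y: "y \<in> latt (J1 \<union> J2) e" "\<forall>p\<in>J1 \<union> J2. pairing (e p) y = ?t p" by (rule bexE)
    from y(1) obtain u w where uw: "y = u + w" "u \<in> latt J1 e" "w \<in> latt J2 e'" unfolding split by blast
    obtain c where c: "u = (\<Sum>p\<in>J1. scaleE (c p) (e p))" using uw(2) by (rule lspanE)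
    have "u = 0"
    proof (rule nondeg[OF c])
      fix p assume p: "p \<in> J1"
      have "pairing (e p) y = pairing (e p) u + pairing (e p) w" unfolding uw(1) by (rule pairing_add)
      then show "pairing (e p) u = 0" using y(2) p orth'[OF p uw(3)] by simp
    qed
    then have yw: "y = w" using uw(1) by simp
    have "pairing (e' q) w = t q" if q: "q \<in> J2" for q
    proof -
      have "pairing (e q) w = pairing (e' q + x q) w" by (simp add: e'_def)
      also have "\<dots> = pairing (e' q) w" by (simp add: pairing_add orth''[OF x(1)[OF q] uw(3)])
      finally have "pairing (e q) w = pairing (e' q) w" .
      moreover have "q \<notin> J1" using q disj by blast
      moreover have "pairing (e q) w = ?t q" using y(2) q yw by blast
      ultimately show ?thesis by simp
    qed
    then show "\<exists>y\<in>latt J2 e'. \<forall>q\<in>J2. pairing (e' q) y = t q" using uw(3) by blast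
  qed
  ultimately show ?thesis using that[of e'] orth split by blast
qed

end

end

end

section \<open>The orthogonal decomposition\<close>

locale bass_blocks = sesquilinear_lattice v Z scaleQ scaleE \<sigma> pairing
  for v :: "'q::field \<Rightarrow> int" and Z and scaleQ :: "'q \<Rightarrow> 'e::comm_ring_1 \<Rightarrow> 'e"
    and scaleE :: "'e \<Rightarrow> 'v::ab_group_add \<Rightarrow> 'v" and \<sigma> pairing +
  fixes R :: "'e set" and m :: nat and Rs :: "nat \<Rightarrow> 'e set" and r :: "nat \<Rightarrow> nat" and \<alpha> :: "nat \<Rightarrow> 'e"
  assumes bass: "bass_order Z scaleQ R" and local: "local_subring R" and stable_R: "\<sigma> ` R \<subseteq> R"
    and overorder: "i \<in> {1..m} \<Longrightarrow> order (Rs i) \<and> R \<subseteq> Rs i"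
    and chain: "i \<in> {1..<m} \<Longrightarrow> Rs i \<subset> Rs (Suc i)"
    and colon_eq: "i \<in> {1..m} \<Longrightarrow> colon R (Rs i) = (\<lambda>x. \<alpha> i * x) ` Rs i"
begin

text \<open>The index \<open>(j, k)\<close> stands for the \<open>k\<close>-th generator of block
  \<open>j\<close>; \<open>tail (Suc m)\<close> is empty and starts the downward induction.\<close>

definition tail :: "nat \<Rightarrow> (nat \<times> nat) set" where
  "tail i = Sigma {i..m} (\<lambda>i. {..<r i})"

definition block :: "nat \<Rightarrow> (nat \<times> nat) set" where
  "block i = Pair i ` {..<r i}"

lemma Rs_order: "i \<in> {1..m} \<Longrightarrow> order (Rs i)" and Rs_superset: "i \<in> {1..m} \<Longrightarrow> R \<subseteq> Rs i"
  using overorder by auto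

lemma Rs_stable: "i \<in> {1..m} \<Longrightarrow> x \<in> Rs i \<Longrightarrow> \<sigma> x \<in> Rs i"
  and Rs_local_or_maximal: "i \<in> {1..m} \<Longrightarrow> local_subring (Rs i) \<or> maximal_order (Rs i)"
  using bass_overorder[OF bass local involution stable_R Rs_order Rs_superset] by blast+

lemma Rs_strict_mono:
  assumes "1 \<le> i" "i < j" "j \<le> m"
  shows "Rs i \<subset> Rs j"
proof -
  have "Rs i \<subset> Rs (Suc i + k)" if "Suc i + k \<le> m" for k
    using that
  proof (induction k)
    case 0
    then show ?case using chain[of i] assms(1) by simp
  next
    case (Suc k)
    then have "Rs i \<subset> Rs (Suc i + k)" "Rs (Suc i + k) \<subset> Rs (Suc (Suc i + k))"
      using chain[of "Suc i + k"] by auto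
    then show ?case by auto
  qed
  from this[of "j - Suc i"] assms show ?thesis by simp
qed

sublocale overorder_family v Z scaleQ scaleE \<sigma> pairing R "\<lambda>p. Rs (fst p)" "tail 1"
proof unfold_locales
  show "finite (tail 1)" by (simp add: tail_def)
  show "order R" using bass by (simp add: bass_order_def)
  fix p assume "p \<in> tail 1"
  then have i: "fst p \<in> {1..m}" by (auto simp: tail_def)
  show "order (Rs (fst p))" "R \<subseteq> Rs (fst p)" using i Rs_order Rs_superset by auto
  show "\<sigma> x \<in> Rs (fst p)" if "x \<in> Rs (fst p)" for x using Rs_stable[OF i that] .
qed

text \<open>A power of the uniformizer lies in the colon ideal, so the generator divides an element
  that is invertible in \<open>E\<close>.\<close>

lemma \<alpha>_unit:
  assumes "i \<in> {1..m}"
  obtains \<beta> where "\<alpha> i * \<beta> = 1"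
proof -
  obtain n where n: "\<And>x. x \<in> Rs i \<Longrightarrow> scaleQ (unif ^ n) x \<in> R"
    using fg_scale_into[OF orderD(3,2,4)[OF order_R] orderD(3)[OF Rs_order[OF assms]]] by blast
  have "scaleQ (unif ^ n) 1 \<in> colon R (Rs i)"
    by (rule colonI) (use n in \<open>simp add: scaleQ_mult[symmetric]\<close>)
  then obtain s where s: "scaleQ (unif ^ n) 1 = \<alpha> i * s" using colon_eq[OF assms] by blast
  have "\<alpha> i * scaleQ (1 / unif ^ n) s = scaleQ (1 / unif ^ n) (scaleQ (unif ^ n) 1)"
    by (simp add: s mult_scaleQ)
  also have "\<dots> = 1" using unif(1) by simp
  finally show ?thesis by (rule that)
qed

text \<open>Write \<open>x\<close> as \<open>\<alpha> i * w\<close>. If \<open>w\<close> were a unit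
  of \<open>Rs i\<close>, then \<open>\<alpha> i\<close> would lie in the colon ideal of
  \<open>Rs j\<close>, which is stable under \<open>Rs j\<close>. So \<open>\<alpha> i\<close> times
  \<open>Rs j\<close> would lie in \<open>\<alpha> i\<close> times \<open>Rs i\<close>, and
  cancelling \<open>\<alpha> i\<close> would contradict the strict inclusion.\<close>

lemma colon_small:
  assumes ij: "1 \<le> i" "i < j" "j \<le> m" and loc: "local_subring (Rs i)"
  shows "colon R (Rs j) \<subseteq> (\<lambda>x. \<alpha> i * x) ` maximal_ideal (Rs i)"
proof
  fix x assume x: "x \<in> colon R (Rs j)"
  have i: "i \<in> {1..m}" and j: "j \<in> {1..m}" using ij by auto
  note Ri = orderD(1)[OF Rs_order[OF i]] and Rj = orderD(1)[OF Rs_order[OF j]]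
  have sub: "Rs i \<subset> Rs j" by (rule Rs_strict_mono[OF ij])
  obtain \<beta> where \<beta>: "\<alpha> i * \<beta> = 1" by (rule \<alpha>_unit[OF i])
  have "x \<in> colon R (Rs i)" by (rule colonI) (use colonD[OF x] sub in blast)
  then obtain w where w: "w \<in> Rs i" "x = \<alpha> i * w" unfolding colon_eq[OF i] by blast
  have "w \<in> maximal_ideal (Rs i)"
  proof (rule ccontr)
    assume "w \<notin> maximal_ideal (Rs i)"
    then obtain u where u: "u \<in> Rs i" "w * u = 1" using local_unit[OF Ri loc w(1)] by blast
    have "\<alpha> i = \<alpha> i * (w * u)" using u(2) by simp
    then have \<alpha>x: "\<alpha> i = x * u" unfolding w(2) by (simp only: mult.assoc)
    have "c \<in> Rs i" if c: "c \<in> Rs j" for c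
    proof -
      have "\<alpha> i * c \<in> colon R (Rs i)"
      proof (rule colonI)
        fix y assume "y \<in> Rs i"
        then have "u * (c * y) \<in> Rs j" using u(1) sub c is_subringD(4)[OF Rj] by blast
        then have "x * (u * (c * y)) \<in> R" by (rule colonD[OF x])
        then show "\<alpha> i * c * y \<in> R" by (simp add: \<alpha>x mult.assoc)
      qed
      then obtain s where s: "s \<in> Rs i" "\<alpha> i * c = \<alpha> i * s" unfolding colon_eq[OF i] by blast
      have "c = (\<alpha> i * \<beta>) * c" using \<beta> by simp
      also have "\<dots> = \<beta> * (\<alpha> i * c)" by (simp add: mult_ac)
      also have "\<dots> = (\<alpha> i * \<beta>) * s" unfolding s(2) by (simp add: mult_ac)
      also have "\<dots> = s" using \<beta> by simp
      finally show ?thesis using s(1) by simp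
    qed
    then show False using sub by blast
  qed
  then show "x \<in> (\<lambda>x. \<alpha> i * x) ` maximal_ideal (Rs i)" using w(2) by blast
qed

lemma block_subset: "i \<in> {1..m} \<Longrightarrow> block i \<subseteq> tail 1"
  by (auto simp: block_def tail_def)

lemma tail_subset: "1 \<le> i \<Longrightarrow> tail i \<subseteq> tail 1"
  by (auto simp: tail_def)

lemma tail_Suc: "i \<le> m \<Longrightarrow> tail i = block i \<union> tail (Suc i)"
  by (auto simp: tail_def block_def le_less)

lemma block_tail_disjoint: "block i \<inter> tail (Suc i) = {}"
  by (auto simp: tail_def block_def)

lemma fst_block: "p \<in> block i \<Longrightarrow> fst p = i"
  by (auto simp: block_def)

text \<open>For \<open>i < m\<close> the order \<open>Rs i\<close> has a proper overorder in the
  chain, so it is not maximal, hence local, and Nakayama's lemma applies. \<open>Rs m\<close> may be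
  maximal without being local, but then the tail is the block itself.\<close>

lemma tail_perfect_block:
  assumes i: "1 \<le> i" "i \<le> m" and e: "integral_on (tail i) e" "perfect_on (tail i) e"
  shows "perfect_on (block i) e"
proof (cases "i = m")
  case True
  then have "tail i = block i" by (auto simp: tail_def block_def)
  then show ?thesis using e(2) by simp
next
  case False
  with i have im: "i \<in> {1..m}" and lt: "i < m" by auto
  have "Suc i \<in> {1..m}" using lt by auto
  moreover have "Rs i \<subset> Rs (Suc i)" using Rs_strict_mono[OF i(1), of "Suc i"] lt by simp
  ultimately have "\<not> maximal_order (Rs i)"
    using Rs_order[of "Suc i"] unfolding maximal_order_def by blast
  then have loc: "local_subring (Rs i)" using Rs_local_or_maximal[OF im] by blast
  obtain \<beta> where \<beta>: "\<alpha> i * \<beta> = 1" by (rule \<alpha>_unit[OF im])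
  show ?thesis
  proof (rule block_perfect[OF block_subset[OF im] Rs_order[OF im] Rs_stable[OF im] _ colon_eq[OF im] \<beta> 
        tail_subset[of "Suc i"] block_tail_disjoint _ _ loc])
    show "integral_on (block i \<union> tail (Suc i)) e" "perfect_on (block i \<union> tail (Suc i)) e"
      using e tail_Suc[OF i(2)] by auto
    show "Rs (fst p) = Rs i" if "p \<in> block i" for p using fst_block[OF that] by simp
    fix q assume "q \<in> tail (Suc i)"
    then have q: "i < fst q" "fst q \<le> m" by (auto simp: tail_def)
    show "colon R (Rs (fst q)) \<subseteq> (\<lambda>x. \<alpha> i * x) ` maximal_ideal (Rs i)"
      by (rule colon_small[OF i(1) q loc])
  qed auto
qed

lemma pairing_latt_zero:
  assumes "\<And>p q. p \<in> I \<Longrightarrow> q \<in> J \<Longrightarrow> pairing (e p) (f q) = 0" "x \<in> latt I e" "y \<in> latt J f"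
  shows "pairing x y = 0"
proof -
  obtain c where c: "x = (\<Sum>p\<in>I. scaleE (c p) (e p))" using assms(2) by (rule lspanE)
  obtain d where d: "y = (\<Sum>q\<in>J. scaleE (d q) (f q))" using assms(3) by (rule lspanE)
  show ?thesis unfolding c d by (simp add: pairing_sum pairing_scale assms(1))
qed

text \<open>Downward induction over the tails. Orthogonality to block \<open>i\<close> survives the
  later changes of basis because it concerns the whole lattice spanned by the remaining tail, not
  its generators.\<close>

lemma orthogonal_basis:
  assumes "1 \<le> i" "i \<le> Suc m" "lindep scaleE (tail i) e" "integral_on (tail i) e" "perfect_on (tail i) e"
  shows "\<exists>e'. lindep scaleE (tail i) e' \<and> latt (tail i) e' = latt (tail i) e \<and>
    (\<forall>p\<in>tail i. \<forall>q\<in>tail i. fst p < fst q \<longrightarrow> pairing (e' p) (e' q) = 0) \<and>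
    (\<forall>j\<in>{i..m}. perfect_on (block j) e')"
  using assms(2,1,3-)
proof (induction arbitrary: e rule: inc_induct)
  case base
  have "tail (Suc m) = {}" by (simp add: tail_def)
  then show ?case by (intro exI[of _ e]) (simp add: lindep_def)
next
  case (step i)
  have i: "1 \<le> i" "i \<le> m" "i \<in> {1..m}" using step.hyps step.prems(1) by auto
  note tl = tail_Suc[OF i(2)]
  note bs = block_subset[OF i(3)]
  have ts: "tail (Suc i) \<subseteq> tail 1" by (rule tail_subset) simp
  have perf1: "perfect_on (block i) e" by (rule tail_perfect_block[OF i(1,2) step.prems(3,4)])
  obtain \<beta> where \<beta>: "\<alpha> i * \<beta> = 1" by (rule \<alpha>_unit[OF i(3)])
  have Rsb: "Rs (fst p) = Rs i" if "p \<in> block i" for p using fst_block[OF that] by simp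
  have fin: "finite (block i)" "finite (tail (Suc i))" using finite_subset_index bs ts by auto
  obtain e1 where e1: "lindep scaleE (tail (Suc i)) e1" 
    "\<And>p q. p \<in> block i \<Longrightarrow> q \<in> tail (Suc i) \<Longrightarrow> pairing (e p) (e1 q) = 0"
    "latt (block i \<union> tail (Suc i)) e = {x + y | x y. x \<in> latt (block i) e \<and> y \<in> latt (tail (Suc i)) e1}" 
    "perfect_on (tail (Suc i)) e1"
  proof (rule block_split[OF bs Rs_order[OF i(3)] Rs_stable[OF i(3)] Rsb colon_eq[OF i(3)] \<beta> 
        ts block_tail_disjoint _ _ _ perf1])
    show "lindep scaleE (block i \<union> tail (Suc i)) e" "integral_on (block i \<union> tail (Suc i)) e" 
      "perfect_on (block i \<union> tail (Suc i)) e" using step.prems tl by auto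
  qed auto
  have zero1: "0 \<in> latt (block i) e" using submodule_overD(1)[OF submodule_latt_R[OF bs]] .
  have sub1: "latt (tail (Suc i)) e1 \<subseteq> latt (tail i) e"
  proof
    fix y assume "y \<in> latt (tail (Suc i)) e1"
    moreover have "y = 0 + y" by simp
    ultimately show "y \<in> latt (tail i) e" unfolding tl e1(3) using zero1 by blast
  qed
  have int1: "integral_on (tail (Suc i)) e1" by (rule integral_on_subset[OF step.prems(3) sub1])
  obtain e2 where e2: "lindep scaleE (tail (Suc i)) e2" "latt (tail (Suc i)) e2 = latt (tail (Suc i)) e1"
    "\<forall>p\<in>tail (Suc i). \<forall>q\<in>tail (Suc i). fst p < fst q \<longrightarrow> pairing (e2 p) (e2 q) = 0"
    "\<forall>j\<in>{Suc i..m}. perfect_on (block j) e2"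
    using step.IH[OF _ e1(1) int1 e1(4)] by auto
  define e' where "e' p = (if p \<in> block i then e p else e2 p)" for p
  have eb: "e' p = e p" if "p \<in> block i" for p using that by (simp add: e'_def)
  have et: "e' p = e2 p" if "p \<in> tail (Suc i)" for p using that block_tail_disjoint by (auto simp: e'_def)
  have lb: "latt (block i) e' = latt (block i) e" by (rule lspan_cong) (rule eb)
  have lt: "latt (tail (Suc i)) e' = latt (tail (Suc i)) e2" by (rule lspan_cong) (rule et)
  have orth: "pairing (e p) y = 0" if "p \<in> block i" "y \<in> latt (tail (Suc i)) e2" for p y
    by (rule pairing_latt_zero[OF e1(2) basis_in_latt[OF bs that(1)]]) (use that e2(2) in auto)
  have L: "latt (tail i) e' = latt (tail i) e"
    by (simp only: tl e1(3)) (simp only: lspan_Un[OF fin block_tail_disjoint] lb lt e2(2))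
  have int_block: "integral_on (block i) e"
    by (rule integral_on_subset[OF step.prems(3) latt_mono]) (use tl tail_subset[OF i(1)] in auto)
  have nondeg: "y = 0" if "y = (\<Sum>p\<in>block i. scaleE (c p) (e p))" "\<And>p. p \<in> block i \<Longrightarrow> pairing (e p) y = 0" for y c
    by (rule block_nondegenerate[OF bs Rs_order[OF i(3)] Rs_stable[OF i(3)] Rsb colon_eq[OF i(3)] \<beta> 
      int_block perf1 that])
  have ind_block: "lindep scaleE (block i) e"
    by (rule lindep_subset[OF _ _ step.prems(2)]) (use finite_subset_index[OF tail_subset[OF i(1)]] tl in auto)
  have "lindep scaleE (tail i) e'"
    unfolding lindep_def
  proof (intro allI impI)
    fix c assume "(\<Sum>p\<in>tail i. scaleE (c p) (e' p)) = 0"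
    then have "(\<Sum>p\<in>block i. scaleE (c p) (e' p)) + (\<Sum>p\<in>tail (Suc i). scaleE (c p) (e' p)) = 0"
      unfolding tl by (simp only: sum.union_disjoint[OF fin block_tail_disjoint])
    moreover have "(\<Sum>p\<in>block i. scaleE (c p) (e' p)) = (\<Sum>p\<in>block i. scaleE (c p) (e p))" 
      by (rule sum.cong) (auto simp: eb)
    moreover have "(\<Sum>p\<in>tail (Suc i). scaleE (c p) (e' p)) = (\<Sum>p\<in>tail (Suc i). scaleE (c p) (e2 p))"
      by (rule sum.cong) (auto simp: et)
    ultimately have s: "(\<Sum>p\<in>block i. scaleE (c p) (e p)) + (\<Sum>p\<in>tail (Suc i). scaleE (c p) (e2 p)) = 0" by simp
    \<comment> \<open>Pairing the relation with \<open>e p\<close> kills the tail part by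
      orthogonality, so the block part pairs to 0 with the generators of its block and vanishes by
      nondegeneracy.\<close>
    have b0: "(\<Sum>p\<in>block i. scaleE (c p) (e p)) = 0"
    proof (rule nondeg[OF refl])
      fix p assume p: "p \<in> block i"
      have "pairing (e p) (e2 q) = 0" if "q \<in> tail (Suc i)" for q
        by (rule orth[OF p basis_in_latt[OF ts that]])
      then have "pairing (e p) (\<Sum>q\<in>tail (Suc i). scaleE (c q) (e2 q)) = 0"
        by (simp add: pairing_sum pairing_scale)
      moreover have "pairing (e p) ((\<Sum>p\<in>block i. scaleE (c p) (e p)) + 
          (\<Sum>p\<in>tail (Suc i). scaleE (c p) (e2 p))) = 0" unfolding s by (rule pairing_zero)
      ultimately show "pairing (e p) (\<Sum>p\<in>block i. scaleE (c p) (e p)) = 0" by (simp add: pairing_add)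
    qed
    then have "\<forall>p\<in>block i. c p = 0" by (rule ind_block[unfolded lindep_def, THEN spec, THEN mp])
    moreover have "(\<Sum>p\<in>tail (Suc i). scaleE (c p) (e2 p)) = 0" using s b0 by simp
    then have "\<forall>p\<in>tail (Suc i). c p = 0" by (rule e2(1)[unfolded lindep_def, THEN spec, THEN mp])
    ultimately show "\<forall>p\<in>tail i. c p = 0" unfolding tl by blast
  qed
  moreover have "pairing (e' p) (e' q) = 0" if pq: "p \<in> tail i" "q \<in> tail i" "fst p < fst q" for p q
  proof -
    have q: "q \<in> tail (Suc i)" using pq by (auto simp: tail_def)
    show ?thesis
    proof (cases "p \<in> block i")
      case True
      have "pairing (e p) (e2 q) = 0" by (rule orth[OF True basis_in_latt[OF ts q]])
      then show ?thesis by (simp add: eb[OF True] et[OF q])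
    next
      case False
      then have "p \<in> tail (Suc i)" using pq(1) tl by blast
      then show ?thesis using e2(3) q pq(3) by (simp add: et)
    qed
  qed
  moreover have "perfect_on (block j) e'" if "j \<in> {i..m}" for j
  proof (cases "j = i")
    case True
    then show ?thesis using perf1 lb eb unfolding perfect_on_def by simp
  next
    case False
    then have j: "j \<in> {Suc i..m}" using that by auto
    then have "block j \<subseteq> tail (Suc i)" by (auto simp: block_def tail_def)
    then have "e' p = e2 p" if "p \<in> block j" for p using that et by blast
    moreover from this have "latt (block j) e' = latt (block j) e2" by (rule lspan_cong)
    moreover have "perfect_on (block j) e2" using e2(4) j by blast
    ultimately show ?thesis unfolding perfect_on_def by simp
  qed
  ultimately show ?case using L by blast
qed

end

section \<open>Modules, ranks and pairings read off from an orthogonal basis\<close>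

context bass_blocks
begin

lemma block_disjoint: "i \<noteq> j \<Longrightarrow> block i \<inter> block j = {}"
  by (auto simp: block_def)

lemma finite_block: "finite (block i)"
  by (simp add: block_def)

lemma tail_eq_Union: "tail 1 = (\<Union>i\<in>{1..m}. block i)"
  by (auto simp: tail_def block_def)

lemma sum_block: "(\<Sum>p\<in>block i. f p) = (\<Sum>k<r i. f (i, k))"
  unfolding block_def by (subst sum.reindex) (auto simp: inj_on_def)

lemma sum_tail: "(\<Sum>p\<in>tail 1. f p) = (\<Sum>i\<in>{1..m}. \<Sum>p\<in>block i. f p)"
  unfolding tail_eq_Union by (rule sum.UNION_disjoint) (auto simp: finite_block block_disjoint)

lemma fg_latt:
  assumes "i \<in> {1..m}"
  shows "fg_over R scaleE (latt (block i) e)"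
proof -
  have "fg_over Z scaleV (latt (block i) e)"
    by (rule fg_lspan[OF finite_block]) (use assms Rs_order fst_block in auto)
  then obtain B where B: "finite B" "B \<subseteq> latt (block i) e" 
    "\<And>x. x \<in> latt (block i) e \<Longrightarrow> x \<in> span_over Z scaleV B" by (auto simp: fg_over_iff)
  have "\<exists>c. (\<forall>b\<in>B. c b \<in> R) \<and> x = (\<Sum>b\<in>B. scaleE (c b) b)" if x: "x \<in> latt (block i) e" for x
  proof -
    obtain c where "\<forall>b\<in>B. c b \<in> Z" "x = (\<Sum>b\<in>B. scaleV (c b) b)" using B(3)[OF x] by (rule span_overE)
    then show ?thesis using scale_one_in_order[OF order_R] by (intro exI[of _ "\<lambda>b. scaleQ (c b) 1"]) simp
  qed
  then show ?thesis unfolding fg_over_def using B(1,2) by blast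
qed

lemma direct_sum_blocks:
  assumes ind: "lindep scaleE (tail 1) e"
  shows "internal_direct_sum m (\<lambda>i. latt (block i) e) (latt (tail 1) e)"
  unfolding internal_direct_sum_def
proof (rule bij_betw_imageI)
  let ?P = "\<Pi>\<^sub>E i\<in>{1..m}. latt (block i) e"
  have coeffs: "\<exists>c. (\<forall>p\<in>tail 1. c p \<in> Rs (fst p)) \<and> (\<forall>i\<in>{1..m}. x i = (\<Sum>p\<in>block i. scaleE (c p) (e p)))"
    if x: "x \<in> ?P" for x
  proof -
    have "\<forall>i\<in>{1..m}. \<exists>c. (\<forall>p\<in>block i. c p \<in> Rs (fst p)) \<and> x i = (\<Sum>p\<in>block i. scaleE (c p) (e p))"
    proof
      fix i assume "i \<in> {1..m}"
      with x have "x i \<in> latt (block i) e" by (rule PiE_mem)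
      then show "\<exists>c. (\<forall>p\<in>block i. c p \<in> Rs (fst p)) \<and> x i = (\<Sum>p\<in>block i. scaleE (c p) (e p))"
        by (rule lspanE) blast
    qed
    then obtain c where c: "\<forall>i\<in>{1..m}. (\<forall>p\<in>block i. c i p \<in> Rs (fst p)) \<and> 
      x i = (\<Sum>p\<in>block i. scaleE (c i p) (e p))" by metis
    \<comment> \<open>The index of a generator records its block, so the coefficient functions of
      all blocks glue to a single one.\<close>
    have "(\<Sum>p\<in>block i. scaleE (c i p) (e p)) = (\<Sum>p\<in>block i. scaleE (c (fst p) p) (e p))" for i
      by (rule sum.cong) (auto dest: fst_block)
    moreover have "\<forall>p\<in>tail 1. c (fst p) p \<in> Rs (fst p)"
      using c fst_block unfolding tail_eq_Union by auto
    ultimately show ?thesis using c by (intro exI[of _ "\<lambda>p. c (fst p) p"]) simp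
  qed
  have total: "(\<Sum>i\<in>{1..m}. x i) = (\<Sum>p\<in>tail 1. scaleE (c p) (e p))"
    if "\<forall>i\<in>{1..m}. x i = (\<Sum>p\<in>block i. scaleE (c p) (e p))" for x c
    unfolding sum_tail by (rule sum.cong) (use that in auto)
  show "inj_on (\<lambda>x. \<Sum>i\<in>{1..m}. x i) ?P"
  proof (rule inj_onI)
    fix x y assume xy: "x \<in> ?P" "y \<in> ?P" "(\<Sum>i\<in>{1..m}. x i) = (\<Sum>i\<in>{1..m}. y i)"
    obtain c where c: "\<forall>i\<in>{1..m}. x i = (\<Sum>p\<in>block i. scaleE (c p) (e p))" using coeffs[OF xy(1)] by blast
    obtain d where d: "\<forall>i\<in>{1..m}. y i = (\<Sum>p\<in>block i. scaleE (d p) (e p))" using coeffs[OF xy(2)] by blast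
    have eq: "(\<Sum>p\<in>tail 1. scaleE (c p) (e p)) = (\<Sum>p\<in>tail 1. scaleE (d p) (e p))"
      using xy(3) total[OF c] total[OF d] by simp
    show "x = y"
    proof (rule PiE_ext[OF xy(1,2)])
      fix i assume i: "i \<in> {1..m}"
      have "(\<Sum>p\<in>block i. scaleE (c p) (e p)) = (\<Sum>p\<in>block i. scaleE (d p) (e p))"
      proof (rule sum.cong[OF refl])
        fix p assume "p \<in> block i"
        then have "p \<in> tail 1" using block_subset[OF i] by blast
        then show "scaleE (c p) (e p) = scaleE (d p) (e p)" using lindep_eqD[OF ind eq] by simp
      qed
      then show "x i = y i" using c d i by simp
    qed
  qed
  show "(\<lambda>x. \<Sum>i\<in>{1..m}. x i) ` ?P = latt (tail 1) e"
  proof (intro equalityI subsetI)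
    fix z assume "z \<in> (\<lambda>x. \<Sum>i\<in>{1..m}. x i) ` ?P"
    then obtain x where x: "x \<in> ?P" "z = (\<Sum>i\<in>{1..m}. x i)" by blast
    obtain c where c: "\<forall>p\<in>tail 1. c p \<in> Rs (fst p)" "\<forall>i\<in>{1..m}. x i = (\<Sum>p\<in>block i. scaleE (c p) (e p))" 
      using coeffs[OF x(1)] by blast
    show "z \<in> latt (tail 1) e" unfolding x(2) total[OF c(2)] by (rule lspanI[OF c(1)])
  next
    fix z assume "z \<in> latt (tail 1) e"
    then obtain c where c: "\<forall>p\<in>tail 1. c p \<in> Rs (fst p)" "z = (\<Sum>p\<in>tail 1. scaleE (c p) (e p))" by (rule lspanE)
    let ?x = "\<lambda>i\<in>{1..m}. \<Sum>p\<in>block i. scaleE (c p) (e p)"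
    have "?x \<in> ?P"
    proof (rule restrict_PiE_iff[THEN iffD2], rule ballI)
      fix i assume "i \<in> {1..m}"
      then have "\<forall>p\<in>block i. c p \<in> Rs (fst p)" using c(1) block_subset by blast
      then show "(\<Sum>p\<in>block i. scaleE (c p) (e p)) \<in> latt (block i) e" by (rule lspanI)
    qed
    moreover have "z = (\<Sum>i\<in>{1..m}. ?x i)" unfolding c(2) by (rule total[symmetric]) simp
    ultimately show "z \<in> (\<lambda>x. \<Sum>i\<in>{1..m}. x i) ` ?P" by blast
  qed
qed

lemma free_block:
  assumes i: "i \<in> {1..m}" and ind: "lindep scaleE (tail 1) e"
  shows "free_over_of_rank (Rs i) scaleE (latt (block i) e) (r i)"
  unfolding free_over_of_rank_def
proof (intro conjI exI[of _ "\<lambda>k. e (i, k)"] allI impI)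
  note bs = block_subset[OF i]
  have Rsb: "Rs (fst p) = Rs i" if "p \<in> block i" for p using fst_block[OF that] by simp
  show "submodule_over (Rs i) scaleE (latt (block i) e)"
    by (rule submodule_latt_block[OF bs Rsb orderD(1)[OF Rs_order[OF i]]])
  show "e (i, k) \<in> latt (block i) e" if "k < r i" for k
    by (rule basis_in_latt[OF bs]) (use that in \<open>auto simp: block_def\<close>)
  have indb: "lindep scaleE (block i) e"
    by (rule lindep_subset[OF finite_subset_index[OF subset_refl] bs ind])
  show "bij_betw (\<lambda>c. \<Sum>k<r i. scaleE (c k) (e (i, k))) ({..<r i} \<rightarrow>\<^sub>E Rs i) (latt (block i) e)"
  proof (rule bij_betw_imageI)
    show "inj_on (\<lambda>c. \<Sum>k<r i. scaleE (c k) (e (i, k))) ({..<r i} \<rightarrow>\<^sub>E Rs i)"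
    proof (rule inj_onI)
      fix c d assume cd: "c \<in> {..<r i} \<rightarrow>\<^sub>E Rs i" "d \<in> {..<r i} \<rightarrow>\<^sub>E Rs i"
        "(\<Sum>k<r i. scaleE (c k) (e (i, k))) = (\<Sum>k<r i. scaleE (d k) (e (i, k)))"
      have "(\<Sum>p\<in>block i. scaleE (c (snd p)) (e p)) = (\<Sum>p\<in>block i. scaleE (d (snd p)) (e p))"
        using cd(3) by (simp add: sum_block)
      note eq = lindep_eqD[OF indb this]
      show "c = d"
      proof (rule PiE_ext[OF cd(1,2)])
        fix k assume "k \<in> {..<r i}"
        then have "(i, k) \<in> block i" by (auto simp: block_def)
        from eq[OF this] show "c k = d k" by simp
      qed
    qed
    show "(\<lambda>c. \<Sum>k<r i. scaleE (c k) (e (i, k))) ` ({..<r i} \<rightarrow>\<^sub>E Rs i) = latt (block i) e"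
    proof (intro equalityI subsetI)
      fix x assume "x \<in> (\<lambda>c. \<Sum>k<r i. scaleE (c k) (e (i, k))) ` ({..<r i} \<rightarrow>\<^sub>E Rs i)"
      then obtain c where c: "c \<in> {..<r i} \<rightarrow>\<^sub>E Rs i" "x = (\<Sum>k<r i. scaleE (c k) (e (i, k)))" by blast
      have "x = (\<Sum>p\<in>block i. scaleE (c (snd p)) (e p))" unfolding c(2) by (simp add: sum_block)
      also have "\<dots> \<in> latt (block i) e" 
        by (rule lspanI) (use c(1) in \<open>auto simp: block_def\<close>)
      finally show "x \<in> latt (block i) e" .
    next
      fix x assume "x \<in> latt (block i) e"
      then obtain c where c: "\<forall>p\<in>block i. c p \<in> Rs (fst p)" "x = (\<Sum>p\<in>block i. scaleE (c p) (e p))"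
        by (rule lspanE)
      have "x = (\<Sum>k<r i. scaleE (restrict (\<lambda>k. c (i, k)) {..<r i} k) (e (i, k)))"
        unfolding c(2) sum_block by (rule sum.cong) auto
      moreover have "restrict (\<lambda>k. c (i, k)) {..<r i} \<in> {..<r i} \<rightarrow>\<^sub>E Rs i"
        using c(1) by (auto simp: block_def)
      ultimately show "x \<in> (\<lambda>c. \<Sum>k<r i. scaleE (c k) (e (i, k))) ` ({..<r i} \<rightarrow>\<^sub>E Rs i)" by blast
    qed
  qed
qed

text \<open>Values on the block lie in the colon ideal, so they can be divided by
  \<open>\<alpha> i\<close>. Injectivity of the duality map is nondegeneracy of the block;
  surjectivity is \<open>perfect_on\<close> for the values
  \<open>\<alpha> i * f (e q)\<close>.\<close>

lemma perfect_block:
  assumes i: "i \<in> {1..m}" and int: "integral_on (tail 1) e" and perf: "perfect_on (block i) e"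
  obtains p where "sesquilinear_over (Rs i) \<sigma> scaleE (latt (block i) e) p"
    "perfect_over (Rs i) scaleE (latt (block i) e) p"
    "\<forall>x\<in>latt (block i) e. \<forall>y\<in>latt (block i) e. pairing x y = \<alpha> i * p x y"
proof -
  note bs = block_subset[OF i]
  let ?N = "latt (block i) e" and ?S = "Rs i"
  note Sr = orderD(1)[OF Rs_order[OF i]]
  have Rsb: "Rs (fst p) = ?S" if "p \<in> block i" for p using fst_block[OF that] by simp
  obtain \<beta> where \<beta>: "\<alpha> i * \<beta> = 1" by (rule \<alpha>_unit[OF i])
  have intb: "integral_on (block i) e"
    by (rule integral_on_subset[OF int latt_mono[OF bs subset_refl]])
  have NS: "submodule_over ?S scaleE ?N" by (rule submodule_latt_block[OF bs Rsb Sr])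
  let ?p = "\<lambda>x y. \<beta> * pairing x y"
  have colon: "pairing x y \<in> colon R ?S" if "x \<in> ?N" "y \<in> ?N" for x y
  proof (rule colonI)
    fix b assume "b \<in> ?S"
    then have "scaleE b x \<in> ?N" using submodule_overD(3)[OF NS] that(1) by blast
    then have "pairing (scaleE b x) y \<in> R" using intb that(2) unfolding integral_on_def by blast
    then show "pairing x y * b \<in> R" by (simp add: pairing_scale mult.commute)
  qed
  note div = block_divide[OF bs Rs_order[OF i] Rs_stable[OF i] Rsb colon_eq[OF i] \<beta>]
  have pS: "?p x y \<in> ?S" and \<alpha>p: "\<alpha> i * ?p x y = pairing x y" if "x \<in> ?N" "y \<in> ?N" for x y
    using div[OF _ _ colon[OF that]] by auto
  have expand: "f (\<Sum>q\<in>block i. scaleE (c q) (e q)) = (\<Sum>q\<in>block i. c q * f (e q))"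
    if f: "f \<in> hom_over ?S scaleE ?N (*) ?S" and c: "\<forall>q\<in>block i. c q \<in> ?S" for f c
  proof -
    have f': "f (x + y) = f x + f y" "a \<in> ?S \<Longrightarrow> f (scaleE a x) = a * f x" if "x \<in> ?N" "y \<in> ?N" for x y a
      using f that by (auto simp: hom_over_def)
    have N0: "0 \<in> ?N" by (rule submodule_overD(1)[OF NS])
    have "f (scaleE 0 0) = 0 * f 0" by (rule f'(2)[OF N0 N0 is_subringD(1)[OF Sr]])
    then have f0: "f 0 = 0" by simp
    have "f (\<Sum>q\<in>J. scaleE (c q) (e q)) = (\<Sum>q\<in>J. c q * f (e q)) \<and> (\<Sum>q\<in>J. scaleE (c q) (e q)) \<in> ?N"
      if "finite J" "J \<subseteq> block i" for J
      using that
    proof induction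
      case empty
      then show ?case using f0 N0 by simp
    next
      case (insert q J)
      then have q: "e q \<in> ?N" "c q \<in> ?S" using basis_in_latt[OF bs] c by auto
      then have "scaleE (c q) (e q) \<in> ?N" using submodule_overD(3)[OF NS] by blast
      then show ?case using insert f' q submodule_overD(2)[OF NS] by simp
    qed
    then show ?thesis using finite_block by blast
  qed
  have hom: "(\<lambda>x. if x \<in> ?N then ?p x y else 0) \<in> hom_over ?S scaleE ?N (*) ?S" if "y \<in> ?N" for y
    unfolding hom_over_def
    using pS that submodule_overD(2,3)[OF NS] by (simp add: pairing_add pairing_scale algebra_simps)
  have "perfect_over ?S scaleE ?N ?p"
    unfolding perfect_over_def
  proof (rule bij_betw_imageI)
    let ?F = "\<lambda>x y. if y \<in> ?N then ?p y x else 0"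
    show "inj_on ?F ?N"
    proof (rule inj_onI)
      fix x y assume xy: "x \<in> ?N" "y \<in> ?N" "?F x = ?F y"
      obtain c where c: "x = (\<Sum>q\<in>block i. scaleE (c q) (e q))" using xy(1) by (rule lspanE)
      obtain d where d: "y = (\<Sum>q\<in>block i. scaleE (d q) (e q))" using xy(2) by (rule lspanE)
      have "x - y = 0"
      proof (rule block_nondegenerate[OF bs Rs_order[OF i] Rs_stable[OF i] Rsb colon_eq[OF i] \<beta> intb perf])
        show "x - y = (\<Sum>q\<in>block i. scaleE (c q - d q) (e q))"
          unfolding c d by (simp add: V.scale_left_diff_distrib sum_subtractf)
        fix q assume "q \<in> block i"
        then have q: "e q \<in> ?N" by (rule basis_in_latt[OF bs])
        have "?p (e q) x = ?p (e q) y" using fun_cong[OF xy(3), of "e q"] q by simp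
        then have "pairing (e q) x = pairing (e q) y" using \<alpha>p[OF q xy(1)] \<alpha>p[OF q xy(2)] by metis
        then show "pairing (e q) (x - y) = 0" by (simp add: pairing_diff)
      qed auto
      then show "x = y" by simp
    qed
    show "?F ` ?N = hom_over ?S scaleE ?N (*) ?S"
    proof (intro equalityI subsetI)
      fix f assume "f \<in> ?F ` ?N"
      then show "f \<in> hom_over ?S scaleE ?N (*) ?S" using hom by blast
    next
      fix f assume f: "f \<in> hom_over ?S scaleE ?N (*) ?S"
      have "f (e q) \<in> ?S" if "q \<in> block i" for q
        using f basis_in_latt[OF bs that, of e] by (simp add: hom_over_def)
      then have "\<forall>q\<in>block i. \<alpha> i * f (e q) \<in> colon R (Rs (fst q))"
        using Rsb colon_eq[OF i] by auto
      from perfect_onD[OF perf this]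
      obtain y where y: "y \<in> ?N" "\<forall>q\<in>block i. pairing (e q) y = \<alpha> i * f (e q)" by blast
      have pf: "?p (e q) y = f (e q)" if "q \<in> block i" for q
      proof -
        have "?p (e q) y = (\<alpha> i * \<beta>) * f (e q)" using y(2) that by (simp add: mult_ac)
        then show ?thesis using \<beta> by simp
      qed
      have "f x = ?F y x" for x
      proof (cases "x \<in> ?N")
        case True
        then obtain c where c: "\<forall>q\<in>block i. c q \<in> Rs (fst q)" "x = (\<Sum>q\<in>block i. scaleE (c q) (e q))"
          by (rule lspanE)
        have "f x = (\<Sum>q\<in>block i. c q * f (e q))" unfolding c(2) by (rule expand[OF f]) (use c(1) Rsb in auto)
        also have "\<dots> = (\<Sum>q\<in>block i. c q * ?p (e q) y)" by (rule sum.cong) (auto simp: pf)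
        also have "\<dots> = ?p x y" unfolding c(2) by (simp add: pairing_sum pairing_scale sum_distrib_left mult_ac)
        finally show ?thesis using True by simp
      next
        case False
        then show ?thesis using f by (simp add: hom_over_def)
      qed
      then have "f = ?F y" by (rule ext)
      then show "f \<in> ?F ` ?N" using y(1) by blast
    qed
  qed
  moreover have "sesquilinear_over ?S \<sigma> scaleE ?N ?p"
    unfolding sesquilinear_over_def using pS by (simp add: pairing_add pairing_scale distrib_left mult_ac)
  ultimately show ?thesis using that[of ?p] \<alpha>p by auto
qed

text \<open>The isomorphism is only \<open>R\<close>-linear, while the blocks carry coefficients
  from the larger orders \<open>Rs i\<close>. A power of the uniformizer moves any finite set of
  coefficients into \<open>R\<close> and can be cancelled in \<open>V\<close>, so the preimages of
  the unit vectors form a basis with the right coefficient orders. Independence over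
  \<open>E\<close> follows in the same way.\<close>

lemma structural_basis:
  assumes M: "submodule_over R scaleE M" and sd: "self_dual R scaleE pairing M"
    and \<phi>: "\<phi> \<in> hom_over R scaleE M (\<lambda>a f j. a * f j) (block_sum m Rs r)"
    and bij: "bij_betw \<phi> M (block_sum m Rs r)"
  obtains e where "lindep scaleE (tail 1) e" "latt (tail 1) e = M" "perfect_on (tail 1) e"
proof -
  let ?B = "block_sum m Rs r" and ?J = "tail 1"
  have J: "p \<in> ?J \<longleftrightarrow> fst p \<in> {1..m} \<and> snd p < r (fst p)" for p by (cases p) (auto simp: tail_def)
  have B: "f \<in> ?B \<longleftrightarrow> (\<forall>p. (p \<in> ?J \<longrightarrow> f p \<in> Rs (fst p)) \<and> (p \<notin> ?J \<longrightarrow> f p = 0))" for f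
    unfolding block_sum_def J by (simp add: split_paired_all)
  have finJ: "finite ?J" by (rule finite_subset_index) simp
  have \<phi>B: "\<phi> x \<in> ?B" and \<phi>_add: "y \<in> M \<Longrightarrow> \<phi> (x + y) = \<phi> x + \<phi> y" 
    and \<phi>_scale: "a \<in> R \<Longrightarrow> \<phi> (scaleE a x) = (\<lambda>j. a * \<phi> x j)" if "x \<in> M" for x y a
    using \<phi> that by (auto simp: hom_over_def)
  have \<phi>_inj: "x = y" if "x \<in> M" "y \<in> M" "\<phi> x = \<phi> y" for x y
    using bij that unfolding bij_betw_def inj_on_def by blast
  have \<phi>_surj: "\<exists>x. x \<in> M \<and> \<phi> x = f" if "f \<in> ?B" for f
    using bij_betw_imp_surj_on[OF bij] that by (metis imageE)
  let ?\<delta> = "\<lambda>p q. if q = p then 1 else (0::'e)"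
  have "?\<delta> p \<in> ?B" if "p \<in> ?J" for p
    unfolding B using that is_subringD(1,2)[OF subring_A] by auto
  then have "\<forall>p\<in>?J. \<exists>x. x \<in> M \<and> \<phi> x = ?\<delta> p" using \<phi>_surj by blast
  from bchoice[OF this] obtain e where 
    e: "\<And>p. p \<in> ?J \<Longrightarrow> e p \<in> M" "\<And>p. p \<in> ?J \<Longrightarrow> \<phi> (e p) = ?\<delta> p" by blast
  have M0: "0 \<in> M" by (rule submodule_overD(1)[OF M])
  have "\<phi> (scaleE 0 0) = (\<lambda>j. 0 * \<phi> 0 j)" by (rule \<phi>_scale[OF M0 is_subringD(1)[OF subring_R]])
  then have \<phi>0: "\<phi> 0 = (\<lambda>j. 0)" by simp
  have comb: "(\<Sum>p\<in>K. scaleE (c p) (e p)) \<in> M \<and> \<phi> (\<Sum>p\<in>K. scaleE (c p) (e p)) = (\<lambda>q. if q \<in> K then c q else 0)"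
    if "finite K" "K \<subseteq> ?J" "\<forall>p\<in>?J. c p \<in> R" for K c
    using that
  proof induction
    case empty
    then show ?case using M0 \<phi>0 by simp
  next
    case (insert p K)
    then have p: "p \<in> ?J" "c p \<in> R" by auto
    have cM: "scaleE (c p) (e p) \<in> M" by (rule submodule_overD(3)[OF M p(2) e(1)[OF p(1)]])
    have \<phi>c: "\<phi> (scaleE (c p) (e p)) = (\<lambda>q. c p * ?\<delta> p q)" using \<phi>_scale[OF e(1)[OF p(1)] p(2)] e(2)[OF p(1)] by simp
    let ?s = "\<Sum>p\<in>K. scaleE (c p) (e p)"
    have IH: "?s \<in> M" "\<phi> ?s = (\<lambda>q. if q \<in> K then c q else 0)" using insert by auto
    have s: "(\<Sum>p\<in>insert p K. scaleE (c p) (e p)) = scaleE (c p) (e p) + ?s" using insert.hyps by simp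
    have "\<phi> (scaleE (c p) (e p) + ?s) = (\<lambda>q. if q \<in> insert p K then c q else 0)"
      unfolding \<phi>_add[OF cM IH(1)] \<phi>c IH(2) using insert.hyps by (auto simp: fun_eq_iff)
    moreover have "scaleE (c p) (e p) + ?s \<in> M" by (rule submodule_overD(2)[OF M cM IH(1)])
    ultimately show ?case unfolding s by blast
  qed
  have into_R: "\<exists>n. \<forall>p\<in>?J. scaleQ (unif ^ n) (c p) \<in> R" for c
    using finite_scale_into[OF orderD(3,2,4)[OF order_R], of "c ` ?J"] finJ by (metis finite_imageI imageI)
  have uR: "scaleQ (unif ^ n) 1 \<in> R" for n by (rule scale_one_in_order[OF order_R unif_power_in_Z])
  have expand: "x = (\<Sum>p\<in>?J. scaleE (\<phi> x p) (e p))" if x: "x \<in> M" for x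
  proof -
    obtain n where n: "\<forall>p\<in>?J. scaleQ (unif ^ n) (\<phi> x p) \<in> R" using into_R by blast
    let ?c = "\<lambda>p. scaleQ (unif ^ n) (\<phi> x p)"
    note cb = comb[OF finJ subset_refl n]
    have xM: "scaleV (unif ^ n) x \<in> M" by (rule submodule_overD(3)[OF M uR x])
    have "\<phi> (scaleV (unif ^ n) x) = (\<lambda>p. scaleQ (unif ^ n) 1 * \<phi> x p)" by (rule \<phi>_scale[OF x uR])
    also have "\<dots> = (\<lambda>q. if q \<in> ?J then ?c q else 0)"
      using \<phi>B[OF x] unfolding B by (auto simp: fun_eq_iff scaleQ_mult[symmetric])
    also have "\<dots> = \<phi> (\<Sum>p\<in>?J. scaleE (?c p) (e p))" using cb by simp
    finally have "scaleV (unif ^ n) x = (\<Sum>p\<in>?J. scaleE (?c p) (e p))" using \<phi>_inj[OF xM] cb by blast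
    also have "\<dots> = scaleV (unif ^ n) (\<Sum>p\<in>?J. scaleE (\<phi> x p) (e p))"
      by (simp add: V.scale_sum_right scaleQ_mult[symmetric])
    finally show ?thesis by (rule scaleV_cancel[rotated]) (use unif(1) in simp)
  qed
  have LM: "latt ?J e = M"
  proof (intro equalityI subsetI)
    fix x assume x: "x \<in> M"
    have "(\<Sum>p\<in>?J. scaleE (\<phi> x p) (e p)) \<in> latt ?J e" by (rule lspanI) (use \<phi>B[OF x] B in blast)
    then show "x \<in> latt ?J e" using expand[OF x] by simp
  next
    fix x assume "x \<in> latt ?J e"
    then obtain c where c: "\<forall>p\<in>?J. c p \<in> Rs (fst p)" "x = (\<Sum>p\<in>?J. scaleE (c p) (e p))" by (rule lspanE)
    let ?f = "\<lambda>p. if p \<in> ?J then c p else 0"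
    have "?f \<in> ?B" unfolding B using c(1) by simp
    then obtain y where y: "y \<in> M" "\<phi> y = ?f" using \<phi>_surj by blast
    have "y = (\<Sum>p\<in>?J. scaleE (\<phi> y p) (e p))" by (rule expand[OF y(1)])
    also have "\<dots> = x" unfolding c(2) y(2) by (rule sum.cong) auto
    finally show "x \<in> M" using y(1) by simp
  qed
  have "lindep scaleE ?J e"
    unfolding lindep_def
  proof (intro allI impI ballI)
    fix c p assume c: "(\<Sum>p\<in>?J. scaleE (c p) (e p)) = 0" and p: "p \<in> ?J"
    obtain n where n: "\<forall>p\<in>?J. scaleQ (unif ^ n) (c p) \<in> R" using into_R by blast
    have "(\<Sum>p\<in>?J. scaleE (scaleQ (unif ^ n) (c p)) (e p)) = scaleV (unif ^ n) (\<Sum>p\<in>?J. scaleE (c p) (e p))"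
      by (simp add: V.scale_sum_right scaleQ_mult[symmetric])
    also have "\<dots> = 0" unfolding c by simp
    finally have "\<phi> 0 = (\<lambda>q. if q \<in> ?J then scaleQ (unif ^ n) (c q) else 0)" using comb[OF finJ subset_refl n] by simp
    then have "scaleQ (unif ^ n) (c p) = 0" unfolding \<phi>0 using p by (metis (no_types))
    then show "c p = 0" using unif(1) by simp
  qed
  moreover have "perfect_on ?J e"
    unfolding perfect_on_def
  proof (intro allI impI)
    fix t assume t: "\<forall>p\<in>?J. t p \<in> colon R (Rs (fst p))"
    \<comment> \<open>The form on \<open>M\<close> with the prescribed values at the basis. The
      coordinates lie in \<open>Rs (fst p)\<close> and multiply \<open>t p\<close> into
      \<open>R\<close>, so self-duality represents the form by some \<open>y\<close>.\<close>
    let ?f = "\<lambda>x. if x \<in> M then \<Sum>p\<in>?J. \<phi> x p * t p else 0"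
    have "(\<Sum>p\<in>?J. \<phi> x p * t p) \<in> R" if x: "x \<in> M" for x
    proof (rule submodule_over_sum[OF submodule_over_self[OF subring_R]])
      fix p assume p: "p \<in> ?J"
      then have "\<phi> x p \<in> Rs (fst p)" using \<phi>B[OF x] B by blast
      then have "t p * \<phi> x p \<in> R" using t p colonD by blast
      then show "\<phi> x p * t p \<in> R" by (simp add: mult.commute)
    qed
    then have "?f \<in> hom_over R scaleE M (*) R"
      unfolding hom_over_def using submodule_overD(2,3)[OF M]
      by (simp add: \<phi>_add \<phi>_scale distrib_right sum.distrib sum_distrib_left mult.assoc)
    then obtain y where y: "y \<in> M" "?f = (\<lambda>x. if x \<in> M then pairing x y else 0)"
      using sd unfolding self_dual_def perfect_over_def bij_betw_def by (metis (no_types, lifting) imageE)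
    have "pairing (e p) y = t p" if p: "p \<in> ?J" for p
    proof -
      have "pairing (e p) y = (\<Sum>q\<in>?J. \<phi> (e p) q * t q)" using fun_cong[OF y(2), of "e p"] e(1)[OF p] by simp
      also have "\<dots> = (\<Sum>q\<in>?J. if q = p then t q else 0)" unfolding e(2)[OF p] by (rule sum.cong) auto
      also have "\<dots> = t p" using p finJ by simp
      finally show ?thesis .
    qed
    then show "\<exists>y\<in>latt ?J e. \<forall>p\<in>?J. pairing (e p) y = t p" using y(1) LM by blast
  qed
  ultimately show ?thesis using LM by (intro that)
qed

end

theorem theorem1p5:
  fixes Z :: "'q::field set"
    and scaleQ :: "'q \<Rightarrow> 'e::comm_ring_1 \<Rightarrow> 'e"
    and R :: "'e set"
    and \<sigma> :: "'e \<Rightarrow> 'e"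
    and scaleE :: "'e \<Rightarrow> 'v::ab_group_add \<Rightarrow> 'v"
    and pairing :: "'v \<Rightarrow> 'v \<Rightarrow> 'e"
    and M :: "'v set"
    and m :: nat
    and Rs :: "nat \<Rightarrow> 'e set"
    and r :: "nat \<Rightarrow> nat"
    and \<alpha> :: "nat \<Rightarrow> 'e"
  assumes "complete_dvr Z"
    and "fd_algebra scaleQ"
    and "semisimple_ring TYPE('e)"
    and "bass_order Z scaleQ R" and "local_subring R"
    and "involution_over scaleQ \<sigma>" and "\<sigma> ` R \<subseteq> R"
    and "free_finite_rank scaleE"
    and "sesquilinear_over UNIV \<sigma> scaleE UNIV pairing" and "nondegenerate pairing"
    and "lattice_in scaleQ scaleE R M" and "self_dual R scaleE pairing M"
    and "structural_invariants Z scaleQ scaleE R M m Rs r"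
    and "\<forall>i\<in>{1..m}. colon R (Rs i) = (\<lambda>x. \<alpha> i * x) ` Rs i"
  shows "\<exists>Ms :: nat \<Rightarrow> 'v set.
     (\<forall>i\<in>{1..m}. Ms i \<subseteq> M \<and> submodule_over R scaleE (Ms i) \<and> fg_over R scaleE (Ms i)) \<and>
     internal_direct_sum m Ms M \<and>
     (\<forall>i\<in>{1..m}. \<forall>j\<in>{1..m}. i < j \<longrightarrow> (\<forall>x\<in>Ms i. \<forall>y\<in>Ms j. pairing x y = 0)) \<and>
     (\<forall>i\<in>{1..m}.
        free_over_of_rank (Rs i) scaleE (Ms i) (r i) \<and>
        (\<exists>p :: 'v \<Rightarrow> 'v \<Rightarrow> 'e.
           sesquilinear_over (Rs i) \<sigma> scaleE (Ms i) p \<and>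
           perfect_over (Rs i) scaleE (Ms i) p \<and>
           (\<forall>x\<in>Ms i. \<forall>y\<in>Ms i. pairing x y = \<alpha> i * p x y)))"
proof -
  obtain v where v: "discrete_valuation v" "Z = {x. x = 0 \<or> 0 \<le> v x}"
    using assms(1) unfolding complete_dvr_def by blast
  interpret vector_space scaleQ using assms(2) by (simp add: fd_algebra_def)
  interpret E: module scaleE using assms(8) by (simp add: free_finite_rank_def)
  interpret bass_blocks v Z scaleQ scaleE \<sigma> pairing R m Rs r \<alpha>
    by unfold_locales (use assms v in \<open>auto simp: fd_algebra_def structural_invariants_def\<close>)
  have M: "submodule_over R scaleE M" using assms(11) by (simp add: lattice_in_def)
  obtain \<phi> where \<phi>: "\<phi> \<in> hom_over R scaleE M (\<lambda>a f j. a * f j) (block_sum m Rs r)"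
    "bij_betw \<phi> M (block_sum m Rs r)"
    using assms(13) unfolding structural_invariants_def by blast
  obtain e0 where e0: "lindep scaleE (tail 1) e0" "latt (tail 1) e0 = M" "perfect_on (tail 1) e0"
    by (rule structural_basis[OF M assms(12) \<phi>])
  have int0: "integral_on (tail 1) e0"
    using assms(12) unfolding integral_on_def e0(2) self_dual_def by blast
  obtain e where e: "lindep scaleE (tail 1) e" "latt (tail 1) e = M"
    "\<forall>p\<in>tail 1. \<forall>q\<in>tail 1. fst p < fst q \<longrightarrow> pairing (e p) (e q) = 0"
    "\<forall>j\<in>{1..m}. perfect_on (block j) e"
    using orthogonal_basis[OF _ _ e0(1) int0 e0(3)] e0(2) by auto
  \<comment> \<open>Integrality depends only on the lattice, which the change of basis has
    preserved.\<close>
  have int: "integral_on (tail 1) e"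
    by (rule integral_on_subset[OF int0]) (simp only: e(2) e0(2) order_refl)
  let ?Ms = "\<lambda>i. latt (block i) e"
  show ?thesis
  proof (intro exI[of _ ?Ms] conjI ballI impI)
    fix i assume i: "i \<in> {1..m}"
    note bs = block_subset[OF i]
    show "?Ms i \<subseteq> M" using latt_mono[OF bs subset_refl, of e] e(2) by simp
    show "submodule_over R scaleE (?Ms i)" by (rule submodule_latt_R[OF bs])
    show "fg_over R scaleE (?Ms i)" by (rule fg_latt[OF i])
    show "free_over_of_rank (Rs i) scaleE (?Ms i) (r i)" by (rule free_block[OF i e(1)])
    have "perfect_on (block i) e" using e(4) i by blast
    from perfect_block[OF i int this] obtain p where "sesquilinear_over (Rs i) \<sigma> scaleE (?Ms i) p"
      "perfect_over (Rs i) scaleE (?Ms i) p" "\<forall>x\<in>?Ms i. \<forall>y\<in>?Ms i. pairing x y = \<alpha> i * p x y" .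
    then show "\<exists>p. sesquilinear_over (Rs i) \<sigma> scaleE (?Ms i) p \<and> perfect_over (Rs i) scaleE (?Ms i) p \<and>
      (\<forall>x\<in>?Ms i. \<forall>y\<in>?Ms i. pairing x y = \<alpha> i * p x y)" by blast
    fix j x y assume j: "j \<in> {1..m}" "i < j" and xy: "x \<in> ?Ms i" "y \<in> ?Ms j"
    show "pairing x y = 0"
    proof (rule pairing_latt_zero[OF _ xy])
      fix p q assume "p \<in> block i" "q \<in> block j"
      then show "pairing (e p) (e q) = 0"
        using e(3) bs block_subset[OF j(1)] fst_block j(2) by blast
    qed
  next
    show "internal_direct_sum m ?Ms M" using direct_sum_blocks[OF e(1)] unfolding e(2) .
  qed
qed

end
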